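(* Let $\lambda \in P^+_{\mathfrak b_{(2)}}$ and write $\lambda = \kappa\delta + a\varepsilon_1 + b\varepsilon_2$ with $(\kappa;a,b)\in\mathbb C^3$. Then $K_{\mathfrak b_{(2)}}(0)\cong\mathbb C$, and, for $\lambda\neq 0$, the $\mathfrak g$-module $K_{\mathfrak b_{(2)}}(\lambda)$ is irreducible if and only if $\kappa + a\neq 0$ and $\kappa + b\neq 0$.
   Context: All vector spaces are over $\mathbb C$. $\mathfrak g=\mathfrak{sl}(1|2)$ is the Lie superalgebra of $3\times 3$ complex matrices $A=(a_{ij})$ with $a_{11}-a_{22}-a_{33}=0$; the even part consists of block-diagonal matrices (blocks of size $1$ and $2$), the odd part of block-off-diagonal matrices, and $[A,B]=AB-(-1)^{\bar i\bar j}BA$ for $A,B$ of parity $\bar i,\bar j$. Let $E_{i,j}$ be the matrix units, $x_1=E_{1,2}$, $x_2=E_{2,3}$, $x_3=E_{1,3}$, $y_i=x_i^t$ (transpose), $h_1=E_{1,1}+E_{2,2}$, $h_2=E_{2,2}-E_{3,3}$. The Cartan subalgebra is $\mathfrak h=\mathrm{span}\{h_1,h_2\}$, and $\delta,\varepsilon_1,\varepsilon_2\in\mathfrak h^*$ send $\mathrm{diag}(a,b_1,b_2)$ to $a,b_1,b_2$ respectively. For $\lambda\in\mathfrak h^*$ write $\lambda_i=\lambda(h_i)$. The Borel subalgebra $\mathfrak b_{(2)}=\mathfrak h\oplus\mathfrak n^+$ has $\mathfrak n^+=\mathrm{span}\{y_1,x_2,x_3\}$. $\mathfrak g$-modules are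 $\mathbb Z_2$-graded; module homomorphisms are linear maps commuting with the action and need not preserve parity. $P^+_{\mathfrak b_{(2)}}$ is the set of $\lambda\in\mathfrak h^*$ such that the irreducible $\mathfrak g$-module of highest weight $\lambda$ with respect to $\mathfrak b_{(2)}$ is finite dimensional. For $\lambda\in P^+_{\mathfrak b_{(2)}}$, the generalized Kac module $K_{\mathfrak b_{(2)}}(\lambda)$ is the quotient of the universal enveloping superalgebra $\mathbf U(\mathfrak g)$ by the left ideal generated by $\mathfrak n^+$, $h-\lambda(h)$ ($h\in\mathfrak h$) and $y_2^{\lambda_2+1}$. *)

theory Defs
  imports
    "HOL-Analysis.Analysis"
    "HOL-Algebra.Module"
    "HOL-Library.Poly_Mapping"
    "HOL-Library.Z2"
begin

section \<open>The Lie superalgebra sl(1|2)\<close>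

text \<open>Parities are elements of the field \<open>bit\<close> with two elements. The function \<open>koszul\<close> is the
  sign \<open>(-1)^(p q)\<close>.\<close>

definition koszul :: "bit \<Rightarrow> bit \<Rightarrow> 'a::ring_1" where
  "koszul p q = (if p = 1 \<and> q = 1 then - 1 else 1)"

definition index_parity :: "3 \<Rightarrow> bit" where
  "index_parity i = (if i = 1 then 0 else 1)"

text \<open>The block-diagonal (\<open>p = 0\<close>) and block-off-diagonal (\<open>p = 1\<close>) component of a matrix, for
  blocks of size 1 and 2.\<close>

definition matrix_part :: "bit \<Rightarrow> complex^3^3 \<Rightarrow> complex^3^3" where
  "matrix_part p A = (\<chi> i j. if index_parity i + index_parity j = p then A $ i $ j else 0)"

text \<open>The supercommutator, extended bilinearly from homogeneous matrices.\<close>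

definition supercommutator :: "complex^3^3 \<Rightarrow> complex^3^3 \<Rightarrow> complex^3^3" where
  "supercommutator A B =
     (\<Sum>p\<in>{0, 1}. \<Sum>q\<in>{0, 1}. matrix_part p A ** matrix_part q B
        - koszul p q *\<^sub>R (matrix_part q B ** matrix_part p A))"

definition matrix_unit :: "3 \<Rightarrow> 3 \<Rightarrow> complex^3^3" where
  "matrix_unit i j = (\<chi> k l. if k = i \<and> l = j then 1 else 0)"

typedef sl12 = "{A :: complex^3^3. A $ 1 $ 1 - A $ 2 $ 2 - A $ 3 $ 3 = 0}"
  morphisms mat_of_sl12 sl12_of_mat
  by (rule exI[of _ 0]) simp

setup_lifting type_definition_sl12

instantiation sl12 :: ab_group_add
begin

lift_definition zero_sl12 :: sl12 is 0 by simp
lift_definition plus_sl12 :: "sl12 \<Rightarrow> sl12 \<Rightarrow> sl12" is "(+)"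
  by (simp only: vector_add_component diff_diff_eq right_minus_eq) simp
lift_definition minus_sl12 :: "sl12 \<Rightarrow> sl12 \<Rightarrow> sl12" is "(-)"
  by (simp only: vector_minus_component diff_diff_eq right_minus_eq) simp
lift_definition uminus_sl12 :: "sl12 \<Rightarrow> sl12" is "uminus"
  by (simp only: vector_uminus_component diff_diff_eq right_minus_eq) simp

instance
proof
  fix a b c :: sl12
  show "a + b + c = a + (b + c)" by transfer (rule add.assoc)
  show "a + b = b + a" by transfer (rule add.commute)
  show "0 + a = a" by transfer (rule add_0_left)
  show "- a + a = 0" by transfer (rule left_minus)
  show "a - b = a + - b" by transfer (rule diff_conv_add_uminus)
qed

end

lift_definition sl12_scale :: "complex \<Rightarrow> sl12 \<Rightarrow> sl12" is "\<lambda>c A. \<chi> i j. c * A $ i $ j"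
  by (simp only: vec_lambda_beta diff_diff_eq right_minus_eq) (simp add: distrib_left)

interpretation sl12: vector_space sl12_scale
  by standard (transfer; simp add: vec_eq_iff algebra_simps)+

lemma supertrace_supercommutator:
  "supercommutator A B $ 1 $ 1 - supercommutator A B $ 2 $ 2 - supercommutator A B $ 3 $ 3 = 0"
proof -
  have [simp]: "index_parity 1 = 0" "index_parity 2 = 1" "index_parity 3 = 1"
    by (simp_all add: index_parity_def)
  have [simp]: "matrix_part p C $ i $ j = (if index_parity i + index_parity j = p then C $ i $ j else 0)"
    for p C i j
    by (simp add: matrix_part_def)
  have [simp]: "(C ** D) $ i $ j = C $ i $ 1 * D $ 1 $ j + C $ i $ 2 * D $ 2 $ j + C $ i $ 3 * D $ 3 $ j"
    for C D :: "complex^3^3" and i j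
    by (simp add: matrix_matrix_mult_def sum_3)
  show ?thesis
    by (simp add: supercommutator_def koszul_def)
qed

lift_definition sl12_bracket :: "sl12 \<Rightarrow> sl12 \<Rightarrow> sl12" is supercommutator
  by (rule supertrace_supercommutator)

definition sl12_part :: "bit \<Rightarrow> sl12 set" where
  "sl12_part p = {A. matrix_part p (mat_of_sl12 A) = mat_of_sl12 A}"

lift_definition x1 :: sl12 is "matrix_unit 1 2" by (simp add: matrix_unit_def)
lift_definition x2 :: sl12 is "matrix_unit 2 3" by (simp add: matrix_unit_def)
lift_definition x3 :: sl12 is "matrix_unit 1 3" by (simp add: matrix_unit_def)
lift_definition y1 :: sl12 is "transpose (matrix_unit 1 2)" by (simp add: matrix_unit_def transpose_def)
lift_definition y2 :: sl12 is "transpose (matrix_unit 2 3)" by (simp add: matrix_unit_def transpose_def)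
lift_definition y3 :: sl12 is "transpose (matrix_unit 1 3)" by (simp add: matrix_unit_def transpose_def)
lift_definition h1 :: sl12 is "matrix_unit 1 1 + matrix_unit 2 2" by (simp add: matrix_unit_def)
lift_definition h2 :: sl12 is "matrix_unit 2 2 - matrix_unit 3 3" by (simp add: matrix_unit_def)

definition cartan :: "sl12 set" where
  "cartan = sl12.span {h1, h2}"

definition nplus :: "sl12 set" where
  "nplus = sl12.span {y1, x2, x3}"

text \<open>Linear functionals on the Cartan subalgebra are represented by their extension by zero to all
  of \<open>sl12\<close>, so that equal functionals are equal as functions.\<close>

definition cartan_dual :: "(sl12 \<Rightarrow> complex) set" where
  "cartan_dual = {l. (\<forall>h. h \<notin> cartan \<longrightarrow> l h = 0) \<and>
     (\<forall>h\<in>cartan. \<forall>k\<in>cartan. l (h + k) = l h + l k) \<and>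
     (\<forall>c. \<forall>h\<in>cartan. l (sl12_scale c h) = c * l h)}"

definition delta :: "sl12 \<Rightarrow> complex" where
  "delta h = (if h \<in> cartan then mat_of_sl12 h $ 1 $ 1 else 0)"

definition eps1 :: "sl12 \<Rightarrow> complex" where
  "eps1 h = (if h \<in> cartan then mat_of_sl12 h $ 2 $ 2 else 0)"

definition eps2 :: "sl12 \<Rightarrow> complex" where
  "eps2 h = (if h \<in> cartan then mat_of_sl12 h $ 3 $ 3 else 0)"


section \<open>The universal enveloping superalgebra\<close>

instantiation list :: (type) monoid_add
begin

definition zero_list :: "'a list" where "zero_list = []"
definition plus_list :: "'a list \<Rightarrow> 'a list \<Rightarrow> 'a list" where "plus_list = (@)"

instance
  by standard (simp_all add: zero_list_def plus_list_def)

end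

text \<open>The monoid algebra of the monoid of words is the free associative algebra on the set \<open>sl12\<close>;
  linearity of the embedding of \<open>sl12\<close> is imposed together with the commutation relations.\<close>

type_synonym free_algebra = "sl12 list \<Rightarrow>\<^sub>0 complex"

abbreviation free_gen :: "sl12 \<Rightarrow> free_algebra" where
  "free_gen x \<equiv> Poly_Mapping.single [x] 1"

abbreviation free_scalar :: "complex \<Rightarrow> free_algebra" where
  "free_scalar c \<equiv> Poly_Mapping.single [] c"

inductive_set two_sided_ideal :: "'a::ring_1 set \<Rightarrow> 'a set" for S :: "'a set" where
  zero: "0 \<in> two_sided_ideal S"
| gen: "s \<in> S \<Longrightarrow> s \<in> two_sided_ideal S"
| add: "u \<in> two_sided_ideal S \<Longrightarrow> w \<in> two_sided_ideal S \<Longrightarrow> u + w \<in> two_sided_ideal S"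
| mult_left: "u \<in> two_sided_ideal S \<Longrightarrow> r * u \<in> two_sided_ideal S"
| mult_right: "u \<in> two_sided_ideal S \<Longrightarrow> u * r \<in> two_sided_ideal S"

inductive_set left_ideal :: "'a::ring_1 set \<Rightarrow> 'a set" for S :: "'a set" where
  zero: "0 \<in> left_ideal S"
| gen: "s \<in> S \<Longrightarrow> s \<in> left_ideal S"
| add: "u \<in> left_ideal S \<Longrightarrow> w \<in> left_ideal S \<Longrightarrow> u + w \<in> left_ideal S"
| mult_left: "u \<in> left_ideal S \<Longrightarrow> r * u \<in> left_ideal S"

definition uenv_relations :: "free_algebra set" where
  "uenv_relations =
     {free_gen (x + y) - free_gen x - free_gen y | x y. True} \<union>
     {free_gen (sl12_scale c x) - free_scalar c * free_gen x | c x. True} \<union>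
     {free_gen x * free_gen y - koszul p q * free_gen y * free_gen x - free_gen (sl12_bracket x y)
       | x y p q. x \<in> sl12_part p \<and> y \<in> sl12_part q}"

definition uenv_eq :: "free_algebra \<Rightarrow> free_algebra \<Rightarrow> bool" where
  "uenv_eq u w \<longleftrightarrow> u - w \<in> two_sided_ideal uenv_relations"

lemma two_sided_ideal_uminus: "u \<in> two_sided_ideal S \<Longrightarrow> - u \<in> two_sided_ideal S"
  using two_sided_ideal.mult_left[of u S "- 1"] by simp

lemma uenv_eq_refl: "uenv_eq u u"
  by (simp add: uenv_eq_def two_sided_ideal.zero)

lemma uenv_eq_sym: "uenv_eq u w \<Longrightarrow> uenv_eq w u"
  unfolding uenv_eq_def using two_sided_ideal_uminus[of "u - w"] by simp

lemma uenv_eq_add: "uenv_eq u w \<Longrightarrow> uenv_eq u' w' \<Longrightarrow> uenv_eq (u + u') (w + w')"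
  unfolding uenv_eq_def
  using two_sided_ideal.add[of "u - w" _ "u' - w'"] by (simp add: algebra_simps)

lemma uenv_eq_uminus: "uenv_eq u w \<Longrightarrow> uenv_eq (- u) (- w)"
  unfolding uenv_eq_def using two_sided_ideal_uminus[of "u - w"] by simp

lemma uenv_eq_trans: "uenv_eq u w \<Longrightarrow> uenv_eq w z \<Longrightarrow> uenv_eq u z"
  unfolding uenv_eq_def
  using two_sided_ideal.add[of "u - w" _ "w - z"] by simp

lemma uenv_eq_mult: "uenv_eq u w \<Longrightarrow> uenv_eq u' w' \<Longrightarrow> uenv_eq (u * u') (w * w')"
  unfolding uenv_eq_def
  using two_sided_ideal.add[OF two_sided_ideal.mult_right[of "u - w" _ u']
      two_sided_ideal.mult_left[of "u' - w'" _ w]]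
  by (simp add: algebra_simps)

quotient_type uenv = free_algebra / uenv_eq
  by (rule equivpI; (rule reflpI | rule sympI | rule transpI);
      (rule uenv_eq_refl | erule uenv_eq_sym | erule (1) uenv_eq_trans))

text \<open>The coefficient of the empty word is multiplicative and vanishes on the defining ideal.\<close>

lemma lookup_Nil_times: "Poly_Mapping.lookup (u * w :: free_algebra) [] = Poly_Mapping.lookup u [] * Poly_Mapping.lookup w []"
proof -
  have "(\<Sum>q. Poly_Mapping.lookup w q when [] = l + q) = (Poly_Mapping.lookup w [] when l = [])" for l :: "sl12 list"
    by (cases l) (simp_all add: plus_list_def)
  then show ?thesis
    by (simp add: times_poly_mapping.rep_eq prod_fun_def mult_when)
qed

lemma two_sided_ideal_lookup_Nil:
  "u \<in> two_sided_ideal uenv_relations \<Longrightarrow> Poly_Mapping.lookup u [] = 0"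
  by (induction rule: two_sided_ideal.induct)
    (auto simp: uenv_relations_def lookup_Nil_times lookup_add lookup_minus lookup_single)

lemma not_uenv_eq_0_1: "\<not> uenv_eq 0 1"
  using two_sided_ideal_lookup_Nil[of "0 - 1"]
  by (auto simp: uenv_eq_def lookup_minus lookup_one zero_list_def)

instantiation uenv :: ring_1
begin

lift_definition zero_uenv :: uenv is 0 .
lift_definition one_uenv :: uenv is 1 .
lift_definition plus_uenv :: "uenv \<Rightarrow> uenv \<Rightarrow> uenv" is "(+)" by (rule uenv_eq_add)
lift_definition uminus_uenv :: "uenv \<Rightarrow> uenv" is uminus by (rule uenv_eq_uminus)
lift_definition minus_uenv :: "uenv \<Rightarrow> uenv \<Rightarrow> uenv" is "(-)"
  using uenv_eq_add[OF _ uenv_eq_uminus] by simp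
lift_definition times_uenv :: "uenv \<Rightarrow> uenv \<Rightarrow> uenv" is "(*)" by (rule uenv_eq_mult)

instance
proof
  fix a b c :: uenv
  show "a * b * c = a * (b * c)" by transfer (simp add: mult.assoc uenv_eq_refl)
  show "1 * a = a" "a * 1 = a" by (transfer; simp add: uenv_eq_refl)+
  show "a + b + c = a + (b + c)" by transfer (simp add: add.assoc uenv_eq_refl)
  show "a + b = b + a" by transfer (simp add: add.commute uenv_eq_refl)
  show "0 + a = a" by transfer (simp add: uenv_eq_refl)
  show "- a + a = 0" by transfer (simp add: uenv_eq_refl)
  show "a - b = a + - b" by transfer (simp add: uenv_eq_refl)
  show "(a + b) * c = a * c + b * c" by transfer (simp add: distrib_right uenv_eq_refl)
  show "a * (b + c) = a * b + a * c" by transfer (simp add: distrib_left uenv_eq_refl)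
  show "(0::uenv) \<noteq> 1" by transfer (rule not_uenv_eq_0_1)
qed

end

lift_definition uenv_gen :: "sl12 \<Rightarrow> uenv" is free_gen .

lift_definition uenv_scalar :: "complex \<Rightarrow> uenv" is free_scalar .

text \<open>The homogeneous parts: \<open>p\<close> is the sum of the parities of the factors of each monomial.\<close>

inductive uenv_homogeneous :: "bit \<Rightarrow> uenv \<Rightarrow> bool" where
  scalar: "uenv_homogeneous 0 (uenv_scalar c)"
| gen_mult: "x \<in> sl12_part p \<Longrightarrow> uenv_homogeneous q u \<Longrightarrow> uenv_homogeneous (p + q) (uenv_gen x * u)"
| add: "uenv_homogeneous p u \<Longrightarrow> uenv_homogeneous p w \<Longrightarrow> uenv_homogeneous p (u + w)"


section \<open>Modules\<close>

definition complex_ring :: "complex ring" where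
  "complex_ring = \<lparr>carrier = UNIV, monoid.mult = (*), one = 1, ring.zero = 0, add = (+)\<rparr>"

record 'v sl12_module = "(complex, 'v) module" +
  grade :: "bit \<Rightarrow> 'v set"
  act :: "sl12 \<Rightarrow> 'v \<Rightarrow> 'v"

locale sl12_module = Module.module complex_ring V for V :: "('v, 'm) sl12_module_scheme" (structure) +
  assumes grade_submodule: "submodule (grade V p) complex_ring V"
    and grade_Int: "grade V 0 \<inter> grade V 1 = {\<zero>\<^bsub>V\<^esub>}"
    and grade_decomp: "v \<in> carrier V \<Longrightarrow> \<exists>u\<in>grade V 0. \<exists>w\<in>grade V 1. v = u \<oplus>\<^bsub>V\<^esub> w"
    and act_closed: "v \<in> carrier V \<Longrightarrow> act V x v \<in> carrier V"
    and act_add: "v \<in> carrier V \<Longrightarrow> act V (x + y) v = act V x v \<oplus>\<^bsub>V\<^esub> act V y v"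
    and act_scale: "v \<in> carrier V \<Longrightarrow> act V (sl12_scale c x) v = c \<odot>\<^bsub>V\<^esub> act V x v"
    and act_add_right: "v \<in> carrier V \<Longrightarrow> w \<in> carrier V \<Longrightarrow>
      act V x (v \<oplus>\<^bsub>V\<^esub> w) = act V x v \<oplus>\<^bsub>V\<^esub> act V x w"
    and act_scale_right: "v \<in> carrier V \<Longrightarrow> act V x (c \<odot>\<^bsub>V\<^esub> v) = c \<odot>\<^bsub>V\<^esub> act V x v"
    and act_grade: "x \<in> sl12_part p \<Longrightarrow> v \<in> grade V q \<Longrightarrow> act V x v \<in> grade V (p + q)"
    and act_bracket: "x \<in> sl12_part p \<Longrightarrow> y \<in> sl12_part q \<Longrightarrow> v \<in> carrier V \<Longrightarrow>
      act V (sl12_bracket x y) v =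
        act V x (act V y v) \<ominus>\<^bsub>V\<^esub> koszul p q \<odot>\<^bsub>V\<^esub> act V y (act V x v)"

definition sl12_submodule :: "'v set \<Rightarrow> ('v, 'm) sl12_module_scheme \<Rightarrow> bool" where
  "sl12_submodule W V \<longleftrightarrow> submodule W complex_ring V \<and>
     (\<forall>x. \<forall>w\<in>W. act V x w \<in> W) \<and>
     (\<forall>w\<in>W. \<exists>u\<in>W \<inter> grade V 0. \<exists>u'\<in>W \<inter> grade V 1. w = u \<oplus>\<^bsub>V\<^esub> u')"

definition irreducible_sl12_module :: "('v, 'm) sl12_module_scheme \<Rightarrow> bool" where
  "irreducible_sl12_module V \<longleftrightarrow> sl12_module V \<and> carrier V \<noteq> {\<zero>\<^bsub>V\<^esub>} \<and>
     (\<forall>W. sl12_submodule W V \<longrightarrow> W = {\<zero>\<^bsub>V\<^esub>} \<or> W = carrier V)"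

text \<open>Homomorphisms need not preserve the grading.\<close>

definition sl12_hom :: "('v, 'm) sl12_module_scheme \<Rightarrow> ('w, 'n) sl12_module_scheme \<Rightarrow> ('v \<Rightarrow> 'w) set" where
  "sl12_hom V W = {f. f \<in> carrier V \<rightarrow> carrier W \<and>
     (\<forall>v\<in>carrier V. \<forall>w\<in>carrier V. f (v \<oplus>\<^bsub>V\<^esub> w) = f v \<oplus>\<^bsub>W\<^esub> f w) \<and>
     (\<forall>c. \<forall>v\<in>carrier V. f (c \<odot>\<^bsub>V\<^esub> v) = c \<odot>\<^bsub>W\<^esub> f v) \<and>
     (\<forall>x. \<forall>v\<in>carrier V. f (act V x v) = act W x (f v))}"

definition sl12_isomorphic :: "('v, 'm) sl12_module_scheme \<Rightarrow> ('w, 'n) sl12_module_scheme \<Rightarrow> bool" where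
  "sl12_isomorphic V W \<longleftrightarrow> sl12_module V \<and> sl12_module W \<and>
     (\<exists>f\<in>sl12_hom V W. bij_betw f (carrier V) (carrier W))"

definition finite_dimensional :: "('v, 'm) sl12_module_scheme \<Rightarrow> bool" where
  "finite_dimensional V \<longleftrightarrow> (\<exists>B. finite B \<and> B \<subseteq> carrier V \<and>
     (\<forall>W. submodule W complex_ring V \<and> B \<subseteq> W \<longrightarrow> W = carrier V))"

definition trivial_module :: "complex sl12_module" where
  "trivial_module = \<lparr>carrier = UNIV, monoid.mult = (*), one = 1, ring.zero = 0, add = (+),
     smult = (*), grade = (\<lambda>p. if p = 0 then UNIV else {0}), act = (\<lambda>x v. 0)\<rparr>"

definition highest_weight_vector ::
    "('v, 'm) sl12_module_scheme \<Rightarrow> (sl12 \<Rightarrow> complex) \<Rightarrow> 'v \<Rightarrow> bool" where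
  "highest_weight_vector V l v \<longleftrightarrow> v \<in> carrier V \<and> v \<noteq> \<zero>\<^bsub>V\<^esub> \<and>
     (\<forall>x\<in>nplus. act V x v = \<zero>\<^bsub>V\<^esub>) \<and> (\<forall>h\<in>cartan. act V h v = l h \<odot>\<^bsub>V\<^esub> v)"

text \<open>An irreducible module with a highest weight vector is cyclic, hence isomorphic to a quotient of
  the enveloping superalgebra; so modules carried by the type \<open>uenv set\<close> of cosets suffice here.\<close>

definition Pplus :: "(sl12 \<Rightarrow> complex) set" where
  "Pplus = {l \<in> cartan_dual. \<exists>V :: uenv set sl12_module. irreducible_sl12_module V \<and>
     (\<exists>v. highest_weight_vector V l v) \<and> finite_dimensional V}"


section \<open>Generalized Kac modules\<close>

text \<open>The quotient of the enveloping superalgebra by a left ideal \<open>J\<close>. The multiplication and unit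
  fields, which the record inherits from rings, play no role for modules.\<close>

definition uenv_quotient :: "uenv set \<Rightarrow> uenv set sl12_module" where
  "uenv_quotient J = \<lparr>carrier = range (\<lambda>u. (+) u ` J),
     monoid.mult = undefined, one = undefined,
     ring.zero = J,
     add = (\<lambda>A B. {u + w | u w. u \<in> A \<and> w \<in> B}),
     smult = (\<lambda>c A. {uenv_scalar c * u + j | u j. u \<in> A \<and> j \<in> J}),
     grade = (\<lambda>p. (\<lambda>u. (+) u ` J) ` {u. uenv_homogeneous p u}),
     act = (\<lambda>x A. {uenv_gen x * u + j | u j. u \<in> A \<and> j \<in> J})\<rparr>"

text \<open>For \<open>l\<close> in \<open>Pplus\<close> the number \<open>l h2\<close> is a natural number, so that the last set of
  relations has exactly one element.\<close>

definition kac_relations :: "(sl12 \<Rightarrow> complex) \<Rightarrow> uenv set" where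
  "kac_relations l = uenv_gen ` nplus \<union>
     {uenv_gen h - uenv_scalar (l h) | h. h \<in> cartan} \<union>
     {uenv_gen y2 ^ (n + 1) | n. of_nat n = l h2}"

definition kac_module :: "(sl12 \<Rightarrow> complex) \<Rightarrow> uenv set sl12_module" where
  "kac_module l = uenv_quotient (left_ideal (kac_relations l))"

end

theory Submission
  imports Defs "HOL-Computational_Algebra.Formal_Power_Series"
begin

text \<open>Write \<open>v\<close> for the generator of \<open>K(\<lambda>)\<close> and \<open>\<lambda>\<^sub>1 = \<lambda>(h\<^sub>1)\<close>, \<open>\<lambda>\<^sub>2 = \<lambda>(h\<^sub>2)\<close>. In the coordinates of
the theorem \<open>\<kappa> + a = \<lambda>\<^sub>1\<close> and \<open>\<kappa> + b = \<lambda>\<^sub>1 - \<lambda>\<^sub>2\<close>, and these are the scalars in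
\<open>y\<^sub>1 x\<^sub>1 v = \<lambda>\<^sub>1 v\<close> and \<open>x\<^sub>3 y\<^sub>3 v = (\<lambda>\<^sub>1 - \<lambda>\<^sub>2) v\<close>. They decide whether one can return to \<open>v\<close>
from \<open>x\<^sub>1 v\<close> and from \<open>y\<^sub>3 v\<close>.

Dominance. On a finite-dimensional module \<open>h\<^sub>2\<close> has finitely many eigenvalues, so
\<open>y\<^sub>2\<^sup>k v = 0\<close> for some \<open>k\<close>, and the representation theory of \<open>sl(2) = \<langle>x\<^sub>2, h\<^sub>2, y\<^sub>2\<rangle>\<close> makes \<open>\<lambda>\<^sub>2\<close> a natural
number. If \<open>\<lambda>\<^sub>2 = 0\<close> then \<open>y\<^sub>2 v = 0\<close>, hence \<open>x\<^sub>1 v = [x\<^sub>3, y\<^sub>2] v = 0\<close> and \<open>\<lambda>\<^sub>1 v = y\<^sub>1 x\<^sub>1 v = 0\<close>. So a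
nonzero dominant weight has \<open>\<lambda>\<^sub>2 = n + 1\<close> (\<open>Pplus_cases\<close>).

Typical weights. The module \<open>K(\<lambda>)\<close> is spanned over \<open>\<complex>[y\<^sub>2]\<close> by \<open>v\<close>, \<open>x\<^sub>1 v\<close>, \<open>y\<^sub>3 v\<close> and
\<open>z = y\<^sub>3 x\<^sub>1 v - (\<lambda>\<^sub>1/\<lambda>\<^sub>2) y\<^sub>2 v\<close> (\<open>spanned_below\<close>). These are \<open>sl(2)\<close>-highest weight vectors of weights \<open>\<lambda>\<^sub>2\<close>, \<open>\<lambda>\<^sub>2 - 1\<close>,
\<open>\<lambda>\<^sub>2 - 1\<close>, \<open>\<lambda>\<^sub>2 - 2\<close>, each killed by the power of \<open>y\<^sub>2\<close> that the weight prescribes, and the Cartan subalgebra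
separates them. Raising a nonzero element of a submodule by a suitable power of \<open>x\<^sub>2\<close> leads to a nonzero
combination of the four (\<open>descent\<close>), so the submodule contains one of them. From \<open>x\<^sub>1 v\<close> and
\<open>y\<^sub>3 v\<close> one returns to \<open>v\<close> when the two scalars are nonzero, and \<open>y\<^sub>1 z\<close> is a nonzero multiple of \<open>y\<^sub>3 v\<close> unless
\<open>z = 0\<close> (\<open>typical_ideal\<close>).

Atypical weights. If \<open>\<lambda>\<^sub>1 = 0\<close>, the vector \<open>x\<^sub>1 v\<close> is nonzero and generates a submodule that does not contain \<open>v\<close>,
and likewise \<open>y\<^sub>3 v\<close> if \<open>\<lambda>\<^sub>1 = \<lambda>\<^sub>2\<close> (\<open>x1_not_generating\<close>, \<open>y3_not_generating\<close>).

Nonvanishing. A presentation by generators and relations bounds a module only from above. That \<open>K(\<lambda>)\<close> is not zero,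
that \<open>x\<^sub>1 v\<close> and \<open>y\<^sub>3 v\<close> are not zero in it, and that \<open>v\<close> does not lie in the two submodules, is
read off from a concrete module: a completion of the Verma module, realised on quadruples of power series in \<open>t = y\<^sub>2\<close> by differential
operators (\<open>verma_rho\<close>), and three explicit invariant subspaces of it.

For \<open>\<lambda> = 0\<close> the relations contain or imply all generators, so the defining left ideal is the augmentation ideal
(\<open>kac_ideal_zero\<close>).\<close>

section \<open>Calculations in the enveloping superalgebra\<close>

lemma uenv_eqI: "u - w \<in> uenv_relations \<Longrightarrow> uenv_eq u w"
  by (simp add: uenv_eq_def two_sided_ideal.gen)

lemma uenv_abs_eqs:
  "abs_uenv (free_gen x) = uenv_gen x" "abs_uenv (u * w) = abs_uenv u * abs_uenv w"
  "abs_uenv (u + w) = abs_uenv u + abs_uenv w" "abs_uenv (- u) = - abs_uenv u"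
  by (simp_all add: uenv_gen.abs_eq times_uenv.abs_eq plus_uenv.abs_eq uminus_uenv.abs_eq)

lemma uenv_gen_add: "uenv_gen (x + y) = uenv_gen x + uenv_gen y"
  by transfer (rule uenv_eqI, auto simp: uenv_relations_def diff_diff_eq)

lemma uenv_gen_scale: "uenv_gen (sl12_scale c x) = uenv_scalar c * uenv_gen x"
  by transfer (rule uenv_eqI, auto simp: uenv_relations_def)

lemma uenv_gen_mult_bracket:
  assumes "x \<in> sl12_part p" "y \<in> sl12_part q"
  shows "uenv_gen x * uenv_gen y = koszul p q * uenv_gen y * uenv_gen x + uenv_gen (sl12_bracket x y)"
proof -
  have "free_gen x * free_gen y - koszul p q * free_gen y * free_gen x - free_gen (sl12_bracket x y)
      \<in> uenv_relations"
    unfolding uenv_relations_def using assms by blast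
  then have rel: "uenv_eq (free_gen x * free_gen y)
      (koszul p q * free_gen y * free_gen x + free_gen (sl12_bracket x y))"
    by (intro uenv_eqI) (simp add: diff_diff_eq)
  show ?thesis
  proof (cases "p = 1 \<and> q = 1")
    case True
    with rel have "uenv_eq (free_gen x * free_gen y)
        (- (free_gen y * free_gen x) + free_gen (sl12_bracket x y))"
      by (simp add: koszul_def)
    then have "uenv_gen x * uenv_gen y = - (uenv_gen y * uenv_gen x) + uenv_gen (sl12_bracket x y)"
      unfolding uenv.abs_eq_iff[symmetric] by (simp only: uenv_abs_eqs)
    with True show ?thesis by (simp add: koszul_def)
  next
    case False
    with rel have "uenv_eq (free_gen x * free_gen y)
        (free_gen y * free_gen x + free_gen (sl12_bracket x y))"
      by (auto simp: koszul_def)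
    then have "uenv_gen x * uenv_gen y = uenv_gen y * uenv_gen x + uenv_gen (sl12_bracket x y)"
      unfolding uenv.abs_eq_iff[symmetric] by (simp only: uenv_abs_eqs)
    with False show ?thesis by (auto simp: koszul_def)
  qed
qed

lemma uenv_scalar_add: "uenv_scalar (c + d) = uenv_scalar c + uenv_scalar d"
  by transfer (simp add: single_add uenv_eq_refl)

lemma uenv_scalar_mult: "uenv_scalar (c * d) = uenv_scalar c * uenv_scalar d"
  by transfer (simp add: mult_single plus_list_def uenv_eq_refl)

lemma uenv_scalar_0 [simp]: "uenv_scalar 0 = 0"
  by transfer (simp add: uenv_eq_refl)

lemma uenv_scalar_1 [simp]: "uenv_scalar 1 = 1"
proof -
  have "Poly_Mapping.single [] 1 = (1 :: free_algebra)"
    by (metis single_one zero_list_def)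
  then show ?thesis
    by transfer (simp add: uenv_eq_refl)
qed

lemma uenv_scalar_minus: "uenv_scalar (- c) = - uenv_scalar c"
  using uenv_scalar_add[of c "- c"] by (simp add: eq_neg_iff_add_eq_0 add.commute)

lemma uenv_scalar_diff: "uenv_scalar (c - d) = uenv_scalar c - uenv_scalar d"
  using uenv_scalar_add[of c "- d"] by (simp add: uenv_scalar_minus)

lemma uenv_scalar_of_nat: "uenv_scalar (of_nat k) = of_nat k"
  by (induction k) (simp_all add: uenv_scalar_add)

lemma free_algebra_induct_single [case_names single add]:
  fixes u :: free_algebra
  assumes single: "\<And>xs c. P (Poly_Mapping.single xs c)"
    and add: "\<And>u w. P u \<Longrightarrow> P w \<Longrightarrow> P (u + w)"
  shows "P u"
proof -
  have sum: "P (\<Sum>k\<in>A. Poly_Mapping.single k (Poly_Mapping.lookup u k))" if "finite A" for A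
    using that by (induction A) (use single[of "[]" 0] in \<open>auto intro: single add\<close>)
  have "u = (\<Sum>k\<in>Poly_Mapping.keys u. Poly_Mapping.single k (Poly_Mapping.lookup u k))"
    by (rule poly_mapping_eqI)
      (auto simp: lookup_sum lookup_single when_def in_keys_iff if_distrib[of "Poly_Mapping.lookup _"] cong: if_cong)
  then show ?thesis using sum[of "Poly_Mapping.keys u"] by simp
qed

lemma free_algebra_induct [case_names scalar gen_mult add]:
  fixes u :: free_algebra
  assumes scalar: "\<And>c. P (free_scalar c)"
    and gen_mult: "\<And>x u. P u \<Longrightarrow> P (free_gen x * u)"
    and add: "\<And>u w. P u \<Longrightarrow> P w \<Longrightarrow> P (u + w)"
  shows "P u"
proof (induction u rule: free_algebra_induct_single)
  case (single xs c)
  show ?case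
  proof (induction xs)
    case (Cons x xs)
    then show ?case using gen_mult[OF Cons, of x] by (simp add: mult_single plus_list_def)
  qed (rule scalar)
qed (rule add)

text \<open>Words are built by multiplying generators from the left, which is the form in which left ideals and
actions on a module are compatible with induction.\<close>

lemma uenv_induct [case_names scalar gen_mult add]:
  assumes scalar: "\<And>c. P (uenv_scalar c)"
    and gen_mult: "\<And>x u. P u \<Longrightarrow> P (uenv_gen x * u)"
    and add: "\<And>u w. P u \<Longrightarrow> P w \<Longrightarrow> P (u + w)"
  shows "P u"
proof -
  have "P (abs_uenv u)" for u
    by (induction u rule: free_algebra_induct)
      (use assms in \<open>simp_all add: uenv_scalar.abs_eq[symmetric] uenv_gen.abs_eq times_uenv.abs_eq[symmetric]
         plus_uenv.abs_eq[symmetric]\<close>)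
  then show ?thesis by (metis Quotient3_abs_rep Quotient3_uenv)
qed

lemma uenv_scalar_commute: "u * uenv_scalar c = uenv_scalar c * u"
proof (induction u rule: uenv_induct)
  case (scalar d)
  then show ?case by (simp flip: uenv_scalar_mult add: mult.commute)
next
  case (gen_mult x u)
  have "uenv_gen x * uenv_scalar c = uenv_scalar c * uenv_gen x"
    by transfer (simp add: mult_single plus_list_def uenv_eq_refl)
  with gen_mult show ?case by (metis mult.assoc)
next
  case (add u w)
  then show ?case by (simp add: algebra_simps)
qed

interpretation uenv: vector_space "\<lambda>c u. uenv_scalar c * u"
  by standard (simp_all add: algebra_simps uenv_scalar_add uenv_scalar_mult)

lemma uenv_gen_0 [simp]: "uenv_gen 0 = 0"
  using uenv_gen_add[of 0 0] by simp

lemma uenv_gen_minus: "uenv_gen (- x) = - uenv_gen x"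
  using uenv_gen_add[of x "- x"] by (simp add: eq_neg_iff_add_eq_0 add.commute)

lemma uenv_gen_diff: "uenv_gen (x - y) = uenv_gen x - uenv_gen y"
  using uenv_gen_add[of x "- y"] by (simp add: uenv_gen_minus)

section \<open>Brackets of basis elements of sl(1|2)\<close>

abbreviation entry :: "sl12 \<Rightarrow> 3 \<Rightarrow> 3 \<Rightarrow> complex" where
  "entry A i j \<equiv> mat_of_sl12 A $ i $ j"

lemma sl12_eqI: "(\<And>i j. entry A i j = entry B i j) \<Longrightarrow> A = B"
  by (simp add: mat_of_sl12_inject[symmetric] vec_eq_iff)

lemma entry_add: "entry (A + B) i j = entry A i j + entry B i j"
  and entry_diff: "entry (A - B) i j = entry A i j - entry B i j"
  and entry_minus: "entry (- A) i j = - entry A i j"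
  and entry_0: "entry 0 i j = 0"
  and entry_scale: "entry (sl12_scale c A) i j = c * entry A i j"
  by (transfer; simp)+

lemma entry_basis:
  "entry x1 i j = (if i = 1 \<and> j = 2 then 1 else 0)"
  "entry x2 i j = (if i = 2 \<and> j = 3 then 1 else 0)"
  "entry x3 i j = (if i = 1 \<and> j = 3 then 1 else 0)"
  "entry y1 i j = (if j = 1 \<and> i = 2 then 1 else 0)"
  "entry y2 i j = (if j = 2 \<and> i = 3 then 1 else 0)"
  "entry y3 i j = (if j = 1 \<and> i = 3 then 1 else 0)"
  "entry h1 i j = (if i = 1 \<and> j = 1 then 1 else 0) + (if i = 2 \<and> j = 2 then 1 else 0)"
  "entry h2 i j = (if i = 2 \<and> j = 2 then 1 else 0) - (if i = 3 \<and> j = 3 then 1 else 0)"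
  by (simp_all add: x1.rep_eq x2.rep_eq x3.rep_eq y1.rep_eq y2.rep_eq y3.rep_eq h1.rep_eq h2.rep_eq
      matrix_unit_def transpose_def)

lemma entry_11: "entry A 1 1 = entry A 2 2 + entry A 3 3"
  by transfer (simp add: algebra_simps)

lemma index_parity_simps [simp]: "index_parity 1 = 0" "index_parity 2 = 1" "index_parity 3 = 1"
  by (simp_all add: index_parity_def)

lemma sl12_part_iff:
  "A \<in> sl12_part p \<longleftrightarrow> (\<forall>i j. index_parity i + index_parity j \<noteq> p \<longrightarrow> entry A i j = 0)"
  by (auto simp: sl12_part_def matrix_part_def vec_eq_iff)

lemma sl12_part_0_iff:
  "A \<in> sl12_part 0 \<longleftrightarrow> entry A 1 2 = 0 \<and> entry A 1 3 = 0 \<and> entry A 2 1 = 0 \<and> entry A 3 1 = 0"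
  by (auto simp: sl12_part_iff forall_3)

lemma sl12_part_1_iff:
  "A \<in> sl12_part 1 \<longleftrightarrow>
     entry A 2 2 = 0 \<and> entry A 3 3 = 0 \<and> entry A 2 3 = 0 \<and> entry A 3 2 = 0"
  by (auto simp: sl12_part_iff forall_3 entry_11)

lemma sl12_part_basis:
  "x1 \<in> sl12_part 1" "x3 \<in> sl12_part 1" "y1 \<in> sl12_part 1" "y3 \<in> sl12_part 1"
  "x2 \<in> sl12_part 0" "y2 \<in> sl12_part 0" "h1 \<in> sl12_part 0" "h2 \<in> sl12_part 0"
  by (simp_all add: sl12_part_0_iff sl12_part_1_iff entry_basis)

text \<open>Only one summand of the supercommutator survives for homogeneous arguments, which turns brackets into matrix products with a
single sign.\<close>

lemma entry_bracket:
  assumes "A \<in> sl12_part p" "B \<in> sl12_part q"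
  shows "entry (sl12_bracket A B) i j =
    (\<Sum>k\<in>UNIV. entry A i k * entry B k j - koszul p q * entry B i k * entry A k j)"
proof -
  have part: "matrix_part r (mat_of_sl12 C) = (if r = s then mat_of_sl12 C else 0)"
    if "C \<in> sl12_part s" for C r s
  proof (cases "r = s")
    case True
    then show ?thesis using that by (simp add: sl12_part_def)
  next
    case False
    then have "index_parity i + index_parity j = r \<Longrightarrow> entry C i j = 0" for i j
      using that unfolding sl12_part_iff by blast
    with False show ?thesis by (simp add: matrix_part_def vec_eq_iff)
  qed
  have bit: "r = 0 \<or> r = 1" for r :: bit
    by (cases r) simp_all
  have koszul: "koszul p q *\<^sub>R M = (\<chi> i j. koszul p q * M $ i $ j)" for M :: "complex^3^3"
    by (simp add: koszul_def vec_eq_iff)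
  have "mat_of_sl12 (sl12_bracket A B) =
      mat_of_sl12 A ** mat_of_sl12 B - koszul p q *\<^sub>R (mat_of_sl12 B ** mat_of_sl12 A)"
    using bit[of p] bit[of q]
    by (elim disjE)
      (simp_all add: sl12_bracket.rep_eq supercommutator_def part[OF assms(1)] part[OF assms(2)] koszul_def)
  then show ?thesis
    by (simp add: koszul matrix_matrix_mult_def sum_subtractf sum_distrib_left mult.assoc)
qed


lemma sl12_eqI_all: "\<forall>i j. entry A i j = entry B i j \<Longrightarrow> A = B"
  by (simp add: sl12_eqI)

lemma sl12_bracket_odd_odd:
  "sl12_bracket x1 y1 = h1" "sl12_bracket x3 y3 = h1 - h2"
  "sl12_bracket x1 y3 = y2" "sl12_bracket y1 x3 = x2" "sl12_bracket x3 x1 = 0"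
  "sl12_bracket y1 y3 = 0" "sl12_bracket x1 x1 = 0" "sl12_bracket y3 y3 = 0"
  by (rule sl12_eqI_all, simp add: forall_3 sum_3 entry_bracket[where p = 1 and q = 1]
      sl12_part_basis entry_basis koszul_def entry_0 entry_diff)+

lemma sl12_bracket_odd_even:
  "sl12_bracket x1 y2 = 0" "sl12_bracket y3 y2 = 0" "sl12_bracket y1 y2 = - y3"
  "sl12_bracket x3 y2 = x1"
  by (rule sl12_eqI_all, simp add: forall_3 sum_3 entry_bracket[where p = 1 and q = 0]
      sl12_part_basis entry_basis koszul_def entry_0 entry_minus)+

lemma sl12_bracket_even_odd:
  "sl12_bracket x2 x1 = - x3" "sl12_bracket x2 y3 = y1"
  "sl12_bracket h1 x1 = 0" "sl12_bracket h2 x1 = - x1"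
  "sl12_bracket h1 y3 = - y3" "sl12_bracket h2 y3 = - y3"
  by (rule sl12_eqI_all, simp add: forall_3 sum_3 entry_bracket[where p = 0 and q = 1]
      sl12_part_basis entry_basis koszul_def entry_0 entry_minus)+

lemma sl12_bracket_even_even:
  "sl12_bracket x2 y2 = h2" "sl12_bracket h1 y2 = - y2" "sl12_bracket h2 y2 = - y2 - y2"
  by (rule sl12_eqI_all, simp add: forall_3 sum_3 entry_bracket[where p = 0 and q = 0]
      sl12_part_basis entry_basis koszul_def entry_diff entry_minus)+

text \<open>The vanishing supertrace makes the first diagonal entry the sum of the other two, so that the
diagonal part is a combination of \<open>h\<^sub>1 = [x\<^sub>1, y\<^sub>1]\<close> and \<open>h\<^sub>1 - h\<^sub>2 = [x\<^sub>3, y\<^sub>3]\<close>.\<close>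

lemma sl12_decomp:
  "A = sl12_scale (entry A 1 2) x1 + sl12_scale (entry A 1 3) x3 + sl12_scale (entry A 2 1) y1 +
    sl12_scale (entry A 3 1) y3 + sl12_scale (entry A 2 3) x2 + sl12_scale (entry A 3 2) y2 +
    sl12_scale (entry A 2 2) h1 + sl12_scale (entry A 3 3) (h1 - h2)"
  by (rule sl12_eqI_all)
    (simp add: forall_3 entry_add entry_diff entry_scale entry_basis entry_11)

section \<open>Quotients of the enveloping superalgebra as modules\<close>

text \<open>Besides the ideal that defines a module, this covers the preimages of its submodules in the enveloping
superalgebra, with which all later arguments are carried out.\<close>

locale uenv_left_ideal =
  fixes J :: "uenv set"
  assumes zero_mem: "0 \<in> J"
    and add_mem: "u \<in> J \<Longrightarrow> w \<in> J \<Longrightarrow> u + w \<in> J"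
    and mult_mem: "u \<in> J \<Longrightarrow> r * u \<in> J"
begin

lemma minus_mem: "u \<in> J \<Longrightarrow> - u \<in> J"
  using mult_mem[of u "- 1"] by simp

lemma diff_mem: "u \<in> J \<Longrightarrow> w \<in> J \<Longrightarrow> u - w \<in> J"
  using add_mem[OF _ minus_mem, of u w] by simp

lemma mem_cong: "u - w \<in> J \<Longrightarrow> u \<in> J \<longleftrightarrow> w \<in> J"
  using add_mem[of "u - w" w] diff_mem[of u "u - w"] by auto

lemma scalar_mult_mem_iff:
  assumes "c \<noteq> 0"
  shows "uenv_scalar c * u \<in> J \<longleftrightarrow> u \<in> J"
proof
  assume "uenv_scalar c * u \<in> J"
  then have "uenv_scalar (1 / c) * (uenv_scalar c * u) \<in> J" by (rule mult_mem)
  then show "u \<in> J" using assms by (simp flip: mult.assoc uenv_scalar_mult)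
qed (rule mult_mem)

definition coset :: "uenv \<Rightarrow> uenv set" where
  "coset u = (+) u ` J"

lemma mem_coset_iff: "a \<in> coset u \<longleftrightarrow> a - u \<in> J"
  by (force simp: coset_def intro: image_eqI[of _ _ "a - u"])

abbreviation Q :: "uenv set sl12_module" where
  "Q \<equiv> uenv_quotient J"

lemma coset_eq_iff: "coset u = coset w \<longleftrightarrow> u - w \<in> J"
proof
  assume "coset u = coset w"
  then show "u - w \<in> J" using zero_mem mem_coset_iff[of u] by (metis diff_self)
next
  assume "u - w \<in> J"
  then have "a - u \<in> J \<longleftrightarrow> a - w \<in> J" for a
    using mem_cong[of "a - w" "a - u"] by (simp add: algebra_simps)
  then show "coset u = coset w" by (auto simp: mem_coset_iff)
qed

lemma coset_translate: "{r * a + j | a j. a \<in> coset u \<and> j \<in> J} = coset (r * u)"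
proof (intro equalityI subsetI)
  fix b assume "b \<in> {r * a + j | a j. a \<in> coset u \<and> j \<in> J}"
  then obtain a j where "a - u \<in> J" "j \<in> J" "b = r * a + j" by (auto simp: mem_coset_iff)
  then show "b \<in> coset (r * u)"
    using add_mem[OF mult_mem[of "a - u" r], of j] by (simp add: mem_coset_iff algebra_simps)
next
  fix b assume "b \<in> coset (r * u)"
  then have "b = r * u + (b - r * u)" "b - r * u \<in> J" "u \<in> coset u"
    by (simp_all add: mem_coset_iff zero_mem)
  then show "b \<in> {r * a + j | a j. a \<in> coset u \<and> j \<in> J}" by blast
qed

lemma coset_plus: "{a + b | a b. a \<in> coset u \<and> b \<in> coset w} = coset (u + w)"
proof (intro equalityI subsetI)
  fix c assume "c \<in> {a + b | a b. a \<in> coset u \<and> b \<in> coset w}"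
  then obtain a b where "a - u \<in> J" "b - w \<in> J" "c = a + b" by (auto simp: mem_coset_iff)
  then show "c \<in> coset (u + w)"
    using add_mem[of "a - u" "b - w"] by (simp add: mem_coset_iff algebra_simps)
next
  fix c assume "c \<in> coset (u + w)"
  then have "c = u + (c - u)" "u \<in> coset u" "c - u \<in> coset w"
    by (simp_all add: mem_coset_iff zero_mem algebra_simps)
  then show "c \<in> {a + b | a b. a \<in> coset u \<and> b \<in> coset w}" by blast
qed

lemma carrier_Q: "carrier Q = range coset"
  by (simp add: uenv_quotient_def coset_def[abs_def])

lemma coset_carrier [simp]: "coset u \<in> carrier Q"
  by (simp add: carrier_Q)

lemma Q_zero: "\<zero>\<^bsub>Q\<^esub> = coset 0"
  by (simp add: uenv_quotient_def coset_def)

lemma Q_add [simp]: "coset u \<oplus>\<^bsub>Q\<^esub> coset w = coset (u + w)"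
  by (simp add: uenv_quotient_def coset_plus)

lemma Q_smult [simp]: "c \<odot>\<^bsub>Q\<^esub> coset u = coset (uenv_scalar c * u)"
  by (simp add: uenv_quotient_def coset_translate)

lemma Q_act [simp]: "act Q x (coset u) = coset (uenv_gen x * u)"
  by (simp add: uenv_quotient_def coset_translate)

lemma Q_grade: "grade Q p = coset ` {u. uenv_homogeneous p u}"
  by (simp add: uenv_quotient_def coset_def[abs_def])

lemma coset_eq_zero_iff: "coset u = \<zero>\<^bsub>Q\<^esub> \<longleftrightarrow> u \<in> J"
  by (simp add: Q_zero coset_eq_iff)

lemma Q_induct [case_names coset, consumes 1]:
  assumes "v \<in> carrier Q" and "\<And>u. P (coset u)"
  shows "P v"
  using assms by (auto simp: carrier_Q)

lemma abelian_group_Q: "abelian_group Q"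
proof (rule abelian_groupI)
  fix a b c
  assume a: "a \<in> carrier Q" and b: "b \<in> carrier Q" and c: "c \<in> carrier Q"
  from a b show "a \<oplus>\<^bsub>Q\<^esub> b \<in> carrier Q" by (auto simp: carrier_Q)
  from a b c show "a \<oplus>\<^bsub>Q\<^esub> b \<oplus>\<^bsub>Q\<^esub> c = a \<oplus>\<^bsub>Q\<^esub> (b \<oplus>\<^bsub>Q\<^esub> c)" by (auto simp: carrier_Q add.assoc)
  from a b show "a \<oplus>\<^bsub>Q\<^esub> b = b \<oplus>\<^bsub>Q\<^esub> a" by (auto simp: carrier_Q add.commute)
next
  show "\<zero>\<^bsub>Q\<^esub> \<in> carrier Q" by (simp only: Q_zero coset_carrier)
next
  fix a assume a: "a \<in> carrier Q"
  then show "\<zero>\<^bsub>Q\<^esub> \<oplus>\<^bsub>Q\<^esub> a = a"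
    by (induction a rule: Q_induct) (simp only: Q_zero Q_add add_0)
  from a show "\<exists>b\<in>carrier Q. b \<oplus>\<^bsub>Q\<^esub> a = \<zero>\<^bsub>Q\<^esub>"
  proof (induction a rule: Q_induct)
    case (coset u)
    show ?case
      by (rule bexI[of _ "coset (- u)"]) (simp_all only: Q_zero Q_add coset_carrier left_minus)
  qed
qed

lemma Q_minus [simp]: "coset u \<ominus>\<^bsub>Q\<^esub> coset w = coset (u - w)"
proof -
  interpret abelian_group Q by (rule abelian_group_Q)
  have "\<ominus>\<^bsub>Q\<^esub> coset w = coset (- w)"
    by (rule minus_equality) (simp_all only: Q_add Q_zero left_minus coset_carrier)
  then show ?thesis by (simp add: a_minus_def)
qed

end

lemma complex_ring_simps [simp]:
  "carrier complex_ring = UNIV" "a \<otimes>\<^bsub>complex_ring\<^esub> b = a * b" "\<one>\<^bsub>complex_ring\<^esub> = 1"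
  "a \<oplus>\<^bsub>complex_ring\<^esub> b = a + b" "\<zero>\<^bsub>complex_ring\<^esub> = 0"
  by (simp_all add: complex_ring_def)

lemma cring_complex_ring: "cring complex_ring"
proof (rule cringI)
  show "abelian_group complex_ring"
  proof (rule abelian_groupI)
    fix x assume "x \<in> carrier complex_ring"
    show "\<exists>y\<in>carrier complex_ring. y \<oplus>\<^bsub>complex_ring\<^esub> x = \<zero>\<^bsub>complex_ring\<^esub>"
      by (rule bexI[of _ "- x"]) simp_all
  qed simp_all
  show "comm_monoid complex_ring"
    by (rule comm_monoidI) simp_all
qed (simp add: distrib_right)

context uenv_left_ideal
begin

lemma module_Q: "Module.module complex_ring Q"
proof (rule moduleI)
  show "cring complex_ring" by (rule cring_complex_ring)
  show "abelian_group Q" by (rule abelian_group_Q)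
next
  fix a b v w
  assume v: "v \<in> carrier Q"
  then obtain x where x: "v = coset x" by (auto simp: carrier_Q)
  show "a \<odot>\<^bsub>Q\<^esub> v \<in> carrier Q" by (simp add: x)
  show "(a \<oplus>\<^bsub>complex_ring\<^esub> b) \<odot>\<^bsub>Q\<^esub> v = a \<odot>\<^bsub>Q\<^esub> v \<oplus>\<^bsub>Q\<^esub> b \<odot>\<^bsub>Q\<^esub> v"
    by (simp add: x distrib_right uenv_scalar_add)
  show "(a \<otimes>\<^bsub>complex_ring\<^esub> b) \<odot>\<^bsub>Q\<^esub> v = a \<odot>\<^bsub>Q\<^esub> (b \<odot>\<^bsub>Q\<^esub> v)"
    by (simp add: x)
  show "\<one>\<^bsub>complex_ring\<^esub> \<odot>\<^bsub>Q\<^esub> v = v" by (simp add: x)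
  assume "w \<in> carrier Q"
  then obtain y where y: "w = coset y" by (auto simp: carrier_Q)
  show "a \<odot>\<^bsub>Q\<^esub> (v \<oplus>\<^bsub>Q\<^esub> w) = a \<odot>\<^bsub>Q\<^esub> v \<oplus>\<^bsub>Q\<^esub> a \<odot>\<^bsub>Q\<^esub> w"
    by (simp add: x y distrib_left)
qed

lemma submodule_QI:
  assumes "0 \<in> S" "\<And>u w. u \<in> S \<Longrightarrow> w \<in> S \<Longrightarrow> u + w \<in> S"
    "\<And>c u. u \<in> S \<Longrightarrow> uenv_scalar c * u \<in> S"
  shows "submodule (coset ` S) complex_ring Q"
proof -
  interpret Module.module complex_ring Q by (rule module_Q)
  have neg: "\<ominus>\<^bsub>Q\<^esub> coset u = coset (uenv_scalar (- 1) * u)" for u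
    by (rule minus_equality) (simp_all only: Q_add Q_zero uenv_scalar_minus uenv_scalar_1
        mult_minus1 left_minus coset_carrier)
  show ?thesis
  proof (rule submoduleI)
    show "\<zero>\<^bsub>Q\<^esub> \<in> coset ` S" using assms(1) by (simp only: Q_zero imageI)
    fix a assume "a \<in> coset ` S"
    then obtain u where u: "u \<in> S" "a = coset u" by blast
    show "\<ominus>\<^bsub>Q\<^esub> a \<in> coset ` S" using assms(3)[OF u(1)] by (simp only: u neg imageI)
    show "c \<odot>\<^bsub>Q\<^esub> a \<in> coset ` S" for c using assms(3)[OF u(1)] by (simp only: u Q_smult imageI)
    fix b assume "b \<in> coset ` S"
    then obtain w where w: "w \<in> S" "b = coset w" by blast
    show "a \<oplus>\<^bsub>Q\<^esub> b \<in> coset ` S" using assms(2)[OF u(1) w(1)] by (simp only: u w Q_add imageI)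
  qed (use assms in \<open>auto simp: carrier_Q\<close>)
qed

end

section \<open>Representations on types\<close>

text \<open>An ungraded representation on a whole type. Three instances serve as tools: a twisted left
multiplication that yields the parity automorphism, the left regular representation, and
a completion of the Verma module. What matters is
the induced action of the enveloping superalgebra.\<close>

locale sl12_rep = vector_space scale
  for scale :: "complex \<Rightarrow> 'v::ab_group_add \<Rightarrow> 'v" +
  fixes rho :: "sl12 \<Rightarrow> 'v \<Rightarrow> 'v"
  assumes rho_add: "rho (x + y) m = rho x m + rho y m"
    and rho_scale: "rho (sl12_scale c x) m = scale c (rho x m)"
    and rho_add_right: "rho x (m + m') = rho x m + rho x m'"
    and rho_scale_right: "rho x (scale c m) = scale c (rho x m)"
    and rho_bracket: "x \<in> sl12_part p \<Longrightarrow> y \<in> sl12_part q \<Longrightarrow>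
      rho x (rho y m) = scale (koszul p q) (rho y (rho x m)) + rho (sl12_bracket x y) m"
begin

definition free_act :: "free_algebra \<Rightarrow> 'v \<Rightarrow> 'v" where
  "free_act u m = (\<Sum>w\<in>Poly_Mapping.keys u. scale (Poly_Mapping.lookup u w) (foldr rho w m))"

lemma free_act_single: "free_act (Poly_Mapping.single w c) m = scale c (foldr rho w m)"
  by (cases "c = 0") (simp_all add: free_act_def)

lemma free_act_add: "free_act (u + w) m = free_act u m + free_act w m"
  unfolding free_act_def by (rule setsum_keys_plus_distrib) (simp_all add: scale_left_distrib)

lemma foldr_rho_add: "foldr rho w (m + m') = foldr rho w m + foldr rho w m'"
  by (induction w) (simp_all add: rho_add_right)

lemma foldr_rho_scale: "foldr rho w (scale c m) = scale c (foldr rho w m)"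
  by (induction w) (simp_all add: rho_scale_right)

lemma free_act_add_right: "free_act u (m + m') = free_act u m + free_act u m'"
  by (simp add: free_act_def foldr_rho_add scale_right_distrib sum.distrib)

lemma free_act_mult: "free_act (u * w) m = free_act u (free_act w m)"
proof (induction u rule: free_algebra_induct_single)
  case (single xs c)
  show ?case
  proof (induction w rule: free_algebra_induct_single)
    case (single ys d)
    then show ?case
      by (simp add: mult_single plus_list_def free_act_single foldr_rho_scale)
  next
    case (add u w)
    then show ?case by (simp add: distrib_left free_act_add free_act_add_right)
  qed
next
  case (add u w)
  then show ?case by (simp add: distrib_right free_act_add)
qed

lemma free_act_0: "free_act 0 m = 0"
  by (simp add: free_act_def)

lemma free_act_minus: "free_act (- u) m = - free_act u m"
  using free_act_add[of u "- u" m] by (simp add: free_act_0 eq_neg_iff_add_eq_0 add.commute)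

lemma free_act_diff: "free_act (u - w) m = free_act u m - free_act w m"
  using free_act_add[of u "- w" m] by (simp add: free_act_minus)

lemma free_act_right_0: "free_act u 0 = 0"
  using free_act_add_right[of u 0 0] by simp

lemma free_act_relation: "u \<in> two_sided_ideal uenv_relations \<Longrightarrow> free_act u m = 0"
proof (induction arbitrary: m rule: two_sided_ideal.induct)
  case (gen s)
  have free_gen: "free_act (free_gen x) m = rho x m" for x m
    by (simp add: free_act_single)
  have "free_act 1 m = m" for m
    by (metis free_act_single foldr.simps(1) id_apply scale_one single_one zero_list_def)
  then have koszul: "free_act (koszul p q) m = scale (koszul p q) m" for p q m
    by (auto simp: koszul_def free_act_minus)
  from gen consider x y where "s = free_gen (x + y) - free_gen x - free_gen y"
    | c x where "s = free_gen (sl12_scale c x) - free_scalar c * free_gen x"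
    | x y p q where "x \<in> sl12_part p" "y \<in> sl12_part q"
        "s = free_gen x * free_gen y - koszul p q * free_gen y * free_gen x - free_gen (sl12_bracket x y)"
    unfolding uenv_relations_def by blast
  then show ?case
  proof cases
    case 3
    then show ?thesis
      using rho_bracket[OF 3(1,2), of m] by (simp add: free_act_diff free_act_mult free_gen koszul mult.assoc)
  qed (simp_all add: free_act_diff free_act_mult free_gen rho_add rho_scale free_act_single)
qed (simp_all add: free_act_0 free_act_add free_act_mult free_act_right_0)

definition uenv_act :: "uenv \<Rightarrow> 'v \<Rightarrow> 'v" where
  "uenv_act u = free_act (rep_uenv u)"

lemma uenv_act_abs: "uenv_act (abs_uenv u) m = free_act u m"
proof -
  have "uenv_eq (rep_uenv (abs_uenv u)) u"
    by (metis Quotient3_rep_abs Quotient3_uenv uenv_eq_refl)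
  then have "free_act (rep_uenv (abs_uenv u) - u) m = 0"
    by (simp add: uenv_eq_def free_act_relation)
  then show ?thesis by (simp add: uenv_act_def free_act_diff)
qed

lemma uenv_abs_surj: obtains w where "u = abs_uenv w"
  by (metis Quotient3_abs_rep Quotient3_uenv)

lemma uenv_act_gen: "uenv_act (uenv_gen x) m = rho x m"
  by (simp add: uenv_gen.abs_eq uenv_act_abs free_act_single)

lemma uenv_act_scalar: "uenv_act (uenv_scalar c) m = scale c m"
  by (simp add: uenv_scalar.abs_eq uenv_act_abs free_act_single)

lemma uenv_act_add: "uenv_act (u + w) m = uenv_act u m + uenv_act w m"
  by (metis uenv_abs_surj plus_uenv.abs_eq uenv_act_abs free_act_add)

lemma uenv_act_mult: "uenv_act (u * w) m = uenv_act u (uenv_act w m)"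
  by (metis uenv_abs_surj times_uenv.abs_eq uenv_act_abs free_act_mult)

lemma uenv_act_0: "uenv_act 0 m = 0"
  using uenv_act_add[of 0 0 m] by simp

lemma uenv_act_diff: "uenv_act (u - w) m = uenv_act u m - uenv_act w m"
  using uenv_act_add[of "u - w" w m] by (simp add: algebra_simps)

end

section \<open>The parity automorphism\<close>

text \<open>In a quotient by a left ideal, the even and the odd part intersect trivially only if the ideal is spanned by
homogeneous elements. Invariance under the automorphism that is the identity on even and minus the identity on odd
elements is the convenient form of this condition.\<close>

lift_definition parity_involution :: "sl12 \<Rightarrow> sl12" is
  "\<lambda>A. \<chi> i j. if index_parity i + index_parity j = 0 then A $ i $ j else - A $ i $ j"
  by simp

lemma entry_parity_involution:
  "entry (parity_involution A) i j =
     (if index_parity i + index_parity j = 0 then entry A i j else - entry A i j)"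
  by (simp add: parity_involution.rep_eq)

lemma parity_involution_add: "parity_involution (x + y) = parity_involution x + parity_involution y"
  by (rule sl12_eqI) (simp only: entry_parity_involution entry_add minus_add_distrib split: if_split, blast)

lemma parity_involution_scale: "parity_involution (sl12_scale c x) = sl12_scale c (parity_involution x)"
  by (rule sl12_eqI) (simp only: entry_parity_involution entry_scale mult_minus_right split: if_split, blast)

lemma parity_involution_part:
  assumes "x \<in> sl12_part p"
  shows "parity_involution x = (if p = 0 then x else - x)"
proof (rule sl12_eqI)
  fix i j
  have "entry x i j = 0" if "index_parity i + index_parity j \<noteq> p"
    using assms that unfolding sl12_part_iff by blast
  then show "entry (parity_involution x) i j = entry (if p = 0 then x else - x) i j"
    by (cases "index_parity i + index_parity j = p") (auto simp: entry_parity_involution entry_minus)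
qed

lemma bit_cases: "p = 0 \<or> p = (1::bit)"
  by (cases p) simp_all

lemma sl12_part_bracket:
  assumes "x \<in> sl12_part p" "y \<in> sl12_part q"
  shows "sl12_bracket x y \<in> sl12_part (p + q)"
  unfolding sl12_part_iff
proof (intro allI impI)
  fix i j assume ij: "index_parity i + index_parity j \<noteq> p + q"
  have zero: "entry x i k = 0 \<or> entry y k j = 0" "entry y i k = 0 \<or> entry x k j = 0" for k
  proof -
    have x: "entry x a b = 0" if "index_parity a + index_parity b \<noteq> p" for a b
      using assms(1) that unfolding sl12_part_iff by blast
    have y: "entry y a b = 0" if "index_parity a + index_parity b \<noteq> q" for a b
      using assms(2) that unfolding sl12_part_iff by blast
    have double: "r + r = 0" for r :: bit
      using bit_cases[of r] by auto
    have "a + b = p + q" if "a + c = p" "c + b = q" for a b c :: bit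
      using double[of c] that by (metis add.assoc add.left_neutral)
    with ij have "index_parity i + index_parity k \<noteq> p \<or> index_parity k + index_parity j \<noteq> q"
      "index_parity i + index_parity k \<noteq> q \<or> index_parity k + index_parity j \<noteq> p"
      by (metis add.commute)+
    then show "entry x i k = 0 \<or> entry y k j = 0" "entry y i k = 0 \<or> entry x k j = 0"
      using x y by blast+
  qed
  have "entry x i k * entry y k j - koszul p q * entry y i k * entry x k j = 0" for k
    using zero[of k] by auto
  then show "entry (sl12_bracket x y) i j = 0"
    unfolding entry_bracket[OF assms] by (intro sum.neutral) simp
qed

text \<open>Letting \<open>x\<close> act as left multiplication by its image under the involution is a representation. The induced action of \<open>u\<close> on the
unit is the image of \<open>u\<close> under the automorphism that extends the involution.\<close>

interpretation parity: sl12_rep "\<lambda>c u. uenv_scalar c * u" "\<lambda>x u. uenv_gen (parity_involution x) * u"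
proof
  fix x y :: sl12 and p q and u w :: uenv and c :: complex
  show "uenv_gen (parity_involution (x + y)) * u =
      uenv_gen (parity_involution x) * u + uenv_gen (parity_involution y) * u"
    by (simp add: parity_involution_add uenv_gen_add distrib_right)
  show "uenv_gen (parity_involution (sl12_scale c x)) * u = uenv_scalar c * (uenv_gen (parity_involution x) * u)"
    by (simp add: parity_involution_scale uenv_gen_scale mult.assoc)
  show "uenv_gen (parity_involution x) * (u + w) =
      uenv_gen (parity_involution x) * u + uenv_gen (parity_involution x) * w"
    by (rule distrib_left)
  show "uenv_gen (parity_involution x) * (uenv_scalar c * u) =
      uenv_scalar c * (uenv_gen (parity_involution x) * u)"
    by (simp only: mult.assoc[symmetric] uenv_scalar_commute)
  assume x: "x \<in> sl12_part p" and y: "y \<in> sl12_part q"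
  have "uenv_scalar (koszul p q) = koszul p q"
    by (auto simp: koszul_def uenv_scalar_minus)
  then have "uenv_gen x * (uenv_gen y * u) =
      uenv_scalar (koszul p q) * (uenv_gen y * (uenv_gen x * u)) + uenv_gen (sl12_bracket x y) * u"
    by (simp only: mult.assoc[symmetric] uenv_gen_mult_bracket[OF x y] distrib_right)
  with bit_cases[of p] bit_cases[of q] show "uenv_gen (parity_involution x) * (uenv_gen (parity_involution y) * u) =
      uenv_scalar (koszul p q) * (uenv_gen (parity_involution y) * (uenv_gen (parity_involution x) * u)) +
      uenv_gen (parity_involution (sl12_bracket x y)) * u"
    by (auto simp: parity_involution_part[OF x] parity_involution_part[OF y]
        parity_involution_part[OF sl12_part_bracket[OF x y]] uenv_gen_minus)
qed

definition parity_aut :: "uenv \<Rightarrow> uenv" where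
  "parity_aut u = parity.uenv_act u 1"

lemma parity_aut_mult: "parity_aut (u * w) = parity_aut u * parity_aut w"
proof -
  have "parity.uenv_act u m = parity_aut u * m" for m
    unfolding parity_aut_def
  proof (induction u arbitrary: m rule: uenv_induct)
    case (scalar c)
    then show ?case by (simp only: parity.uenv_act_scalar mult_1_right)
  next
    case (gen_mult x u)
    show ?case
      by (simp only: parity.uenv_act_mult parity.uenv_act_gen mult.assoc gen_mult[of m])
  next
    case (add u w)
    show ?case by (simp only: parity.uenv_act_add distrib_right add[of m])
  qed
  then show ?thesis by (metis parity_aut_def parity.uenv_act_mult)
qed

lemma parity_aut_add: "parity_aut (u + w) = parity_aut u + parity_aut w"
  and parity_aut_diff: "parity_aut (u - w) = parity_aut u - parity_aut w"
  and parity_aut_0: "parity_aut 0 = 0"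
  and parity_aut_scalar: "parity_aut (uenv_scalar c) = uenv_scalar c"
  and parity_aut_gen: "parity_aut (uenv_gen x) = uenv_gen (parity_involution x)"
  by (simp_all add: parity_aut_def parity.uenv_act_add parity.uenv_act_diff parity.uenv_act_0
      parity.uenv_act_scalar parity.uenv_act_gen)

lemma parity_aut_homogeneous:
  "uenv_homogeneous p u \<Longrightarrow> parity_aut u = (if p = 0 then u else - u)"
proof (induction rule: uenv_homogeneous.induct)
  case (gen_mult x p q u)
  with bit_cases[of p] bit_cases[of q] show ?case
    by (auto simp: parity_aut_mult parity_aut_gen parity_involution_part[OF gen_mult(1)] uenv_gen_minus)
qed (simp_all add: parity_aut_scalar parity_aut_add)

section \<open>The grading of a quotient\<close>

lemma uenv_homogeneous_0: "uenv_homogeneous p 0"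
proof -
  have "0 \<in> sl12_part p" by (simp add: sl12_part_iff entry_0)
  then show ?thesis
    using uenv_homogeneous.gen_mult[of 0 p 0 "uenv_scalar 0"] uenv_homogeneous.scalar[of 0]
    by (simp only: uenv_scalar_0 mult_zero_right add_0_right)
qed

lemma uenv_homogeneous_scalar_mult:
  "uenv_homogeneous p u \<Longrightarrow> uenv_homogeneous p (uenv_scalar c * u)"
proof (induction rule: uenv_homogeneous.induct)
  case (scalar d)
  then show ?case by (metis uenv_homogeneous.scalar uenv_scalar_mult)
next
  case (gen_mult x p q u)
  then have "uenv_homogeneous (p + q) (uenv_gen x * (uenv_scalar c * u))"
    by (intro uenv_homogeneous.gen_mult)
  moreover have "uenv_gen x * (uenv_scalar c * u) = uenv_scalar c * (uenv_gen x * u)"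
    by (simp only: mult.assoc[symmetric] uenv_scalar_commute)
  ultimately show ?case by simp
next
  case (add p u w)
  then show ?case by (simp only: distrib_left uenv_homogeneous.add)
qed

lemma uenv_homogeneous_gen: "x \<in> sl12_part p \<Longrightarrow> uenv_homogeneous p (uenv_gen x)"
  using uenv_homogeneous.gen_mult[of x p 0 "uenv_scalar 1"] uenv_homogeneous.scalar[of 1]
  by (simp only: uenv_scalar_1 mult_1_right add_0_right)

lemma uenv_homogeneous_mult:
  "uenv_homogeneous p u \<Longrightarrow> uenv_homogeneous q w \<Longrightarrow> uenv_homogeneous (p + q) (u * w)"
proof (induction rule: uenv_homogeneous.induct)
  case (scalar c)
  then show ?case by (simp only: uenv_homogeneous_scalar_mult add_0_left)
next
  case (gen_mult x p p' u)
  then show ?case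
    by (simp only: mult.assoc add.assoc uenv_homogeneous.gen_mult)
next
  case (add p u u')
  then show ?case by (simp only: distrib_right uenv_homogeneous.add)
qed

text \<open>The even and odd part of \<open>x\<close> are the averages of \<open>x\<close> and \<open>\<plusminus>\<close> its image under the involution.\<close>

lemma uenv_homogeneous_decomp:
  obtains u0 u1 where "uenv_homogeneous 0 u0" "uenv_homogeneous 1 u1" "u = u0 + u1"
proof -
  have "\<exists>u0 u1. uenv_homogeneous 0 u0 \<and> uenv_homogeneous 1 u1 \<and> u = u0 + u1"
  proof (induction u rule: uenv_induct)
    case (scalar c)
    show ?case
      using uenv_homogeneous.scalar[of c] uenv_homogeneous_0[of 1] by (metis add.right_neutral)
  next
    case (gen_mult x u)
    then obtain u0 u1 where u: "uenv_homogeneous 0 u0" "uenv_homogeneous 1 u1" "u = u0 + u1" by blast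
    define a where "a = sl12_scale (1/2) (x + parity_involution x)"
    define b where "b = sl12_scale (1/2) (x - parity_involution x)"
    have ab: "a \<in> sl12_part 0" "b \<in> sl12_part 1"
      by (simp_all add: a_def b_def sl12_part_0_iff sl12_part_1_iff entry_add entry_diff entry_scale
          entry_parity_involution)
    have x: "x = a + b"
      by (rule sl12_eqI) (simp add: a_def b_def entry_add entry_diff entry_scale distrib_left
          right_diff_distrib)
    have "uenv_homogeneous 0 (uenv_gen a * u0 + uenv_gen b * u1)"
      "uenv_homogeneous 1 (uenv_gen b * u0 + uenv_gen a * u1)"
      using u uenv_homogeneous.gen_mult[OF ab(2) u(2)] uenv_homogeneous.gen_mult[OF ab(2) u(1)]
        uenv_homogeneous.gen_mult[OF ab(1) u(1)] uenv_homogeneous.gen_mult[OF ab(1) u(2)]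
      by (auto intro!: uenv_homogeneous.add)
    moreover have "uenv_gen x * u =
        (uenv_gen a * u0 + uenv_gen b * u1) + (uenv_gen b * u0 + uenv_gen a * u1)"
      by (simp add: u x uenv_gen_add algebra_simps)
    ultimately show ?case by blast
  next
    case (add u w)
    then obtain u0 u1 w0 w1 where
      "uenv_homogeneous 0 u0" "uenv_homogeneous 1 u1" "u = u0 + u1"
      "uenv_homogeneous 0 w0" "uenv_homogeneous 1 w1" "w = w0 + w1" by blast
    then have "uenv_homogeneous 0 (u0 + w0)" "uenv_homogeneous 1 (u1 + w1)"
      "u + w = (u0 + w0) + (u1 + w1)"
      by (simp_all add: uenv_homogeneous.add algebra_simps)
    then show ?case by blast
  qed
  then show thesis using that by blast
qed

locale graded_left_ideal = uenv_left_ideal +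
  assumes parity_mem: "u \<in> J \<Longrightarrow> parity_aut u \<in> J"
begin

text \<open>If an even \<open>u\<close> and an odd \<open>w\<close> are congruent modulo \<open>J\<close>, the parity automorphism maps \<open>u - w\<close> to \<open>u + w\<close>, so
that \<open>2 u\<close> lies in \<open>J\<close>.\<close>

lemma grade_Int_Q: "grade Q 0 \<inter> grade Q 1 = {\<zero>\<^bsub>Q\<^esub>}"
proof (intro equalityI subsetI)
  fix v assume "v \<in> grade Q 0 \<inter> grade Q 1"
  then obtain u w where u: "uenv_homogeneous 0 u" "v = coset u" and w: "uenv_homogeneous 1 w" "v = coset w"
    by (auto simp: Q_grade)
  then have "u - w \<in> J" using coset_eq_iff by metis
  moreover from this have "u + w \<in> J"
    using parity_mem[of "u - w"] by (simp add: parity_aut_diff parity_aut_homogeneous[OF u(1)]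
        parity_aut_homogeneous[OF w(1)])
  ultimately have "(u - w) + (u + w) \<in> J" by (rule add_mem)
  moreover have "(u - w) + (u + w) = uenv_scalar (1 + 1) * u"
    by (simp only: uenv_scalar_add distrib_right uenv_scalar_1 mult_1_left) simp
  ultimately have "u \<in> J" using scalar_mult_mem_iff[of "1 + 1" u] by simp
  then show "v \<in> {\<zero>\<^bsub>Q\<^esub>}" by (simp add: u coset_eq_zero_iff)
next
  fix v assume "v \<in> {\<zero>\<^bsub>Q\<^esub>}"
  then show "v \<in> grade Q 0 \<inter> grade Q 1"
    using uenv_homogeneous_0 by (auto simp: Q_grade Q_zero)
qed

lemma sl12_module_Q: "sl12_module Q"
proof (intro sl12_module.intro module_Q sl12_module_axioms.intro)
  show "submodule (grade Q p) complex_ring Q" for p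
    unfolding Q_grade
    by (rule submodule_QI)
      (auto intro: uenv_homogeneous_0 uenv_homogeneous.add uenv_homogeneous_scalar_mult)
  show "grade Q 0 \<inter> grade Q 1 = {\<zero>\<^bsub>Q\<^esub>}" by (rule grade_Int_Q)
next
  fix v assume "v \<in> carrier Q"
  then obtain u where u: "v = coset u" by (auto simp: carrier_Q)
  obtain u0 u1 where d: "uenv_homogeneous 0 u0" "uenv_homogeneous 1 u1" "u = u0 + u1"
    by (rule uenv_homogeneous_decomp)
  then have "coset u0 \<in> grade Q 0" "coset u1 \<in> grade Q 1" "v = coset u0 \<oplus>\<^bsub>Q\<^esub> coset u1"
    by (auto simp: Q_grade u)
  then show "\<exists>u\<in>grade Q 0. \<exists>w\<in>grade Q 1. v = u \<oplus>\<^bsub>Q\<^esub> w" by blast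
next
  fix x y v c assume "v \<in> carrier Q"
  then obtain u where u: "v = coset u" by (auto simp: carrier_Q)
  show "act Q x v \<in> carrier Q" by (simp add: u)
  show "act Q (x + y) v = act Q x v \<oplus>\<^bsub>Q\<^esub> act Q y v" by (simp add: u uenv_gen_add distrib_right)
  show "act Q (sl12_scale c x) v = c \<odot>\<^bsub>Q\<^esub> act Q x v" by (simp add: u uenv_gen_scale mult.assoc)
  show "act Q x (c \<odot>\<^bsub>Q\<^esub> v) = c \<odot>\<^bsub>Q\<^esub> act Q x v"
    by (simp only: u Q_act Q_smult mult.assoc[symmetric] uenv_scalar_commute)
  show "act Q x (v \<oplus>\<^bsub>Q\<^esub> w) = act Q x v \<oplus>\<^bsub>Q\<^esub> act Q x w" if "w \<in> carrier Q" for w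
    using that by (auto simp: u carrier_Q distrib_left)
  show "act Q (sl12_bracket x y) v =
      act Q x (act Q y v) \<ominus>\<^bsub>Q\<^esub> koszul p q \<odot>\<^bsub>Q\<^esub> act Q y (act Q x v)"
    if "x \<in> sl12_part p" "y \<in> sl12_part q" for p q
  proof -
    have "uenv_scalar (koszul p q) = koszul p q"
      by (auto simp: koszul_def uenv_scalar_minus)
    then have "uenv_gen (sl12_bracket x y) * u =
        uenv_gen x * (uenv_gen y * u) - uenv_scalar (koszul p q) * (uenv_gen y * (uenv_gen x * u))"
      by (simp only: mult.assoc[symmetric] uenv_gen_mult_bracket[OF that] distrib_right add_diff_cancel_left')
    then show ?thesis by (simp only: u Q_act Q_smult Q_minus)
  qed
next
  fix x p v q assume x: "x \<in> sl12_part p" and "v \<in> grade Q q"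
  then obtain u where u: "uenv_homogeneous q u" "v = coset u" by (auto simp: Q_grade)
  show "act Q x v \<in> grade Q (p + q)"
    unfolding Q_grade u Q_act by (intro imageI CollectI uenv_homogeneous.gen_mult x u)
qed

end

context uenv_left_ideal
begin

text \<open>Submodules of the quotient correspond to the left ideals that contain \<open>J\<close>.\<close>

lemma submodule_ideal:
  assumes "sl12_submodule W Q"
  defines "I \<equiv> {u. coset u \<in> W}"
  shows "uenv_left_ideal I" "J \<subseteq> I" "W = coset ` I"
proof -
  interpret Module.module complex_ring Q by (rule module_Q)
  have sub: "submodule W complex_ring Q" and act: "\<And>x w. w \<in> W \<Longrightarrow> act Q x w \<in> W"
    using assms by (auto simp: sl12_submodule_def)
  note E = submoduleE[OF sub]
  have zero: "\<zero>\<^bsub>Q\<^esub> \<in> W"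
    using subgroup.one_closed[OF submodule.axioms(1)[OF sub]] by simp
  show "J \<subseteq> I" using zero by (auto simp: I_def coset_eq_zero_iff[symmetric])
  show "W = coset ` I" using E(1) by (auto simp: I_def carrier_Q)
  show "uenv_left_ideal I"
  proof
    show "0 \<in> I" using zero by (simp add: I_def Q_zero)
    show "u + w \<in> I" if "u \<in> I" "w \<in> I" for u w
      using E(5) that by (auto simp: I_def simp flip: Q_add)
    show "r * u \<in> I" if "u \<in> I" for r u
      using that
    proof (induction r arbitrary: u rule: uenv_induct)
      case (scalar c)
      then show ?case using E(4) by (auto simp: I_def simp flip: Q_smult)
    next
      case (gen_mult x r)
      from gen_mult.IH[OF gen_mult.prems] show ?case
        using act by (simp add: I_def mult.assoc flip: Q_act)
    next
      case (add r s)
      from add.IH[OF add.prems] show ?case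
        using E(5) by (simp add: I_def distrib_right flip: Q_add)
    qed
  qed
qed

lemma carrier_Q_nonzero_iff: "carrier Q \<noteq> {\<zero>\<^bsub>Q\<^esub>} \<longleftrightarrow> 1 \<notin> J"
proof -
  have "carrier Q = {\<zero>\<^bsub>Q\<^esub>} \<longleftrightarrow> (\<forall>u. u \<in> J)"
    using coset_eq_zero_iff coset_carrier by (auto simp: carrier_Q)
  also have "\<dots> \<longleftrightarrow> 1 \<in> J"
    using mult_mem[of 1] by (metis mult_1_right)
  finally show ?thesis by simp
qed

text \<open>The elements \<open>r s\<close> span a submodule, which inherits the grading because \<open>s\<close> is homogeneous. It is nonzero, hence contains the
class of the unit.\<close>

lemma irreducible_imp_generating:
  assumes irr: "irreducible_sl12_module Q" and s: "uenv_homogeneous p s" and "s \<notin> J"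
  shows "\<exists>r. 1 - r * s \<in> J"
proof -
  let ?S = "range (\<lambda>r. r * s)"
  let ?W = "coset ` ?S"
  have "sl12_submodule ?W Q"
    unfolding sl12_submodule_def
  proof (intro conjI ballI allI)
    show "submodule ?W complex_ring Q"
    proof (rule submodule_QI)
      show "0 \<in> ?S" by (rule range_eqI[of _ _ 0]) simp
      show "u + w \<in> ?S" if "u \<in> ?S" "w \<in> ?S" for u w
        using that by (auto simp flip: distrib_right)
      show "uenv_scalar c * u \<in> ?S" if "u \<in> ?S" for c u
        using that by (auto simp flip: mult.assoc)
    qed
    show "act Q x w \<in> ?W" if w: "w \<in> ?W" for x w
    proof -
      from w obtain r where "w = coset (r * s)" by blast
      then have "act Q x w = coset ((uenv_gen x * r) * s)" by (simp add: mult.assoc)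
      then show ?thesis by blast
    qed
    fix w assume "w \<in> ?W"
    then obtain r where w: "w = coset (r * s)" by blast
    obtain r0 r1 where r: "uenv_homogeneous 0 r0" "uenv_homogeneous 1 r1" "r = r0 + r1"
      by (rule uenv_homogeneous_decomp)
    have w': "w = coset (r0 * s) \<oplus>\<^bsub>Q\<^esub> coset (r1 * s)" "w = coset (r1 * s) \<oplus>\<^bsub>Q\<^esub> coset (r0 * s)"
      by (simp_all add: w r(3) distrib_right add.commute)
    have hom: "uenv_homogeneous p (r0 * s)" "uenv_homogeneous (1 + p) (r1 * s)"
      using uenv_homogeneous_mult[OF r(1) s] uenv_homogeneous_mult[OF r(2) s]
      by (simp_all only: add_0_left)
    show "\<exists>u\<in>?W \<inter> grade Q 0. \<exists>u'\<in>?W \<inter> grade Q 1. w = u \<oplus>\<^bsub>Q\<^esub> u'"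
    proof (cases "p = 0")
      case True
      then have "coset (r0 * s) \<in> ?W \<inter> grade Q 0" "coset (r1 * s) \<in> ?W \<inter> grade Q 1"
        using hom by (auto simp: Q_grade)
      with w'(1) show ?thesis by blast
    next
      case False
      then have "p = 1" using bit_cases by blast
      then have "coset (r1 * s) \<in> ?W \<inter> grade Q 0" "coset (r0 * s) \<in> ?W \<inter> grade Q 1"
        using hom by (auto simp: Q_grade)
      with w'(2) show ?thesis by blast
    qed
  qed
  then have "?W = {\<zero>\<^bsub>Q\<^esub>} \<or> ?W = carrier Q"
    using irr by (simp add: irreducible_sl12_module_def)
  moreover have "coset s \<in> ?W" by (metis imageI mult_1_left rangeI)
  then have "?W \<noteq> {\<zero>\<^bsub>Q\<^esub>}" by (metis \<open>s \<notin> J\<close> coset_eq_zero_iff singletonD)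
  ultimately have "coset 1 \<in> ?W" using coset_carrier[of 1] by metis
  then show ?thesis by (auto simp: coset_eq_iff)
qed

end

lemma (in graded_left_ideal) irreducible_QI:
  assumes "1 \<notin> J" and "\<And>I u. uenv_left_ideal I \<Longrightarrow> J \<subseteq> I \<Longrightarrow> u \<in> I \<Longrightarrow> u \<notin> J \<Longrightarrow> 1 \<in> I"
  shows "irreducible_sl12_module Q"
  unfolding irreducible_sl12_module_def
proof (intro conjI allI impI sl12_module_Q)
  show "carrier Q \<noteq> {\<zero>\<^bsub>Q\<^esub>}" using assms(1) by (simp add: carrier_Q_nonzero_iff)
  fix W assume W: "sl12_submodule W Q"
  define I where "I = {u. coset u \<in> W}"
  note I = submodule_ideal[OF W, folded I_def]
  show "W = {\<zero>\<^bsub>Q\<^esub>} \<or> W = carrier Q"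
  proof (cases "I \<subseteq> J")
    case True
    then have "I = J" using I(2) by blast
    then have "W = coset ` J" using I(3) by simp
    moreover have "coset u = \<zero>\<^bsub>Q\<^esub>" if "u \<in> J" for u using that by (simp add: coset_eq_zero_iff)
    ultimately show ?thesis using zero_mem by (auto simp: image_iff)
  next
    case False
    then obtain u where "u \<in> I" "u \<notin> J" by blast
    then have "1 \<in> I" using assms(2)[OF I(1,2)] by blast
    then have "I = UNIV" using uenv_left_ideal.mult_mem[OF I(1), of 1] by (metis UNIV_eq_I mult_1_right)
    then show ?thesis using I(3) by (simp add: carrier_Q)
  qed
qed

lemma uenv_left_ideal_left_ideal: "uenv_left_ideal (left_ideal S)"
  by standard (auto intro: left_ideal.intros)

lemma left_ideal_least:
  assumes "uenv_left_ideal I" "S \<subseteq> I"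
  shows "left_ideal S \<subseteq> I"
proof
  interpret I: uenv_left_ideal I by fact
  fix u assume "u \<in> left_ideal S"
  then show "u \<in> I"
    by induction (use assms(2) I.zero_mem I.add_mem I.mult_mem in auto)
qed

lemma graded_left_idealI:
  assumes "\<And>s. s \<in> S \<Longrightarrow> parity_aut s \<in> left_ideal S"
  shows "graded_left_ideal (left_ideal S)"
proof (intro graded_left_ideal.intro uenv_left_ideal_left_ideal graded_left_ideal_axioms.intro)
  fix u assume "u \<in> left_ideal S"
  then show "parity_aut u \<in> left_ideal S"
    by induction (auto simp: parity_aut_0 parity_aut_add parity_aut_mult intro: assms left_ideal.intros)
qed

section \<open>The Verma module\<close>

text \<open>The Verma module of highest weight \<open>\<lambda>\<close> is free over the polynomials in \<open>t = y\<^sub>2\<close> with basis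
\<open>v\<close>, \<open>x\<^sub>1 v\<close>, \<open>y\<^sub>3 v\<close>, \<open>y\<^sub>3 x\<^sub>1 v\<close>. A quadruple \<open>(f, g, h, k)\<close> stands for
\<open>f v + g x\<^sub>1 v + h y\<^sub>3 v + k y\<^sub>3 x\<^sub>1 v\<close>, with power series
instead of polynomials as coefficients. Since \<open>x\<^sub>1\<close> and \<open>y\<^sub>3\<close> commute with \<open>y\<^sub>2\<close>, they act by matrices,
whereas \<open>x\<^sub>3 f(y\<^sub>2) = f(y\<^sub>2) x\<^sub>3 + f'(y\<^sub>2) x\<^sub>1\<close> and \<open>y\<^sub>1 f(y\<^sub>2) = f(y\<^sub>2) y\<^sub>1 - f'(y\<^sub>2) y\<^sub>3\<close> give rise to derivatives. The even elements act
by the anticommutators of the odd ones.\<close>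

type_synonym fps4 = "complex fps \<times> complex fps \<times> complex fps \<times> complex fps"

definition fps4_scale :: "complex \<Rightarrow> fps4 \<Rightarrow> fps4" where
  "fps4_scale c = (\<lambda>(f, g, h, k). (fps_const c * f, fps_const c * g, fps_const c * h, fps_const c * k))"

text \<open>The parameters are \<open>a = \<lambda>(h\<^sub>1)\<close> and \<open>b = \<lambda>(h\<^sub>1 - h\<^sub>2)\<close>. The diagonal part of a matrix enters through its second and
third entry, the coefficients of \<open>h\<^sub>1\<close> and \<open>h\<^sub>1 - h\<^sub>2\<close>.\<close>

definition verma_rho :: "complex \<Rightarrow> complex \<Rightarrow> sl12 \<Rightarrow> fps4 \<Rightarrow> fps4" where
  "verma_rho a b A = (\<lambda>(f, g, h, k).
     let t = fps_X; D = fps_deriv; e = (\<lambda>i j. fps_const (entry A i j)); a = fps_const a; b = fps_const b in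
     (e 1 2 * (t * h) + e 1 3 * (b * h + t * D h) + e 2 1 * (a * g)
        + e 2 3 * ((a - b) * D f - t * D (D f) + a * k) + e 3 2 * (t * f)
        + e 2 2 * (a * f - t * D f) + e 3 3 * (b * f + t * D f),
      e 1 2 * (f + t * k) + e 1 3 * (D f + (b + 1) * k + t * D k)
        + e 2 3 * ((a - b - 1) * D g - t * D (D g)) + e 3 2 * (t * g)
        + e 2 2 * (a * g - t * D g) + e 3 3 * ((b + 1) * g + t * D g),
      e 3 1 * f - e 2 1 * (D f + a * k)
        + e 2 3 * ((a - b - 1) * D h - t * D (D h)) + e 3 2 * (t * h)
        + e 2 2 * ((a - 1) * h - t * D h) + e 3 3 * (b * h + t * D h),
      e 3 1 * g - e 1 2 * h - e 1 3 * D h - e 2 1 * D g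
        + e 2 3 * ((a - b - 2) * D k - t * D (D k)) + e 3 2 * (t * k)
        + e 2 2 * ((a - 1) * k - t * D k) + e 3 3 * ((b + 1) * k + t * D k)))"

lemma fps_const_hom:
  "fps_const (c + d) = fps_const c + fps_const d" "fps_const (c * d) = fps_const c * fps_const d"
  "fps_const (c - d) = fps_const c - fps_const d" "fps_const (- c) = - fps_const c"
  for c d :: complex
  by simp_all

lemma verma_rho_bracket:
  assumes "x \<in> sl12_part p" "y \<in> sl12_part q"
  shows "verma_rho a b x (verma_rho a b y m) =
    fps4_scale (koszul p q) (verma_rho a b y (verma_rho a b x m)) + verma_rho a b (sl12_bracket x y) m"
proof -
  obtain f g h k where m: "m = (f, g, h, k)" by (cases m)
  define t :: "complex fps" where "t = fps_X"
  have Dt: "fps_deriv t = 1" by (simp add: t_def)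
  define A B where "A = fps_const a" and "B = fps_const b"
  have DAB: "fps_deriv A = 0" "fps_deriv B = 0" by (simp_all add: A_def B_def)
  define e where "e i j = fps_const (entry x i j)" for i j
  define d where "d i j = fps_const (entry y i j)" for i j
  have De: "fps_deriv (e i j) = 0" "fps_deriv (d i j) = 0" for i j by (simp_all add: e_def d_def)
  note rules = prod_eq_iff Dt De DAB fps_deriv_mult
  note br = entry_bracket[OF assms] sum_3 koszul_def fps_const_hom e_def[symmetric] d_def[symmetric]
  have minus_one: "fps_const (- 1) = (- 1 :: complex fps)"
    by (simp flip: fps_const_neg)
  have e0: "e i j = 0" if "index_parity i + index_parity j \<noteq> p" for i j
    using assms(1) that unfolding e_def sl12_part_iff by (metis fps_const_0_eq_0)
  have d0: "d i j = 0" if "index_parity i + index_parity j \<noteq> q" for i j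
    using assms(2) that unfolding d_def sl12_part_iff by (metis fps_const_0_eq_0)
  \<comment> \<open>For each choice of the parities, the claim is an identity in a commutative ring with derivation.\<close>
  consider "p = 0" "q = 0" | "p = 0" "q = 1" | "p = 1" "q = 0" | "p = 1" "q = 1"
    using bit_cases[of p] bit_cases[of q] by blast
  then show ?thesis
  proof cases
    case 1
    have e: "e 1 2 = 0" "e 1 3 = 0" "e 2 1 = 0" "e 3 1 = 0" "d 1 2 = 0" "d 1 3 = 0" "d 2 1 = 0" "d 3 1 = 0"
      by (auto intro!: e0 d0 simp: 1)
    show ?thesis
      unfolding m verma_rho_def Let_def case_prod_conv t_def[symmetric] A_def[symmetric] B_def[symmetric]
        e_def[symmetric] d_def[symmetric] br fps4_scale_def
      by (simp add: rules e 1; simp add: algebra_simps)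
  next
    case 2
    have e: "e 1 2 = 0" "e 1 3 = 0" "e 2 1 = 0" "e 3 1 = 0" "d 1 1 = 0" "d 2 2 = 0" "d 3 3 = 0" "d 2 3 = 0" "d 3 2 = 0"
      by (auto intro!: e0 d0 simp: 2)
    have e11: "e 1 1 = e 2 2 + e 3 3" by (simp add: e_def entry_11)
    show ?thesis
      unfolding m verma_rho_def Let_def case_prod_conv t_def[symmetric] A_def[symmetric] B_def[symmetric]
        e_def[symmetric] d_def[symmetric] br fps4_scale_def
      by (simp add: rules e e11 2; simp add: algebra_simps)
  next
    case 3
    have e: "d 1 2 = 0" "d 1 3 = 0" "d 2 1 = 0" "d 3 1 = 0" "e 1 1 = 0" "e 2 2 = 0" "e 3 3 = 0" "e 2 3 = 0" "e 3 2 = 0"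
      by (auto intro!: e0 d0 simp: 3)
    have e11: "d 1 1 = d 2 2 + d 3 3" by (simp add: d_def entry_11)
    show ?thesis
      unfolding m verma_rho_def Let_def case_prod_conv t_def[symmetric] A_def[symmetric] B_def[symmetric]
        e_def[symmetric] d_def[symmetric] br fps4_scale_def
      by (simp add: rules e e11 3; simp add: algebra_simps)
  next
    case 4
    have e: "d 1 1 = 0" "d 2 2 = 0" "d 3 3 = 0" "d 2 3 = 0" "d 3 2 = 0" "e 1 1 = 0" "e 2 2 = 0" "e 3 3 = 0" "e 2 3 = 0" "e 3 2 = 0"
      by (auto intro!: e0 d0 simp: 4)
    show ?thesis
      unfolding m verma_rho_def Let_def case_prod_conv t_def[symmetric] A_def[symmetric] B_def[symmetric]
        e_def[symmetric] d_def[symmetric] br fps4_scale_def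
      by (simp add: rules e 4 minus_one; simp add: algebra_simps)
  qed
qed

lemma verma_rho_simps:
  "verma_rho a b x1 (f, g, h, k) = (fps_X * h, f + fps_X * k, 0, - h)"
  "verma_rho a b x3 (f, g, h, k) = (fps_const b * h + fps_X * fps_deriv h,
     fps_deriv f + (fps_const b + 1) * k + fps_X * fps_deriv k, 0, - fps_deriv h)"
  "verma_rho a b y1 (f, g, h, k) = (fps_const a * g, 0, - (fps_deriv f + fps_const a * k), - fps_deriv g)"
  "verma_rho a b y3 (f, g, h, k) = (0, 0, f, g)"
  "verma_rho a b y2 (f, g, h, k) = (fps_X * f, fps_X * g, fps_X * h, fps_X * k)"
  by (simp_all add: verma_rho_def entry_basis Let_def)

lemma verma_rho_highest:
  "verma_rho a b x2 (1, 0, 0, 0) = 0" "verma_rho a b x3 (1, 0, 0, 0) = 0" "verma_rho a b y1 (1, 0, 0, 0) = 0"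
  "verma_rho a b h1 (1, 0, 0, 0) = fps4_scale a (1, 0, 0, 0)"
  "verma_rho a b h2 (1, 0, 0, 0) = fps4_scale (a - b) (1, 0, 0, 0)"
  by (simp_all add: verma_rho_def entry_basis Let_def fps4_scale_def zero_prod_def)

interpretation verma: sl12_rep fps4_scale "verma_rho a b" for a b
proof
  fix c d :: complex and x y :: sl12 and m m' :: fps4
  obtain f g h k where m: "m = (f, g, h, k)" by (cases m)
  obtain f' g' h' k' where m': "m' = (f', g', h', k')" by (cases m')
  show "fps4_scale c (m + m') = fps4_scale c m + fps4_scale c m'"
    "fps4_scale (c + d) m = fps4_scale c m + fps4_scale d m"
    "fps4_scale c (fps4_scale d m) = fps4_scale (c * d) m" "fps4_scale 1 m = m"
    by (simp_all add: m m' fps4_scale_def fps_const_hom(1,2) algebra_simps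
        del: fps_const_add fps_const_mult fps_const_sub fps_const_neg)
  show "verma_rho a b (x + y) m = verma_rho a b x m + verma_rho a b y m"
    by (simp add: m verma_rho_def Let_def entry_add fps_const_hom(1,2) algebra_simps del: fps_const_add fps_const_mult fps_const_sub fps_const_neg)
  show "verma_rho a b (sl12_scale c x) m = fps4_scale c (verma_rho a b x m)"
    by (simp add: m verma_rho_def Let_def entry_scale fps_const_hom(1,2) fps4_scale_def algebra_simps
        del: fps_const_add fps_const_mult fps_const_sub fps_const_neg)
  show "verma_rho a b x (m + m') = verma_rho a b x m + verma_rho a b x m'"
    by (simp add: m m' verma_rho_def Let_def algebra_simps)
  show "verma_rho a b x (fps4_scale c m) = fps4_scale c (verma_rho a b x m)"
    by (simp add: m verma_rho_def Let_def fps4_scale_def algebra_simps del: fps_const_add fps_const_mult fps_const_sub fps_const_neg)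
qed (rule verma_rho_bracket)

section \<open>Invariant subspaces\<close>

context sl12_rep
begin

definition invariant :: "'v set \<Rightarrow> bool" where
  "invariant N \<longleftrightarrow> subspace N \<and> (\<forall>x. \<forall>m\<in>N. rho x m \<in> N)"

text \<open>The odd elements \<open>x\<^sub>1, x\<^sub>3, y\<^sub>1, y\<^sub>3\<close> generate the Lie superalgebra.\<close>

lemma invariantI:
  assumes N: "subspace N"
    and odd: "\<And>m. m \<in> N \<Longrightarrow> rho x1 m \<in> N" "\<And>m. m \<in> N \<Longrightarrow> rho x3 m \<in> N"
      "\<And>m. m \<in> N \<Longrightarrow> rho y1 m \<in> N" "\<And>m. m \<in> N \<Longrightarrow> rho y3 m \<in> N"
  shows "invariant N"
  unfolding invariant_def
proof (intro conjI N allI ballI)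
  fix A m assume m: "m \<in> N"
  note sub = subspace_add[OF N] subspace_scale[OF N] subspace_diff[OF N]
  have br: "rho (sl12_bracket x y) m \<in> N"
    if "x \<in> sl12_part 1" "y \<in> sl12_part 1" "rho x (rho y m) \<in> N" "rho y (rho x m) \<in> N" for x y
  proof -
    have "rho (sl12_bracket x y) m = rho x (rho y m) - scale (koszul 1 1) (rho y (rho x m))"
      using rho_bracket[OF that(1,2)] by simp
    then show ?thesis using that sub by simp
  qed
  have "rho h1 m \<in> N" "rho (h1 - h2) m \<in> N" "rho y2 m \<in> N" "rho x2 m \<in> N"
    using br[of x1 y1] br[of x3 y3] br[of x1 y3] br[of y1 x3] odd m
    by (simp_all add: sl12_part_basis sl12_bracket_odd_odd)
  then have "rho (sl12_scale (entry A 1 2) x1 + sl12_scale (entry A 1 3) x3 + sl12_scale (entry A 2 1) y1 +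
      sl12_scale (entry A 3 1) y3 + sl12_scale (entry A 2 3) x2 + sl12_scale (entry A 3 2) y2 +
      sl12_scale (entry A 2 2) h1 + sl12_scale (entry A 3 3) (h1 - h2)) m \<in> N"
    unfolding rho_add rho_scale by (intro sub odd m)
  then show "rho A m \<in> N" by (simp flip: sl12_decomp)
qed

lemma invariant_uenv_act:
  assumes "invariant N" "m \<in> N"
  shows "uenv_act u m \<in> N"
  using assms(2)
proof (induction u arbitrary: m rule: uenv_induct)
  case (scalar c)
  then show ?case using assms(1) by (simp add: uenv_act_scalar invariant_def subspace_scale)
next
  case (gen_mult x u)
  then show ?case using assms(1) by (simp add: uenv_act_mult uenv_act_gen invariant_def)
next
  case (add u w)
  then show ?case using assms(1) by (simp add: uenv_act_add invariant_def subspace_add)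
qed

text \<open>This is the universal property of the generalized Kac module, with vanishing replaced by membership in an invariant
subspace: the elements that map \<open>m\<close> into \<open>N\<close> form a left ideal.\<close>

lemma kac_ideal_annihilates:
  assumes N: "invariant N" and l: "l \<in> cartan_dual"
    and m: "rho y1 m \<in> N" "rho x2 m \<in> N" "rho x3 m \<in> N"
      "rho h1 m - scale (l h1) m \<in> N" "rho h2 m - scale (l h2) m \<in> N"
      "\<And>n. of_nat n = l h2 \<Longrightarrow> (rho y2 ^^ Suc n) m \<in> N"
    and u: "u \<in> left_ideal (kac_relations l)"
  shows "uenv_act u m \<in> N"
proof -
  from N have sub: "subspace N" by (simp add: invariant_def)
  have ideal: "uenv_left_ideal {u. uenv_act u m \<in> N}"
    by standard (simp_all add: uenv_act_0 uenv_act_add uenv_act_mult subspace_0[OF sub]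
        subspace_add[OF sub] invariant_uenv_act[OF N])
  have nplus: "rho x m \<in> N" if "x \<in> nplus" for x
  proof -
    have "sl12.subspace {x. rho x m \<in> N}"
      by (rule sl12.subspaceI)
        (use rho_scale[of 0 0 m] in \<open>simp_all add: rho_add rho_scale subspace_0[OF sub] subspace_add[OF sub]
          subspace_scale[OF sub]\<close>)
    then show ?thesis
      using sl12.span_minimal[of "{y1, x2, x3}" "{x. rho x m \<in> N}"] that m by (auto simp: nplus_def)
  qed
  have cartan: "rho h m - scale (l h) m \<in> N" if "h \<in> cartan" for h
  proof -
    have l_add: "l (h + k) = l h + l k" if "h \<in> cartan" "k \<in> cartan" for h k
      using l that by (auto simp: cartan_dual_def)
    have l_scale: "l (sl12_scale c h) = c * l h" if "h \<in> cartan" for h c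
      using l that by (auto simp: cartan_dual_def)
    have zero: "0 \<in> cartan" by (simp add: cartan_def sl12.span_zero)
    have "sl12.subspace {h \<in> cartan. rho h m - scale (l h) m \<in> N}"
    proof (rule sl12.subspaceI)
      show "0 \<in> {h \<in> cartan. rho h m - scale (l h) m \<in> N}"
        using zero l_scale[OF zero, of 0] rho_scale[of 0 0 m] by (simp add: subspace_0[OF sub])
      fix h k assume hk: "h \<in> {h \<in> cartan. rho h m - scale (l h) m \<in> N}" "k \<in> {h \<in> cartan. rho h m - scale (l h) m \<in> N}"
      then have "rho (h + k) m - scale (l (h + k)) m = (rho h m - scale (l h) m) + (rho k m - scale (l k) m)"
        by (simp add: l_add rho_add scale_left_distrib)
      then show "h + k \<in> {h \<in> cartan. rho h m - scale (l h) m \<in> N}"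
        using hk by (auto simp: subspace_add[OF sub] cartan_def sl12.span_add)
      fix c
      have "rho (sl12_scale c h) m - scale (l (sl12_scale c h)) m = scale c (rho h m - scale (l h) m)"
        using hk by (simp add: l_scale rho_scale scale_right_diff_distrib)
      then show "sl12_scale c h \<in> {h \<in> cartan. rho h m - scale (l h) m \<in> N}"
        using hk by (auto simp: subspace_scale[OF sub] cartan_def sl12.span_scale)
    qed
    moreover have "{h1, h2} \<subseteq> {h \<in> cartan. rho h m - scale (l h) m \<in> N}"
      using m by (auto simp: cartan_def intro: sl12.span_base)
    ultimately show ?thesis
      using sl12.span_minimal that unfolding cartan_def by blast
  qed
  have power: "uenv_act (uenv_gen y2 ^ k) m = (rho y2 ^^ k) m" for k
    using uenv_act_scalar[of 1] by (induction k) (simp_all add: uenv_act_mult uenv_act_gen)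
  have "kac_relations l \<subseteq> {u. uenv_act u m \<in> N}"
    using nplus cartan m(6)
    by (auto simp: kac_relations_def uenv_act_gen uenv_act_diff uenv_act_scalar power simp del: power_Suc funpow.simps)
  then show ?thesis using left_ideal_least[OF ideal] u by auto
qed

end

lemma fps_X_deriv_nth: "fps_nth (fps_X * fps_deriv f) i = of_nat i * (fps_nth f i :: complex)"
  by (cases i) simp_all

lemma fps_X_nth: "fps_nth (fps_X * f) i = (if i = 0 then 0 else fps_nth f (i - 1) :: complex)"
  by (rule fps_X_mult_nth)

text \<open>An invariant subspace that contains \<open>t\<^sup>n\<^sup>+\<^sup>2 v\<close> when \<open>\<lambda>(h\<^sub>2) = n + 1\<close>. Applying \<open>x\<^sub>3\<close>, \<open>y\<^sub>1\<close> and \<open>y\<^sub>1 x\<^sub>3\<close> to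
this vector gives multiples of \<open>t\<^sup>n\<^sup>+\<^sup>1 x\<^sub>1 v\<close>, \<open>t\<^sup>n\<^sup>+\<^sup>1 y\<^sub>3 v\<close> and \<open>(n + 1) t\<^sup>n y\<^sub>3 x\<^sub>1 v - a t\<^sup>n\<^sup>+\<^sup>1 v\<close>. The last vector is
the reason for the linear condition.\<close>

definition verma_kernel :: "complex \<Rightarrow> nat \<Rightarrow> fps4 set" where
  "verma_kernel a n = {(f, g, h, k). (\<forall>i\<le>n. fps_nth f i = 0 \<and> fps_nth g i = 0 \<and> fps_nth h i = 0) \<and> (\<forall>i<n. fps_nth k i = 0) \<and>
     of_nat (Suc n) * fps_nth f (Suc n) + a * fps_nth k n = 0}"

text \<open>For \<open>a = 0\<close> and \<open>b = - (n + 1)\<close>, an invariant subspace that contains \<open>x\<^sub>1 v\<close> and \<open>t\<^sup>n\<^sup>+\<^sup>2 v\<close>, but not \<open>v\<close>.\<close>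

definition verma_sub_x1 :: "nat \<Rightarrow> fps4 set" where
  "verma_sub_x1 n = {(f, g, h, k). (\<forall>i\<le>Suc n. fps_nth f i = 0) \<and> (\<forall>i\<le>n. fps_nth h i = 0)}"

text \<open>For \<open>a = n + 1\<close> and \<open>b = 0\<close>, an invariant subspace that contains \<open>y\<^sub>3 v\<close> and \<open>t\<^sup>n\<^sup>+\<^sup>2 v\<close>, but not \<open>v\<close>. It contains
\<open>x\<^sub>1 y\<^sub>3 v = t v - y\<^sub>3 x\<^sub>1 v\<close>, on which \<open>f + t k\<close> vanishes.\<close>

definition verma_sub_y3 :: "nat \<Rightarrow> fps4 set" where
  "verma_sub_y3 n = {(f, g, h, k). (\<forall>i\<le>n. fps_nth g i = 0) \<and> (\<forall>i\<le>Suc n. fps_nth (f + fps_X * k) i = 0)}"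

lemmas verma_simps = verma_rho_simps fps4_scale_def zero_prod_def fps_X_deriv_nth fps_X_nth


lemma invariant_verma_kernel:
  assumes "b = a - of_nat (Suc n)"
  shows "verma.invariant a b (verma_kernel a n)"
proof (rule verma.invariantI)
  show "verma.subspace (verma_kernel a n)"
  proof (rule verma.subspaceI)
    show "0 \<in> verma_kernel a n" by (simp add: verma_kernel_def zero_prod_def)
    fix m m' assume m: "m \<in> verma_kernel a n" "m' \<in> verma_kernel a n"
    obtain f g h k f' g' h' k' where fghk: "m = (f, g, h, k)" "m' = (f', g', h', k')" by (cases m, cases m')
    have "of_nat (Suc n) * fps_nth f (Suc n) + a * fps_nth k n = 0"
      "of_nat (Suc n) * fps_nth f' (Suc n) + a * fps_nth k' n = 0"
      using m unfolding verma_kernel_def fghk by simp_all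
    moreover have "of_nat (Suc n) * fps_nth (f + f') (Suc n) + a * fps_nth (k + k') n =
        (of_nat (Suc n) * fps_nth f (Suc n) + a * fps_nth k n) +
        (of_nat (Suc n) * fps_nth f' (Suc n) + a * fps_nth k' n)"
      by (simp only: fps_add_nth distrib_left add_ac)
    moreover have "of_nat (Suc n) * fps_nth (fps_const c * f) (Suc n) + a * fps_nth (fps_const c * k) n =
        c * (of_nat (Suc n) * fps_nth f (Suc n) + a * fps_nth k n)" for c
      by (simp only: fps_mult_left_const_nth) (simp only: distrib_left mult_ac)
    ultimately show "m + m' \<in> verma_kernel a n" "fps4_scale c m \<in> verma_kernel a n" for c
      using m by (simp_all add: verma_kernel_def fps4_scale_def fghk del: of_nat_Suc)
  qed
  fix m assume m: "m \<in> verma_kernel a n"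
  obtain f g h k where fghk: "m = (f, g, h, k)" by (cases m)
  have c: "\<And>i. i \<le> n \<Longrightarrow> fps_nth f i = 0 \<and> fps_nth g i = 0 \<and> fps_nth h i = 0" "\<And>i. i < n \<Longrightarrow> fps_nth k i = 0"
    "of_nat (Suc n) * fps_nth f (Suc n) + a * fps_nth k n = 0"
    using m by (auto simp: verma_kernel_def fghk)
  show "verma_rho a b x1 m \<in> verma_kernel a n"
    using c by (auto simp: fghk verma_kernel_def verma_simps)
  show "verma_rho a b y3 m \<in> verma_kernel a n"
    using c by (auto simp: fghk verma_kernel_def verma_simps)
  have "fps_nth (- (fps_deriv f + fps_const a * k)) i = 0" if "i \<le> n" for i
    using c(1)[of "Suc i"] c(2)[of i] c(3) that by (cases "i = n") (auto simp: neg_eq_iff_add_eq_0)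
  then show "verma_rho a b y1 m \<in> verma_kernel a n"
    using c(1,2) by (auto simp: fghk verma_kernel_def verma_simps algebra_simps)
  show "verma_rho a b x3 m \<in> verma_kernel a n"
  proof -
    have d: "fps_nth (fps_deriv f) i + (b + 1) * fps_nth k i + of_nat i * fps_nth k i = 0" if "i \<le> n" for i
    proof (cases "i = n")
      case True
      have a: "a = b + of_nat (Suc n)" using assms by simp
      show ?thesis using c(3) True unfolding a by (simp add: algebra_simps)
    next
      case False
      then show ?thesis using c(1)[of "Suc i"] c(2)[of i] that by simp
    qed
    show ?thesis
      using d d[of 0] c assms by (auto simp: fghk verma_kernel_def verma_simps algebra_simps)
  qed
qed

lemma invariant_verma_sub_x1: "verma.invariant 0 (- of_nat (Suc n)) (verma_sub_x1 n)"
proof (rule verma.invariantI)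
  show "verma.subspace (verma_sub_x1 n)"
    by (rule verma.subspaceI) (auto simp: verma_sub_x1_def fps4_scale_def zero_prod_def)
  fix m assume m: "m \<in> verma_sub_x1 n"
  obtain f g h k where fghk: "m = (f, g, h, k)" by (cases m)
  have c: "\<And>i. i \<le> Suc n \<Longrightarrow> fps_nth f i = 0" "\<And>i. i \<le> n \<Longrightarrow> fps_nth h i = 0"
    using m by (auto simp: verma_sub_x1_def fghk)
  show "verma_rho 0 (- of_nat (Suc n)) x1 m \<in> verma_sub_x1 n"
    "verma_rho 0 (- of_nat (Suc n)) y3 m \<in> verma_sub_x1 n"
    "verma_rho 0 (- of_nat (Suc n)) y1 m \<in> verma_sub_x1 n"
    using c by (auto simp: fghk verma_sub_x1_def verma_simps)
  have "- of_nat (Suc n) * fps_nth h i + of_nat i * fps_nth h i = 0" if "i \<le> Suc n" for i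
    using c(2)[of i] that by (cases "i = Suc n") (auto simp: algebra_simps)
  then show "verma_rho 0 (- of_nat (Suc n)) x3 m \<in> verma_sub_x1 n"
    using c by (auto simp: fghk verma_sub_x1_def verma_simps simp del: of_nat_Suc)
qed

lemma invariant_verma_sub_y3: "verma.invariant (of_nat (Suc n)) 0 (verma_sub_y3 n)"
proof (rule verma.invariantI)
  show "verma.subspace (verma_sub_y3 n)"
  proof (rule verma.subspaceI)
    show "0 \<in> verma_sub_y3 n" by (simp add: verma_sub_y3_def zero_prod_def)
    fix m m' assume m: "m \<in> verma_sub_y3 n" "m' \<in> verma_sub_y3 n"
    obtain f g h k f' g' h' k' where fghk: "m = (f, g, h, k)" "m' = (f', g', h', k')" by (cases m, cases m')
    have "f + f' + fps_X * (k + k') = (f + fps_X * k) + (f' + fps_X * k')"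
      "fps_const c * f + fps_X * (fps_const c * k) = fps_const c * (f + fps_X * k)" for c
      by (simp_all add: algebra_simps)
    note eq = this
    have iff: "(f, g, h, k) \<in> verma_sub_y3 n \<longleftrightarrow>
        (\<forall>i\<le>n. fps_nth g i = 0) \<and> (\<forall>i\<le>Suc n. fps_nth (f + fps_X * k) i = 0)" for f g h k
      by (simp add: verma_sub_y3_def)
    show "m + m' \<in> verma_sub_y3 n" "fps4_scale c m \<in> verma_sub_y3 n" for c
      using m unfolding fghk add_Pair fps4_scale_def case_prod_conv iff eq
      by (simp_all only: fps_add_nth[of "_ + _" "_ + _"] fps_mult_left_const_nth) (simp_all del: fps_X_mult_nth)
  qed
  fix m assume m: "m \<in> verma_sub_y3 n"
  obtain f g h k where fghk: "m = (f, g, h, k)" by (cases m)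
  have c: "\<And>i. i \<le> n \<Longrightarrow> fps_nth g i = 0" "\<And>i. i \<le> Suc n \<Longrightarrow> fps_nth (f + fps_X * k) i = 0"
    using m by (auto simp: verma_sub_y3_def fghk)
  show "verma_rho (of_nat (Suc n)) 0 x1 m \<in> verma_sub_y3 n"
    "verma_rho (of_nat (Suc n)) 0 y3 m \<in> verma_sub_y3 n"
    using c by (auto simp: fghk verma_sub_y3_def verma_simps)
  have "of_nat (Suc n) * fps_nth g i - of_nat i * fps_nth g i = 0" if "i \<le> Suc n" for i
    using c(1)[of i] that by (cases "i = Suc n") auto
  then show "verma_rho (of_nat (Suc n)) 0 y1 m \<in> verma_sub_y3 n"
    using c by (auto simp: fghk verma_sub_y3_def verma_simps simp del: of_nat_Suc)
  have "fps_nth (fps_deriv f) i + fps_nth k i + of_nat i * fps_nth k i = 0" if "i \<le> n" for i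
  proof -
    have "fps_nth (fps_deriv f) i + fps_nth k i + of_nat i * fps_nth k i = of_nat (Suc i) * fps_nth (f + fps_X * k) (Suc i)"
      by (simp add: fps_X_nth algebra_simps)
    then show ?thesis using c(2)[of "Suc i"] that by simp
  qed
  then show "verma_rho (of_nat (Suc n)) 0 x3 m \<in> verma_sub_y3 n"
    using c c(2)[of 1] by (auto simp: fghk verma_sub_y3_def verma_simps)
qed

lemma verma_power: "(verma_rho a b y2 ^^ j) (1, 0, 0, 0) = (fps_X ^ j, 0, 0, 0)"
  by (induction j) (simp_all add: verma_rho_simps)

context
  fixes l :: "sl12 \<Rightarrow> complex" and n :: nat
  assumes l: "l \<in> cartan_dual" "l h2 = of_nat (Suc n)"
begin

lemma kac_ideal_verma:
  assumes N: "verma.invariant (l h1) (l h1 - l h2) N" and power: "(fps_X ^ Suc (Suc n), 0, 0, 0) \<in> N"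
    and u: "u \<in> left_ideal (kac_relations l)"
  shows "verma.uenv_act (l h1) (l h1 - l h2) u (1, 0, 0, 0) \<in> N"
proof (rule verma.kac_ideal_annihilates[OF N l(1) _ _ _ _ _ _ u])
  have "0 \<in> N" using N by (simp add: verma.invariant_def verma.subspace_0)
  then show "verma_rho (l h1) (l h1 - l h2) y1 (1, 0, 0, 0) \<in> N"
    "verma_rho (l h1) (l h1 - l h2) x2 (1, 0, 0, 0) \<in> N"
    "verma_rho (l h1) (l h1 - l h2) x3 (1, 0, 0, 0) \<in> N"
    "verma_rho (l h1) (l h1 - l h2) h1 (1, 0, 0, 0) - fps4_scale (l h1) (1, 0, 0, 0) \<in> N"
    "verma_rho (l h1) (l h1 - l h2) h2 (1, 0, 0, 0) - fps4_scale (l h2) (1, 0, 0, 0) \<in> N"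
    by (simp_all only: verma_rho_highest) simp_all
  fix j assume "of_nat j = l h2"
  then have "j = Suc n" using l(2) by (metis of_nat_eq_iff)
  then show "(verma_rho (l h1) (l h1 - l h2) y2 ^^ Suc j) (1, 0, 0, 0) \<in> N"
    using power by (simp only: verma_power)
qed

lemma verma_kernel_ideal:
  "u \<in> left_ideal (kac_relations l) \<Longrightarrow>
    verma.uenv_act (l h1) (l h1 - l h2) u (1, 0, 0, 0) \<in> verma_kernel (l h1) n"
  by (rule kac_ideal_verma[OF invariant_verma_kernel]) (simp_all add: l(2) verma_kernel_def fps_X_power_nth del: power_Suc)

lemma one_notin_kac_ideal: "1 \<notin> left_ideal (kac_relations l)"
proof
  assume "1 \<in> left_ideal (kac_relations l)"
  from verma_kernel_ideal[OF this] show False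
    using verma.uenv_act_scalar[of "l h1" "l h1 - l h2" 1] by (auto simp: verma_kernel_def dest: spec[of _ 0])
qed

lemma x1_notin_kac_ideal: "uenv_gen x1 \<notin> left_ideal (kac_relations l)"
proof
  assume "uenv_gen x1 \<in> left_ideal (kac_relations l)"
  from verma_kernel_ideal[OF this] show False
    by (auto simp: verma.uenv_act_gen verma_rho_simps verma_kernel_def dest: spec[of _ 0])
qed

lemma y3_notin_kac_ideal: "uenv_gen y3 \<notin> left_ideal (kac_relations l)"
proof
  assume "uenv_gen y3 \<in> left_ideal (kac_relations l)"
  from verma_kernel_ideal[OF this] show False
    by (auto simp: verma.uenv_act_gen verma_rho_simps verma_kernel_def dest: spec[of _ 0])
qed

lemma x1_not_generating:
  assumes "l h1 = 0"
  shows "1 - r * uenv_gen x1 \<notin> left_ideal (kac_relations l)"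
proof
  assume "1 - r * uenv_gen x1 \<in> left_ideal (kac_relations l)"
  moreover have inv: "verma.invariant (l h1) (l h1 - l h2) (verma_sub_x1 n)"
    using invariant_verma_sub_x1[of n] by (simp only: assms l(2) diff_0)
  ultimately have "verma.uenv_act (l h1) (l h1 - l h2) (1 - r * uenv_gen x1) (1, 0, 0, 0) \<in> verma_sub_x1 n"
    by (intro kac_ideal_verma) (auto simp: verma_sub_x1_def fps_X_power_nth simp del: power_Suc)
  moreover have "verma.uenv_act (l h1) (l h1 - l h2) (r * uenv_gen x1) (1, 0, 0, 0) \<in> verma_sub_x1 n"
    unfolding verma.uenv_act_mult verma.uenv_act_gen verma_rho_simps
    by (rule verma.invariant_uenv_act[OF inv]) (simp add: verma_sub_x1_def)
  ultimately have "verma.uenv_act (l h1) (l h1 - l h2) 1 (1, 0, 0, 0) \<in> verma_sub_x1 n"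
    using verma.subspace_add inv unfolding verma.invariant_def verma.uenv_act_diff by fastforce
  then show False
    using verma.uenv_act_scalar[of "l h1" "l h1 - l h2" 1] by (auto simp: verma_sub_x1_def)
qed

lemma y3_not_generating:
  assumes "l h1 = l h2"
  shows "1 - r * uenv_gen y3 \<notin> left_ideal (kac_relations l)"
proof
  assume "1 - r * uenv_gen y3 \<in> left_ideal (kac_relations l)"
  moreover have inv: "verma.invariant (l h1) (l h1 - l h2) (verma_sub_y3 n)"
    using invariant_verma_sub_y3[of n] by (simp only: assms l(2) diff_self)
  ultimately have "verma.uenv_act (l h1) (l h1 - l h2) (1 - r * uenv_gen y3) (1, 0, 0, 0) \<in> verma_sub_y3 n"
    by (intro kac_ideal_verma) (auto simp: verma_sub_y3_def fps_X_power_nth simp del: power_Suc)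
  moreover have "verma.uenv_act (l h1) (l h1 - l h2) (r * uenv_gen y3) (1, 0, 0, 0) \<in> verma_sub_y3 n"
    unfolding verma.uenv_act_mult verma.uenv_act_gen verma_rho_simps
    by (rule verma.invariant_uenv_act[OF inv]) (simp add: verma_sub_y3_def)
  ultimately have "verma.uenv_act (l h1) (l h1 - l h2) 1 (1, 0, 0, 0) \<in> verma_sub_y3 n"
    using verma.subspace_add inv unfolding verma.invariant_def verma.uenv_act_diff by fastforce
  then show False
    using verma.uenv_act_scalar[of "l h1" "l h1 - l h2" 1] by (auto simp: verma_sub_y3_def)
qed

end

section \<open>Commutation relations\<close>

abbreviation "X1 \<equiv> uenv_gen x1"
abbreviation "X2 \<equiv> uenv_gen x2"
abbreviation "X3 \<equiv> uenv_gen x3"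
abbreviation "Y1 \<equiv> uenv_gen y1"
abbreviation "Y2 \<equiv> uenv_gen y2"
abbreviation "Y3 \<equiv> uenv_gen y3"
abbreviation "H1 \<equiv> uenv_gen h1"
abbreviation "H2 \<equiv> uenv_gen h2"

lemma odd_commutations:
  "X1 * Y3 = Y2 - Y3 * X1" "X3 * Y3 = H1 - H2 - Y3 * X3" "X3 * X1 = - X1 * X3" "Y1 * Y3 = - Y3 * Y1"
  "Y1 * X1 = H1 - X1 * Y1"
proof -
  note bracket = uenv_gen_mult_bracket[where p = 1 and q = 1, unfolded koszul_def, simplified]
  show "X1 * Y3 = Y2 - Y3 * X1" "X3 * Y3 = H1 - H2 - Y3 * X3" "X3 * X1 = - X1 * X3" "Y1 * Y3 = - Y3 * Y1"
    "Y1 * X1 = H1 - X1 * Y1"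
    using bracket[of x1 y3] bracket[of x3 y3] bracket[of x3 x1] bracket[of y1 y3] bracket[of x1 y1]
    by (simp_all add: sl12_part_basis sl12_bracket_odd_odd uenv_gen_diff)
qed

lemma odd_squares: "X1 * X1 = 0" "Y3 * Y3 = 0"
proof -
  have "uenv_gen x * uenv_gen x = 0" if "x \<in> sl12_part 1" "sl12_bracket x x = 0" for x
  proof -
    have "uenv_gen x * uenv_gen x + uenv_gen x * uenv_gen x = 0"
      using uenv_gen_mult_bracket[OF that(1) that(1)] that(2) by (simp add: koszul_def eq_neg_iff_add_eq_0)
    then have "uenv_scalar (1 / 2 + 1 / 2) * (uenv_gen x * uenv_gen x) = 0"
      by (metis uenv_scalar_add distrib_left distrib_right mult_zero_right)
    then show ?thesis by simp
  qed
  then show "X1 * X1 = 0" "Y3 * Y3 = 0"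
    by (simp_all add: sl12_part_basis sl12_bracket_odd_odd)
qed

lemma even_commutations:
  "X1 * Y2 = Y2 * X1" "Y3 * Y2 = Y2 * Y3" "Y1 * Y2 = Y2 * Y1 - Y3" "X3 * Y2 = Y2 * X3 + X1"
  "X2 * X1 = X1 * X2 - X3" "X2 * Y3 = Y3 * X2 + Y1" "X2 * Y2 = Y2 * X2 + H2"
  "H1 * X1 = X1 * H1" "H1 * Y3 = Y3 * H1 - Y3" "H1 * Y2 = Y2 * H1 - Y2"
  "H2 * X1 = X1 * H2 - X1" "H2 * Y3 = Y3 * H2 - Y3" "H2 * Y2 = Y2 * H2 - 2 * Y2"
proof -
  note b0 = uenv_gen_mult_bracket[where p = 0, unfolded koszul_def, simplified]
  note b1 = uenv_gen_mult_bracket[where q = 0, unfolded koszul_def, simplified]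
  note simps = sl12_part_basis sl12_bracket_even_odd sl12_bracket_odd_even sl12_bracket_even_even
    uenv_gen_diff uenv_gen_minus
  show "X1 * Y2 = Y2 * X1" "Y3 * Y2 = Y2 * Y3" "Y1 * Y2 = Y2 * Y1 - Y3" "X3 * Y2 = Y2 * X3 + X1"
    using b1[of x1 1 y2] b1[of y3 1 y2] b1[of y1 1 y2] b1[of x3 1 y2] by (simp_all add: simps)
  show "X2 * X1 = X1 * X2 - X3" "X2 * Y3 = Y3 * X2 + Y1" "H1 * X1 = X1 * H1" "H1 * Y3 = Y3 * H1 - Y3"
    "H2 * X1 = X1 * H2 - X1" "H2 * Y3 = Y3 * H2 - Y3"
    using b0[of x2 x1 1] b0[of x2 y3 1] b0[of h1 x1 1] b0[of h1 y3 1] b0[of h2 x1 1] b0[of h2 y3 1]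
    by (simp_all add: simps)
  show "X2 * Y2 = Y2 * X2 + H2" "H1 * Y2 = Y2 * H1 - Y2" "H2 * Y2 = Y2 * H2 - 2 * Y2"
    using b0[of x2 y2 0] b0[of h1 y2 0] b0[of h2 y2 0] by (simp_all add: simps mult_2)
qed

text \<open>All of these follow by induction from the case of the first power. The last one is the usual relation in the
enveloping algebra of \<open>sl(2)\<close>.\<close>

lemma Y2_power_commutations:
  "X1 * Y2 ^ i = Y2 ^ i * X1" "Y3 * Y2 ^ i = Y2 ^ i * Y3"
  "Y1 * Y2 ^ Suc i = Y2 ^ Suc i * Y1 - of_nat (Suc i) * (Y2 ^ i * Y3)"
  "X3 * Y2 ^ Suc i = Y2 ^ Suc i * X3 + of_nat (Suc i) * (Y2 ^ i * X1)"
  "H2 * Y2 ^ i = Y2 ^ i * H2 - of_nat (2 * i) * Y2 ^ i"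
  "X2 * Y2 ^ Suc i = Y2 ^ Suc i * X2 + of_nat (Suc i) * (Y2 ^ i * (H2 - of_nat i))"
proof -
  show X1: "X1 * Y2 ^ i = Y2 ^ i * X1" for i
    by (rule power_commuting_commutes[symmetric]) (simp add: even_commutations)
  show Y3: "Y3 * Y2 ^ i = Y2 ^ i * Y3" for i
    by (rule power_commuting_commutes[symmetric]) (simp add: even_commutations)
  have pow: "Y2 ^ Suc i = Y2 * Y2 ^ i" for i by simp
  have comm: "Y2 * (of_nat i * u) = of_nat i * (Y2 * u)" for i u
    by (metis mult.assoc mult_of_nat_commute)
  have comm2: "Y2 * (2 * u) = 2 * (Y2 * u)" for u
    using comm[of 2 u] by simp
  have comm_power: "Y2 ^ i * of_nat j = of_nat j * Y2 ^ i" for i j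
    by (metis mult_of_nat_commute)
  show "Y1 * Y2 ^ Suc i = Y2 ^ Suc i * Y1 - of_nat (Suc i) * (Y2 ^ i * Y3)"
  proof (induction i)
    case (Suc i)
    have "Y1 * Y2 ^ Suc (Suc i) = Y2 * (Y1 * Y2 ^ Suc i) - Y3 * Y2 ^ Suc i"
      by (simp only: pow[of "Suc i"] mult.assoc[symmetric] even_commutations left_diff_distrib)
    also have "\<dots> = Y2 ^ Suc (Suc i) * Y1 - of_nat (Suc (Suc i)) * (Y2 ^ Suc i * Y3)"
      unfolding Suc.IH Y3 by (simp add: algebra_simps comm comm2 comm_power mult_2)
    finally show ?case .
  qed (simp add: even_commutations)
  show "X3 * Y2 ^ Suc i = Y2 ^ Suc i * X3 + of_nat (Suc i) * (Y2 ^ i * X1)"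
  proof (induction i)
    case (Suc i)
    have "X3 * Y2 ^ Suc (Suc i) = Y2 * (X3 * Y2 ^ Suc i) + X1 * Y2 ^ Suc i"
      by (simp only: pow[of "Suc i"] mult.assoc[symmetric] even_commutations distrib_right)
    also have "\<dots> = Y2 ^ Suc (Suc i) * X3 + of_nat (Suc (Suc i)) * (Y2 ^ Suc i * X1)"
      unfolding Suc.IH X1 by (simp add: algebra_simps comm comm2 comm_power mult_2)
    finally show ?case .
  qed (simp add: even_commutations)
  show H2: "H2 * Y2 ^ i = Y2 ^ i * H2 - of_nat (2 * i) * Y2 ^ i" for i
  proof (induction i)
    case (Suc i)
    have "H2 * Y2 ^ Suc i = Y2 * (H2 * Y2 ^ i) - 2 * Y2 ^ Suc i"
      by (simp only: pow[of i] mult.assoc[symmetric] even_commutations left_diff_distrib)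
    also have "\<dots> = Y2 ^ Suc i * H2 - of_nat (2 * Suc i) * Y2 ^ Suc i"
      unfolding Suc.IH by (simp add: algebra_simps comm comm2 comm_power mult_2)
    finally show ?case .
  qed simp
  show "X2 * Y2 ^ Suc i = Y2 ^ Suc i * X2 + of_nat (Suc i) * (Y2 ^ i * (H2 - of_nat i))"
  proof (induction i)
    case (Suc i)
    have "X2 * Y2 ^ Suc (Suc i) = Y2 * (X2 * Y2 ^ Suc i) + H2 * Y2 ^ Suc i"
      by (simp only: pow[of "Suc i"] mult.assoc[symmetric] even_commutations distrib_right)
    also have "\<dots> = Y2 ^ Suc (Suc i) * X2 + of_nat (Suc (Suc i)) * (Y2 ^ Suc i * (H2 - of_nat (Suc i)))"
      unfolding Suc.IH H2 by (simp add: algebra_simps comm comm2 comm_power mult_2)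
    finally show ?case .
  qed (simp add: even_commutations)
qed

interpretation regular: sl12_rep "\<lambda>c u. uenv_scalar c * u" "\<lambda>x u. uenv_gen x * u"
proof
  fix x y :: sl12 and p q and u w :: uenv and c :: complex
  show "uenv_gen (x + y) * u = uenv_gen x * u + uenv_gen y * u"
    by (simp add: uenv_gen_add distrib_right)
  show "uenv_gen (sl12_scale c x) * u = uenv_scalar c * (uenv_gen x * u)"
    by (simp add: uenv_gen_scale mult.assoc)
  show "uenv_gen x * (u + w) = uenv_gen x * u + uenv_gen x * w"
    by (rule distrib_left)
  show "uenv_gen x * (uenv_scalar c * u) = uenv_scalar c * (uenv_gen x * u)"
    by (simp only: mult.assoc[symmetric] uenv_scalar_commute)
  assume x: "x \<in> sl12_part p" and y: "y \<in> sl12_part q"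
  have "uenv_scalar (koszul p q) = koszul p q"
    by (auto simp: koszul_def uenv_scalar_minus)
  then show "uenv_gen x * (uenv_gen y * u) =
      uenv_scalar (koszul p q) * (uenv_gen y * (uenv_gen x * u)) + uenv_gen (sl12_bracket x y) * u"
    by (simp only: mult.assoc[symmetric] uenv_gen_mult_bracket[OF x y] distrib_right)
qed

lemma regular_uenv_act: "regular.uenv_act u m = u * m"
  by (induction u arbitrary: m rule: uenv_induct)
    (simp_all only: regular.uenv_act_scalar regular.uenv_act_mult regular.uenv_act_gen
      regular.uenv_act_add distrib_right mult.assoc)

section \<open>The spanning set of a generalized Kac module\<close>

text \<open>The nonzero dominant weights, with \<open>\<lambda>(h\<^sub>2) = n + 1\<close>. Calculations take place in the enveloping superalgebra modulo the
defining left ideal \<open>J\<close>. An element \<open>u\<close> stands for the vector \<open>u v\<close>.\<close>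

locale kac =
  fixes l :: "sl12 \<Rightarrow> complex" and n :: nat
  assumes l_dual: "l \<in> cartan_dual" and l_h2: "l h2 = of_nat (Suc n)"
begin

abbreviation J :: "uenv set" where
  "J \<equiv> left_ideal (kac_relations l)"

sublocale uenv_left_ideal J
  by (rule uenv_left_ideal_left_ideal)

abbreviation scal :: "complex \<Rightarrow> uenv" where "scal \<equiv> uenv_scalar"

text \<open>The multiple of \<open>y\<^sub>2\<close> is chosen such that \<open>x\<^sub>2 z\<close> lies in \<open>J\<close>: modulo \<open>J\<close>, \<open>x\<^sub>2 y\<^sub>3 x\<^sub>1 = \<lambda>(h\<^sub>1)\<close> and
\<open>x\<^sub>2 y\<^sub>2 = \<lambda>(h\<^sub>2)\<close>.\<close>

definition Z :: uenv where
  "Z = Y3 * X1 - scal (l h1 / of_nat (Suc n)) * Y2"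

lemma generators_mem:
  "X2 \<in> J" "X3 \<in> J" "Y1 \<in> J" "H1 - scal (l h1) \<in> J" "H2 - scal (l h2) \<in> J" "Y2 ^ Suc (Suc n) \<in> J"
proof -
  have "kac_relations l \<subseteq> J" by (auto intro: left_ideal.gen)
  moreover have "{X2, X3, Y1, H1 - scal (l h1), H2 - scal (l h2)} \<subseteq> kac_relations l"
    by (auto simp: kac_relations_def nplus_def cartan_def intro: sl12.span_base)
  moreover have "Y2 ^ Suc (Suc n) \<in> kac_relations l"
    using l_h2 by (auto simp: kac_relations_def intro!: exI[of _ "Suc n"])
  ultimately show "X2 \<in> J" "X3 \<in> J" "Y1 \<in> J" "H1 - scal (l h1) \<in> J" "H2 - scal (l h2) \<in> J"
    "Y2 ^ Suc (Suc n) \<in> J" by auto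
qed

definition highest_comb :: "complex \<Rightarrow> complex \<Rightarrow> complex \<Rightarrow> complex \<Rightarrow> uenv" where
  "highest_comb a b c d = scal a + scal b * X1 + scal c * Y3 + scal d * Z"

lemma scal_commute: "u * (scal c * w) = scal c * (u * w)"
  by (metis mult.assoc uenv_scalar_commute)

lemma subspace_J: "uenv.subspace J"
  by (rule uenv.subspaceI) (simp_all add: zero_mem add_mem mult_mem)

definition spanning_below :: "nat \<Rightarrow> uenv set" where
  "spanning_below k = {Y2 ^ i * g | i g. i < k \<and> g \<in> {1, X1, Y3, Z}}"

definition kac_span :: "uenv set" where
  "kac_span = uenv.span ((\<Union>k. spanning_below k) \<union> J)"

lemma spanning_below_in_span: "g \<in> {1, X1, Y3, Z} \<Longrightarrow> Y2 ^ i * g \<in> kac_span"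
  unfolding kac_span_def by (rule uenv.span_base) (auto simp: spanning_below_def)

lemma ideal_in_kac_span: "u \<in> J \<Longrightarrow> u \<in> kac_span"
  unfolding kac_span_def by (rule uenv.span_base) auto

lemma kac_span_closed:
  "u \<in> kac_span \<Longrightarrow> w \<in> kac_span \<Longrightarrow> u + w \<in> kac_span" "u \<in> kac_span \<Longrightarrow> w \<in> kac_span \<Longrightarrow> u - w \<in> kac_span"
  "u \<in> kac_span \<Longrightarrow> scal c * u \<in> kac_span" "u \<in> kac_span \<Longrightarrow> - u \<in> kac_span" "0 \<in> kac_span"
  unfolding kac_span_def by (rule uenv.span_add uenv.span_diff uenv.span_scale uenv.span_neg uenv.span_zero; assumption?)+

lemma kac_span_of_nat: "u \<in> kac_span \<Longrightarrow> of_nat i * u \<in> kac_span"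
  using kac_span_closed(3)[of u "of_nat i"] by (simp add: uenv_scalar_of_nat)

lemma kac_span_mult_closed:
  assumes "\<And>i g. g \<in> {1, X1, Y3, Z} \<Longrightarrow> r * (Y2 ^ i * g) \<in> kac_span" and "u \<in> kac_span"
  shows "r * u \<in> kac_span"
proof -
  have "uenv.subspace {u. r * u \<in> kac_span}"
    by (rule uenv.subspaceI) (simp_all add: kac_span_closed distrib_left scal_commute)
  moreover have "(\<Union>k. spanning_below k) \<union> J \<subseteq> {u. r * u \<in> kac_span}"
    using assms(1) ideal_in_kac_span[OF mult_mem] by (auto simp: spanning_below_def)
  ultimately have "kac_span \<subseteq> {u. r * u \<in> kac_span}"
    unfolding kac_span_def by (intro uenv.span_minimal)
  with assms(2) show ?thesis by auto
qed

lemma kac_span_Y2_power: "u \<in> kac_span \<Longrightarrow> Y2 ^ i * u \<in> kac_span"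
  by (erule kac_span_mult_closed[rotated]) (metis spanning_below_in_span mult.assoc power_add)

lemma kac_span_elements: "1 \<in> kac_span" "X1 \<in> kac_span" "Y3 \<in> kac_span" "Z \<in> kac_span" "Y2 \<in> kac_span" "Y3 * X1 \<in> kac_span"
proof -
  show kac_span: "1 \<in> kac_span" "X1 \<in> kac_span" "Y3 \<in> kac_span" "Z \<in> kac_span" "Y2 \<in> kac_span"
    using spanning_below_in_span[of 1 0] spanning_below_in_span[of X1 0] spanning_below_in_span[of Y3 0] spanning_below_in_span[of Z 0] spanning_below_in_span[of 1 1] by simp_all
  have "Y3 * X1 = Z + scal (l h1 / of_nat (Suc n)) * Y2" by (simp add: Z_def)
  then show "Y3 * X1 \<in> kac_span" using kac_span by (metis kac_span_closed(1,3))
qed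

lemma mem_J_right:
  "r * X2 \<in> J" "r * X3 \<in> J" "r * Y1 \<in> J" "r * H1 - scal (l h1) * r \<in> J" "r * H2 - scal (l h2) * r \<in> J"
proof -
  have "r * (H1 - scal (l h1)) \<in> J" "r * (H2 - scal (l h2)) \<in> J"
    by (intro mult_mem generators_mem)+
  then show "r * H1 - scal (l h1) * r \<in> J" "r * H2 - scal (l h2) * r \<in> J"
    by (simp_all add: right_diff_distrib uenv_scalar_commute[of r])
qed (intro mult_mem generators_mem)+

lemma kac_span_H:
  assumes "r \<in> kac_span"
  shows "r * H1 \<in> kac_span" "r * H2 \<in> kac_span"
  using kac_span_closed(1)[OF ideal_in_kac_span[OF mem_J_right(4)[of r]] kac_span_closed(3)[OF assms]]
    kac_span_closed(1)[OF ideal_in_kac_span[OF mem_J_right(5)[of r]] kac_span_closed(3)[OF assms]]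
  by (metis diff_add_cancel)+

lemma odd_actions:
  "X1 * Z = scal (1 - l h1 / of_nat (Suc n)) * (Y2 * X1)"
  "Y3 * Z = - scal (l h1 / of_nat (Suc n)) * (Y2 * Y3)"
  "X3 * Z = X1 * (H1 - H2) + X1 + (Y3 * X1) * X3 - scal (l h1 / of_nat (Suc n)) * (Y2 * X3 + X1)"
  "Y1 * Z = - (Y3 * H1) + (Y3 * X1) * Y1 - scal (l h1 / of_nat (Suc n)) * (Y2 * Y1 - Y3)"
proof -
  have "X1 * (Y3 * X1) = Y2 * X1"
    by (simp add: odd_commutations odd_squares left_diff_distrib mult.assoc flip: mult.assoc[of X1 Y3])
  then show "X1 * Z = scal (1 - l h1 / of_nat (Suc n)) * (Y2 * X1)"
    by (simp add: Z_def right_diff_distrib scal_commute even_commutations uenv_scalar_diff left_diff_distrib)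
  have "Y3 * (Y3 * X1) = 0"
    by (simp add: odd_squares flip: mult.assoc)
  then show "Y3 * Z = - scal (l h1 / of_nat (Suc n)) * (Y2 * Y3)"
    by (simp add: Z_def right_diff_distrib scal_commute even_commutations)
  have "X3 * (Y3 * X1) = (H1 - H2 - Y3 * X3) * X1"
    by (simp add: odd_commutations flip: mult.assoc)
  also have "\<dots> = X1 * (H1 - H2) + X1 + (Y3 * X1) * X3"
    by (simp add: left_diff_distrib right_diff_distrib even_commutations odd_commutations mult.assoc)
  finally show "X3 * Z = X1 * (H1 - H2) + X1 + (Y3 * X1) * X3 - scal (l h1 / of_nat (Suc n)) * (Y2 * X3 + X1)"
    by (simp add: Z_def right_diff_distrib scal_commute even_commutations)
  have "Y1 * (Y3 * X1) = - (Y3 * (Y1 * X1))"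
    by (simp add: odd_commutations(4) flip: mult.assoc)
  also have "\<dots> = - (Y3 * H1) + (Y3 * X1) * Y1"
    by (simp add: odd_commutations(5) right_diff_distrib mult.assoc)
  finally show "Y1 * Z = - (Y3 * H1) + (Y3 * X1) * Y1 - scal (l h1 / of_nat (Suc n)) * (Y2 * Y1 - Y3)"
    by (simp add: Z_def right_diff_distrib scal_commute even_commutations)
qed

lemma kac_span_odd:
  assumes g: "g \<in> {1, X1, Y3, Z}"
  shows "X1 * g \<in> kac_span" "Y3 * g \<in> kac_span" "X3 * g \<in> kac_span" "Y1 * g \<in> kac_span"
proof -
  note intros = kac_span_closed kac_span_elements kac_span_H ideal_in_kac_span[OF mem_J_right(1)] ideal_in_kac_span[OF mem_J_right(2)] ideal_in_kac_span[OF mem_J_right(3)]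
    ideal_in_kac_span[OF generators_mem(2)] ideal_in_kac_span[OF generators_mem(3)] kac_span_H(1)[OF kac_span_elements(1), simplified]
    kac_span_H(2)[OF kac_span_elements(1), simplified] kac_span_Y2_power[of _ 1, simplified]
  have minus: "- a * b = - (a * b)" for a b :: uenv by simp
  show "X1 * g \<in> kac_span"
    using g by (auto simp only: odd_actions odd_commutations odd_squares mult_1_right minus intro!: intros)
  show "Y3 * g \<in> kac_span"
    using g by (auto simp only: odd_actions odd_squares mult_1_right minus intro!: intros)
  show "X3 * g \<in> kac_span"
    using g by (auto simp only: odd_actions odd_commutations mult_1_right minus right_diff_distrib[of X1] intro!: intros)
  show "Y1 * g \<in> kac_span"
    using g by (auto simp only: odd_actions odd_commutations mult_1_right minus intro!: intros)
qed

text \<open>The span contains the unit and is stable under left multiplication by the odd root vectors, because these can be moved past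
powers of \<open>y\<^sub>2\<close> to the four generators.\<close>

lemma kac_span_UNIV: "u \<in> kac_span"
proof -
  have X1: "X1 * (Y2 ^ i * g) = Y2 ^ i * (X1 * g)" and Y3: "Y3 * (Y2 ^ i * g) = Y2 ^ i * (Y3 * g)" for i g
    by (metis Y2_power_commutations mult.assoc)+
  have X3: "X3 * (Y2 ^ Suc i * g) = Y2 ^ Suc i * (X3 * g) + of_nat (Suc i) * (Y2 ^ i * (X1 * g))" for i g
    by (simp only: mult.assoc[symmetric] Y2_power_commutations(4) distrib_right)
  have Y1: "Y1 * (Y2 ^ Suc i * g) = Y2 ^ Suc i * (Y1 * g) - of_nat (Suc i) * (Y2 ^ i * (Y3 * g))" for i g
    by (simp only: mult.assoc[symmetric] Y2_power_commutations(3) left_diff_distrib)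
  have "regular.invariant kac_span"
  proof (rule regular.invariantI)
    show "uenv.subspace kac_span" unfolding kac_span_def by (rule uenv.subspace_span)
    fix u assume u: "u \<in> kac_span"
    show "X1 * u \<in> kac_span" "Y3 * u \<in> kac_span"
      by (rule kac_span_mult_closed[OF _ u], simp only: X1 Y3 kac_span_Y2_power kac_span_odd)+
    show "X3 * u \<in> kac_span"
    proof (rule kac_span_mult_closed[OF _ u])
      fix i g assume "g \<in> {1, X1, Y3, Z}"
      then show "X3 * (Y2 ^ i * g) \<in> kac_span"
        by (cases i) (simp_all only: X3 power_0 mult_1_left kac_span_odd kac_span_Y2_power kac_span_of_nat kac_span_closed)
    qed
    show "Y1 * u \<in> kac_span"
    proof (rule kac_span_mult_closed[OF _ u])
      fix i g assume "g \<in> {1, X1, Y3, Z}"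
      then show "Y1 * (Y2 ^ i * g) \<in> kac_span"
        by (cases i) (simp_all only: Y1 power_0 mult_1_left kac_span_odd kac_span_Y2_power kac_span_of_nat kac_span_closed)
    qed
  qed
  from regular.invariant_uenv_act[OF this kac_span_elements(1), of u] show ?thesis
    by (simp add: regular_uenv_act)
qed

lemma spanning_below_mono: "i \<le> j \<Longrightarrow> spanning_below i \<subseteq> spanning_below j"
  by (force simp: spanning_below_def)

lemma spanned_below: "\<exists>k. u \<in> uenv.span (spanning_below k \<union> J)"
proof -
  let ?U = "\<Union>k. uenv.span (spanning_below k \<union> J)"
  have mono: "uenv.span (spanning_below i \<union> J) \<subseteq> uenv.span (spanning_below j \<union> J)" if "i \<le> j" for i j
    using spanning_below_mono[OF that] by (intro uenv.span_mono) auto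
  have "uenv.subspace ?U"
  proof (rule uenv.subspaceI)
    show "0 \<in> ?U" by (auto intro: uenv.span_zero)
    fix u w assume "u \<in> ?U" "w \<in> ?U"
    then obtain i j where "u \<in> uenv.span (spanning_below i \<union> J)" "w \<in> uenv.span (spanning_below j \<union> J)" by blast
    then have "u + w \<in> uenv.span (spanning_below (max i j) \<union> J)"
      using mono[of i "max i j"] mono[of j "max i j"] by (intro uenv.span_add) auto
    then show "u + w \<in> ?U" by blast
  next
    fix c u assume "u \<in> ?U"
    then show "scal c * u \<in> ?U" by (auto intro: uenv.span_scale)
  qed
  moreover have "(\<Union>k. spanning_below k) \<union> J \<subseteq> ?U"
    by (auto intro: uenv.span_base)
  ultimately have "kac_span \<subseteq> ?U" unfolding kac_span_def by (intro uenv.span_minimal)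
  then show ?thesis using kac_span_UNIV[of u] by auto
qed

lemma spanned_below_Suc:
  assumes "u \<in> uenv.span (spanning_below (Suc k) \<union> J)"
  obtains a b c d w where "u = Y2 ^ k * highest_comb a b c d + w" "w \<in> uenv.span (spanning_below k \<union> J)"
proof -
  let ?U = "{u. \<exists>a b c d w. u = Y2 ^ k * highest_comb a b c d + w \<and> w \<in> uenv.span (spanning_below k \<union> J)}"
  have vec0: "highest_comb 0 0 0 0 = 0" by (simp add: highest_comb_def)
  have vec_add: "highest_comb a b c d + highest_comb a' b' c' d' = highest_comb (a + a') (b + b') (c + c') (d + d')" for a b c d a' b' c' d'
    by (simp add: highest_comb_def uenv_scalar_add algebra_simps)
  have vec_scale: "scal e * highest_comb a b c d = highest_comb (e * a) (e * b) (e * c) (e * d)" for a b c d e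
    by (simp only: highest_comb_def distrib_left mult.assoc[symmetric] uenv_scalar_mult)
  have "uenv.subspace ?U"
  proof (rule uenv.subspaceI)
    show "0 \<in> ?U"
      using uenv.span_zero vec0 by (metis (mono_tags, lifting) add_0_right mem_Collect_eq mult_zero_right)
    fix u w assume "u \<in> ?U" "w \<in> ?U"
    then obtain a b c d x a' b' c' d' y where
      "u = Y2 ^ k * highest_comb a b c d + x" "x \<in> uenv.span (spanning_below k \<union> J)"
      "w = Y2 ^ k * highest_comb a' b' c' d' + y" "y \<in> uenv.span (spanning_below k \<union> J)" by blast
    then have "u + w = Y2 ^ k * highest_comb (a + a') (b + b') (c + c') (d + d') + (x + y)"
      "x + y \<in> uenv.span (spanning_below k \<union> J)"
      by (simp_all add: uenv.span_add distrib_left flip: vec_add)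
    then show "u + w \<in> ?U" by blast
  next
    fix e u assume "u \<in> ?U"
    then obtain a b c d x where
      "u = Y2 ^ k * highest_comb a b c d + x" "x \<in> uenv.span (spanning_below k \<union> J)" by blast
    then have "scal e * u = Y2 ^ k * highest_comb (e * a) (e * b) (e * c) (e * d) + scal e * x"
      "scal e * x \<in> uenv.span (spanning_below k \<union> J)"
      by (simp_all add: uenv.span_scale distrib_left scal_commute flip: vec_scale)
    then show "scal e * u \<in> ?U" by blast
  qed
  moreover have "spanning_below (Suc k) \<union> J \<subseteq> ?U"
  proof
    fix u assume u: "u \<in> spanning_below (Suc k) \<union> J"
    show "u \<in> ?U"
    proof (cases "u \<in> spanning_below k \<union> J")
      case True
      then have "u = Y2 ^ k * highest_comb 0 0 0 0 + u" "u \<in> uenv.span (spanning_below k \<union> J)"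
        by (simp_all add: vec0 uenv.span_base)
      then show ?thesis by blast
    next
      case False
      then obtain g where g: "u = Y2 ^ k * g" "g \<in> {1, X1, Y3, Z}"
        using u by (auto simp: spanning_below_def less_Suc_eq)
      have "g \<in> {highest_comb 1 0 0 0, highest_comb 0 1 0 0, highest_comb 0 0 1 0, highest_comb 0 0 0 1}"
        using g(2) by (auto simp: highest_comb_def)
      then obtain a b c d where "u = Y2 ^ k * highest_comb a b c d + 0" using g(1) by auto
      then show ?thesis using uenv.span_zero by blast
    qed
  qed
  ultimately have "u \<in> ?U" using uenv.span_minimal assms by blast
  then show thesis using that by blast
qed

end

section \<open>Irreducibility in the typical case\<close>

text \<open>Eigenvectors for different eigenvalues are separated by applying \<open>h - \<beta>\<close>.\<close>

lemma (in uenv_left_ideal) weight_split: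
  assumes p: "h * p - uenv_scalar \<alpha> * p \<in> J" and q: "h * q - uenv_scalar \<beta> * q \<in> J"
    and "\<alpha> \<noteq> \<beta>" and pq: "p + q \<in> J"
  shows "p \<in> J" "q \<in> J"
proof -
  have "uenv_scalar (\<alpha> - \<beta>) * p = (h * (p + q) - uenv_scalar \<beta> * (p + q)) -
      (h * p - uenv_scalar \<alpha> * p) - (h * q - uenv_scalar \<beta> * q)"
    by (simp add: uenv_scalar_diff algebra_simps)
  also have "\<dots> \<in> J" by (intro diff_mem mult_mem p q pq)
  finally show "p \<in> J" using scalar_mult_mem_iff[of "\<alpha> - \<beta>" p] \<open>\<alpha> \<noteq> \<beta>\<close> by simp
  with pq show "q \<in> J" using diff_mem[of "p + q" p] by simp
qed

context kac
begin

definition weight :: "uenv \<Rightarrow> complex \<Rightarrow> uenv \<Rightarrow> bool" where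
  "weight h \<mu> u \<longleftrightarrow> h * u - scal \<mu> * u \<in> J"

lemma weight_scal:
  assumes "weight h \<mu> u"
  shows "weight h \<mu> (scal c * u)"
proof -
  have "scal c * (h * u - scal \<mu> * u) = h * (scal c * u) - scal \<mu> * (scal c * u)"
    by (simp only: right_diff_distrib scal_commute[of h] uenv.scale_left_commute[of c])
  then show ?thesis using assms unfolding weight_def by (metis mult_mem)
qed

lemma weight_add: "weight h \<mu> u \<Longrightarrow> weight h \<mu> w \<Longrightarrow> weight h \<mu> (u + w)"
  using add_mem[of "h * u - scal \<mu> * u" "h * w - scal \<mu> * w"]
  by (simp add: weight_def algebra_simps)

lemma H_Z: "H1 * Z = Z * H1 - Z" "H2 * Z = Z * H2 - 2 * Z"
proof -
  have "H1 * (Y3 * X1) = (Y3 * X1) * H1 - Y3 * X1"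
    by (simp only: mult.assoc[symmetric] even_commutations left_diff_distrib)
      (simp only: mult.assoc even_commutations)
  then show "H1 * Z = Z * H1 - Z"
    by (simp add: Z_def right_diff_distrib left_diff_distrib scal_commute even_commutations mult.assoc)
  have "H2 * (Y3 * X1) = (Y3 * X1) * H2 - Y3 * X1 - Y3 * X1"
    by (simp only: mult.assoc[symmetric] even_commutations left_diff_distrib)
      (simp only: mult.assoc even_commutations right_diff_distrib)
  then show "H2 * Z = Z * H2 - 2 * Z"
    by (simp add: Z_def right_diff_distrib left_diff_distrib scal_commute even_commutations mult.assoc mult_2)
qed

lemma weights:
  "weight H1 (l h1) 1" "weight H1 (l h1) X1" "weight H1 (l h1 - 1) Y3" "weight H1 (l h1 - 1) Z"
  "weight H2 (of_nat (Suc n)) 1" "weight H2 (of_nat n) X1" "weight H2 (of_nat n) Y3"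
  "weight H2 (of_nat n - 1) Z"
  using mem_J_right(4,5)[of 1] mem_J_right(4,5)[of X1] mem_J_right(4,5)[of Y3] mem_J_right(4,5)[of Z]
  by (simp_all add: weight_def even_commutations H_Z l_h2 uenv_scalar_diff uenv_scalar_add algebra_simps mult_2)

lemma highest_comb_components:
  assumes I: "uenv_left_ideal I" "J \<subseteq> I" and highest_comb: "highest_comb a b c d \<in> I"
  shows "scal a \<in> I" "scal b * X1 \<in> I" "scal c * Y3 \<in> I" "scal d * Z \<in> I"
proof -
  interpret I: uenv_left_ideal I by (rule I)
  have wt: "h * u - scal \<mu> * u \<in> I" if "weight h \<mu> u" for h \<mu> u
    using that I(2) by (auto simp: weight_def)
  have p: "weight H1 (l h1) (scal a * 1 + scal b * X1)" and q: "weight H1 (l h1 - 1) (scal c * Y3 + scal d * Z)"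
    by (intro weight_add weight_scal weights)+
  have pq: "(scal a * 1 + scal b * X1) + (scal c * Y3 + scal d * Z) \<in> I"
    using highest_comb by (simp add: highest_comb_def add_ac)
  have "scal a * 1 + scal b * X1 \<in> I" "scal c * Y3 + scal d * Z \<in> I"
    using I.weight_split[OF wt[OF p] wt[OF q] _ pq] by simp_all
  moreover have "weight H2 (of_nat (Suc n)) (scal a * 1)" "weight H2 (of_nat n) (scal b * X1)"
    "weight H2 (of_nat n) (scal c * Y3)" "weight H2 (of_nat n - 1) (scal d * Z)"
    by (intro weight_scal weights)+
  ultimately show "scal a \<in> I" "scal b * X1 \<in> I" "scal c * Y3 \<in> I" "scal d * Z \<in> I"
    using I.weight_split[OF wt wt, of H2 "of_nat (Suc n)" "scal a * 1" "of_nat n" "scal b * X1"]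
      I.weight_split[OF wt wt, of H2 "of_nat n" "scal c * Y3" "of_nat n - 1" "scal d * Z"]
    by simp_all
qed

text \<open>Modulo \<open>J\<close>, these are the highest weight vectors for \<open>sl(2)\<close> that generate a finite-dimensional representation whenever
the weight is a natural number.\<close>

definition highest :: "complex \<Rightarrow> uenv \<Rightarrow> bool" where
  "highest \<mu> u \<longleftrightarrow> X2 * u \<in> J \<and> weight H2 \<mu> u \<and> (\<forall>i. \<mu> = of_nat i \<longrightarrow> Y2 ^ Suc i * u \<in> J)"

lemma highest_raise:
  assumes "highest \<mu> u"
  shows "X2 * (Y2 ^ Suc i * u) - scal (of_nat (Suc i) * (\<mu> - of_nat i)) * (Y2 ^ i * u) \<in> J"
proof -
  have "scal (of_nat (Suc i) * (\<mu> - of_nat i)) * (Y2 ^ i * u) =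
      scal (of_nat (Suc i)) * (Y2 ^ i * (scal (\<mu> - of_nat i) * u))"
    by (simp only: uenv_scalar_mult mult.assoc scal_commute[of "Y2 ^ i"])
  moreover have "X2 * (Y2 ^ Suc i * u) =
      Y2 ^ Suc i * (X2 * u) + of_nat (Suc i) * (Y2 ^ i * (H2 * u - of_nat i * u))"
    by (simp only: mult.assoc[symmetric] Y2_power_commutations(6))
      (simp only: mult.assoc distrib_right left_diff_distrib)
  ultimately have "X2 * (Y2 ^ Suc i * u) - scal (of_nat (Suc i) * (\<mu> - of_nat i)) * (Y2 ^ i * u) =
      Y2 ^ Suc i * (X2 * u) + of_nat (Suc i) * (Y2 ^ i * (H2 * u - scal \<mu> * u))"
    by (simp only: uenv_scalar_of_nat uenv_scalar_diff left_diff_distrib right_diff_distrib) simp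
  also have "\<dots> \<in> J"
    using assms by (intro add_mem[OF mult_mem mult_mem[OF mult_mem]]) (auto simp: highest_def weight_def)
  finally show ?thesis .
qed

text \<open>The scalar by which \<open>x\<^sub>2\<^sup>k y\<^sub>2\<^sup>k\<close> acts on a highest weight vector of weight \<open>\<mu>\<close>.\<close>

definition raise_coeff :: "complex \<Rightarrow> nat \<Rightarrow> complex" where
  "raise_coeff \<mu> k = (\<Prod>i<k. of_nat (Suc i) * (\<mu> - of_nat i))"

lemma raise_coeff_Suc: "raise_coeff \<mu> (Suc k) = of_nat (Suc k) * (\<mu> - of_nat k) * raise_coeff \<mu> k"
  by (simp add: raise_coeff_def mult.commute del: of_nat_Suc)

lemma highest_raise_power:
  assumes "highest \<mu> u"
  shows "X2 ^ k * (Y2 ^ k * u) - scal (raise_coeff \<mu> k) * u \<in> J"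
proof (induction k)
  case 0
  then show ?case by (simp add: raise_coeff_def zero_mem)
next
  case (Suc k)
  let ?c = "of_nat (Suc k) * (\<mu> - of_nat k)"
  have "X2 ^ k * (X2 * (Y2 ^ Suc k * u) - scal ?c * (Y2 ^ k * u)) +
      scal ?c * (X2 ^ k * (Y2 ^ k * u) - scal (raise_coeff \<mu> k) * u) \<in> J"
    by (intro add_mem mult_mem highest_raise assms Suc)
  also have "X2 ^ k * (X2 * (Y2 ^ Suc k * u) - scal ?c * (Y2 ^ k * u)) +
      scal ?c * (X2 ^ k * (Y2 ^ k * u) - scal (raise_coeff \<mu> k) * u) =
      X2 ^ Suc k * (Y2 ^ Suc k * u) - scal (raise_coeff \<mu> (Suc k)) * u"
    by (simp only: right_diff_distrib scal_commute[of "X2 ^ k"] power_Suc2[of X2] mult.assoc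
        uenv.scale_scale raise_coeff_Suc) simp
  finally show ?case .
qed

lemma highest_raise_kill:
  assumes "highest \<mu> u"
  shows "i < k \<Longrightarrow> X2 ^ k * (Y2 ^ i * u) \<in> J"
proof (induction k arbitrary: i)
  case (Suc k)
  have Suc_k: "X2 ^ Suc k * w = X2 ^ k * (X2 * w)" for w
    by (simp only: power_Suc2 mult.assoc)
  show ?case
  proof (cases i)
    case 0
    then show ?thesis using assms by (simp only: Suc_k) (auto simp: highest_def intro: mult_mem)
  next
    case (Suc j)
    let ?c = "of_nat (Suc j) * (\<mu> - of_nat j)"
    have "X2 ^ k * (X2 * (Y2 ^ Suc j * u) - scal ?c * (Y2 ^ j * u)) \<in> J"
      by (intro mult_mem highest_raise assms)
    moreover have "scal ?c * (X2 ^ k * (Y2 ^ j * u)) \<in> J"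
      using Suc.IH[of j] Suc.prems Suc by (simp add: mult_mem del: power_Suc of_nat_Suc)
    ultimately have "X2 ^ k * (X2 * (Y2 ^ Suc j * u) - scal ?c * (Y2 ^ j * u)) +
        scal ?c * (X2 ^ k * (Y2 ^ j * u)) \<in> J"
      by (rule add_mem)
    then show ?thesis
      unfolding Suc Suc_k right_diff_distrib scal_commute[of "X2 ^ k"] by (simp only: diff_add_cancel)
  qed
qed simp

text \<open>A vanishing factor of the coefficient means that \<open>\<mu>\<close> is a natural number below \<open>k\<close>.\<close>

lemma highest_lower_kill:
  assumes "highest \<mu> u" "raise_coeff \<mu> k = 0"
  shows "Y2 ^ k * u \<in> J"
proof -
  obtain i where i: "i < k" "\<mu> = of_nat i"
    using assms(2) by (auto simp: raise_coeff_def simp del: of_nat_Suc)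
  then have "Y2 ^ (k - Suc i) * (Y2 ^ Suc i * u) \<in> J"
    using assms(1) by (auto simp: highest_def intro: mult_mem)
  then show ?thesis using i by (simp only: mult.assoc[symmetric] power_add[symmetric]) simp
qed

lemma of_nat_mult_mem_iff: "of_nat (Suc i) * u \<in> J \<longleftrightarrow> u \<in> J"
  using scalar_mult_mem_iff[of "of_nat (Suc i)" u] unfolding uenv_scalar_of_nat by (simp del: of_nat_Suc)

text \<open>The first two memberships come from applying \<open>x\<^sub>3\<close> and \<open>y\<^sub>1\<close> to the relation \<open>y\<^sub>2\<^sup>n\<^sup>+\<^sup>2\<close>, the third from applying \<open>y\<^sub>1\<close> to the
first.\<close>

lemma lowest_mem: "Y2 ^ Suc n * X1 \<in> J" "Y2 ^ Suc n * Y3 \<in> J" "Y2 ^ n * Z \<in> J"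
proof -
  have "of_nat (Suc (Suc n)) * (Y2 ^ Suc n * X1) = X3 * Y2 ^ Suc (Suc n) - Y2 ^ Suc (Suc n) * X3"
    unfolding Y2_power_commutations(4) by simp
  also have "\<dots> \<in> J" by (intro diff_mem mult_mem generators_mem)
  finally show X1: "Y2 ^ Suc n * X1 \<in> J" by (simp only: of_nat_mult_mem_iff)
  have "of_nat (Suc (Suc n)) * (Y2 ^ Suc n * Y3) = Y2 ^ Suc (Suc n) * Y1 - Y1 * Y2 ^ Suc (Suc n)"
    unfolding Y2_power_commutations(3) by simp
  also have "\<dots> \<in> J" by (intro diff_mem mult_mem generators_mem)
  finally show "Y2 ^ Suc n * Y3 \<in> J" by (simp only: of_nat_mult_mem_iff)
  have "of_nat (Suc n) * scal (l h1 / of_nat (Suc n)) = scal (l h1)"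
    by (simp only: uenv_scalar_of_nat[symmetric] uenv_scalar_mult[symmetric]) (simp del: of_nat_Suc)
  moreover have "Y2 ^ n * Z = Y2 ^ n * (Y3 * X1) - scal (l h1 / of_nat (Suc n)) * Y2 ^ Suc n"
    by (simp only: Z_def right_diff_distrib scal_commute[of "Y2 ^ n"] power_Suc2)
  ultimately have "of_nat (Suc n) * (Y2 ^ n * Z) = of_nat (Suc n) * (Y2 ^ n * (Y3 * X1)) - scal (l h1) * Y2 ^ Suc n"
    by (simp only: right_diff_distrib mult.assoc[symmetric])
  moreover have "Y1 * (Y2 ^ Suc n * X1) = Y2 ^ Suc n * H1 - Y2 ^ Suc n * (X1 * Y1) - of_nat (Suc n) * (Y2 ^ n * (Y3 * X1))"
    unfolding mult.assoc[symmetric, of Y1] Y2_power_commutations(3)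
    by (simp only: left_diff_distrib mult.assoc odd_commutations right_diff_distrib)
  ultimately have "of_nat (Suc n) * (Y2 ^ n * Z) =
      (Y2 ^ Suc n * H1 - scal (l h1) * Y2 ^ Suc n) - Y2 ^ Suc n * (X1 * Y1) - Y1 * (Y2 ^ Suc n * X1)"
    by simp
  also have "\<dots> \<in> J" by (intro diff_mem mem_J_right mult_mem generators_mem X1)
  finally show "Y2 ^ n * Z \<in> J" by (simp only: of_nat_mult_mem_iff)
qed

lemma highest_vectors:
  "highest (of_nat (Suc n)) 1" "highest (of_nat n) X1" "highest (of_nat n) Y3" "highest (of_nat n - 1) Z"
proof -
  show "highest (of_nat (Suc n)) 1"
    using generators_mem weights by (auto simp: highest_def simp del: of_nat_Suc power_Suc)
  have "X2 * X1 \<in> J" "X2 * Y3 \<in> J"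
    by (simp_all add: even_commutations add_mem diff_mem mem_J_right generators_mem)
  then show "highest (of_nat n) X1" "highest (of_nat n) Y3"
    using lowest_mem weights by (auto simp: highest_def simp del: power_Suc)
  have "X2 * Z = (Y3 * X1) * X2 - Y3 * X3 + H1 - X1 * Y1 - scal (l h1 / of_nat (Suc n)) * (Y2 * X2 + H2)"
  proof -
    have "X2 * (Y3 * X1) = Y3 * (X2 * X1) + Y1 * X1"
      by (simp only: mult.assoc[symmetric] even_commutations(6) distrib_right)
    then show ?thesis
      by (simp add: Z_def right_diff_distrib scal_commute even_commutations odd_commutations mult.assoc)
  qed
  also have "\<dots> = (Y3 * X1) * X2 - Y3 * X3 + (H1 - scal (l h1)) - X1 * Y1 -
      scal (l h1 / of_nat (Suc n)) * (Y2 * X2 + (H2 - scal (l h2)))"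
  proof -
    have "scal (l h1 / of_nat (Suc n)) * scal (l h2) = scal (l h1)"
      by (simp only: uenv_scalar_mult[symmetric] l_h2) (simp del: of_nat_Suc)
    then show ?thesis by (simp add: right_diff_distrib distrib_left)
  qed
  also have "\<dots> \<in> J"
    by (intro add_mem diff_mem mem_J_right mult_mem generators_mem)
  finally have "X2 * Z \<in> J" .
  moreover have "Y2 ^ Suc i * Z \<in> J" if "of_nat n - 1 = (of_nat i :: complex)" for i
  proof -
    have "of_nat n = (of_nat (Suc i) :: complex)" using that by (simp add: algebra_simps)
    then have "n = Suc i" by (simp only: of_nat_eq_iff)
    then show ?thesis using lowest_mem(3) by simp
  qed
  ultimately show "highest (of_nat n - 1) Z"
    using weights by (simp add: highest_def)
qed

lemma raise_highest_comb:
  "X2 ^ k * (Y2 ^ k * highest_comb a b c d) - highest_comb (a * raise_coeff (of_nat (Suc n)) k) (b * raise_coeff (of_nat n) k)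
     (c * raise_coeff (of_nat n) k) (d * raise_coeff (of_nat n - 1) k) \<in> J"
proof -
  let ?r = "\<lambda>\<mu> u. X2 ^ k * (Y2 ^ k * u) - scal (raise_coeff \<mu> k) * u"
  have "scal a * ?r (of_nat (Suc n)) 1 + scal b * ?r (of_nat n) X1 + scal c * ?r (of_nat n) Y3 +
      scal d * ?r (of_nat n - 1) Z \<in> J"
    by (intro add_mem mult_mem highest_raise_power highest_vectors)
  also have "scal a * ?r (of_nat (Suc n)) 1 + scal b * ?r (of_nat n) X1 + scal c * ?r (of_nat n) Y3 +
      scal d * ?r (of_nat n - 1) Z = X2 ^ k * (Y2 ^ k * highest_comb a b c d) -
      highest_comb (a * raise_coeff (of_nat (Suc n)) k) (b * raise_coeff (of_nat n) k)
        (c * raise_coeff (of_nat n) k) (d * raise_coeff (of_nat n - 1) k)"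
  proof -
    have highest_comb: "highest_comb a b c d = scal a * 1 + scal b * X1 + scal c * Y3 + scal d * Z" for a b c d
      by (simp add: highest_comb_def)
    have regroup: "(p - p') + (q - q') + (r - r') + (s - s') = (p + q + r + s) - (p' + q' + r' + s')"
      for p q r s p' q' r' s' :: uenv
      by simp
    show ?thesis
      by (simp only: highest_comb right_diff_distrib distrib_left scal_commute[of "X2 ^ k"] scal_commute[of "Y2 ^ k"]
          uenv.scale_scale regroup)
  qed
  finally show ?thesis .
qed

text \<open>Let \<open>k\<close> be the top power of \<open>y\<^sub>2\<close> in \<open>u\<close>. Then \<open>x\<^sub>2\<^sup>k\<close> kills the lower terms and maps the top term to a combination of the four
highest weight vectors. If this combination lies in \<open>J\<close>, so does each of its components, and then the top term itself lies in \<open>J\<close>: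
a component whose coefficient \<open>x\<^sub>2\<^sup>k y\<^sub>2\<^sup>k\<close> is nonzero lies in \<open>J\<close> before lowering, and the others are killed by
\<open>y\<^sub>2\<^sup>k\<close>. The top term can therefore be removed.\<close>

lemma descent:
  assumes I: "uenv_left_ideal I" "J \<subseteq> I"
  shows "u \<in> uenv.span (spanning_below k \<union> J) \<Longrightarrow> u \<in> I \<Longrightarrow> u \<notin> J \<Longrightarrow>
    \<exists>a b c d. highest_comb a b c d \<in> I \<and> highest_comb a b c d \<notin> J"
proof (induction k arbitrary: u)
  case 0
  have "uenv.span J = J" by (simp add: uenv.span_eq_iff subspace_J)
  with 0 show ?case by (simp add: spanning_below_def)
next
  case (Suc k)
  interpret I: uenv_left_ideal I by (rule I)
  from Suc.prems(1) obtain a b c d w where u: "u = Y2 ^ k * highest_comb a b c d + w"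
    and w: "w \<in> uenv.span (spanning_below k \<union> J)"
    by (rule spanned_below_Suc)
  let ?e = "highest_comb (a * raise_coeff (of_nat (Suc n)) k) (b * raise_coeff (of_nat n) k)
     (c * raise_coeff (of_nat n) k) (d * raise_coeff (of_nat n - 1) k)"
  have "uenv.subspace {w. X2 ^ k * w \<in> J}"
    by (rule uenv.subspaceI) (simp_all add: zero_mem add_mem mult_mem distrib_left scal_commute)
  moreover have "spanning_below k \<union> J \<subseteq> {w. X2 ^ k * w \<in> J}"
    using highest_vectors[THEN highest_raise_kill] mult_mem by (auto simp: spanning_below_def)
  ultimately have "X2 ^ k * w \<in> J" using w uenv.span_minimal by blast
  then have "X2 ^ k * u - ?e \<in> J"
    using add_mem[OF raise_highest_comb[of k a b c d]] by (simp add: u distrib_left algebra_simps)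
  moreover have "X2 ^ k * u \<in> I" by (intro I.mult_mem Suc.prems)
  ultimately have e: "?e \<in> I" using I.mem_cong I(2) by blast
  show ?case
  proof (cases "?e \<in> J")
    case True
    have kill: "scal x * (Y2 ^ k * g) \<in> J" if "highest \<mu> g" "scal (x * raise_coeff \<mu> k) * g \<in> J" for x \<mu> g
    proof (cases "x = 0 \<or> raise_coeff \<mu> k = 0")
      case True
      then show ?thesis using highest_lower_kill[OF that(1)] by (auto simp: zero_mem intro: mult_mem)
    next
      case False
      then have "g \<in> J" using scalar_mult_mem_iff that(2) by simp
      then show ?thesis by (intro mult_mem)
    qed
    note comp = highest_comb_components[OF uenv_left_ideal_axioms subset_refl True]
    have "scal a * (Y2 ^ k * 1) + scal b * (Y2 ^ k * X1) + scal c * (Y2 ^ k * Y3) + scal d * (Y2 ^ k * Z) \<in> J"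
      using comp by (intro add_mem kill[OF highest_vectors(1)] kill[OF highest_vectors(2)]
          kill[OF highest_vectors(3)] kill[OF highest_vectors(4)]) simp_all
    then have highest_comb: "Y2 ^ k * highest_comb a b c d \<in> J"
      by (simp add: highest_comb_def distrib_left scal_commute uenv_scalar_commute[of "Y2 ^ k"])
    have "w = u - Y2 ^ k * highest_comb a b c d" by (simp add: u)
    then have "w \<in> I" using I.diff_mem[OF Suc.prems(2)] highest_comb I(2) by auto
    moreover have "w \<notin> J" using Suc.prems(3) add_mem[OF highest_comb, of w] u by auto
    ultimately show ?thesis using Suc.IH[OF w] by blast
  next
    case False
    with e show ?thesis by blast
  qed
qed

text \<open>A combination of the four highest weight vectors has a component outside \<open>J\<close>, and
\<open>y\<^sub>1 x\<^sub>1 = \<lambda>(h\<^sub>1)\<close>, \<open>x\<^sub>3 y\<^sub>3 = \<lambda>(h\<^sub>1) - \<lambda>(h\<^sub>2)\<close> and \<open>y\<^sub>1 z = (\<lambda>(h\<^sub>1)/(n + 1) - \<lambda>(h\<^sub>1)) y\<^sub>3\<close> modulo \<open>J\<close> lead from each of them to the unit.\<close>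

lemma typical_ideal:
  assumes typical: "l h1 \<noteq> 0" "l h1 \<noteq> l h2"
    and I: "uenv_left_ideal I" "J \<subseteq> I" and u: "u \<in> I" "u \<notin> J"
  shows "1 \<in> I"
proof -
  interpret I: uenv_left_ideal I by (rule I)
  obtain k where "u \<in> uenv.span (spanning_below k \<union> J)" using spanned_below by blast
  from descent[OF I this u] obtain a b c d where highest_comb: "highest_comb a b c d \<in> I" "highest_comb a b c d \<notin> J" by blast
  note comp = highest_comb_components[OF I highest_comb(1)]
  have one: "1 \<in> I" if "scal x \<in> I" "x \<noteq> 0" for x
    using I.scalar_mult_mem_iff[of x 1] that by simp
  have X1: "1 \<in> I" if "X1 \<in> I"
  proof -
    have "Y1 * X1 + X1 * Y1 - (H1 - scal (l h1)) \<in> I"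
      using I(2) mem_J_right(3)[of X1] generators_mem(4) I.mult_mem[OF that, of Y1]
      by (blast intro: I.diff_mem I.add_mem)
    then show ?thesis using one[of "l h1"] typical by (simp add: odd_commutations)
  qed
  have Y3: "1 \<in> I" if "Y3 \<in> I"
  proof -
    have "X3 * Y3 + Y3 * X3 - (H1 - scal (l h1)) + (H2 - scal (l h2)) \<in> I"
      using I(2) mem_J_right(2)[of Y3] generators_mem(4,5) I.mult_mem[OF that, of X3]
      by (blast intro: I.diff_mem I.add_mem)
    then show ?thesis using one[of "l h1 - l h2"] typical by (simp add: odd_commutations uenv_scalar_diff)
  qed
  have Z: "1 \<in> I" if "Z \<in> I" "Z \<notin> J"
  proof -
    have "n \<noteq> 0" using that(2) lowest_mem(3) by (intro notI) simp
    have "Y1 * Z + (Y3 * H1 - scal (l h1) * Y3) - (Y3 * X1) * Y1 + scal (l h1 / of_nat (Suc n)) * (Y2 * Y1) \<in> I"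
      using I(2) mem_J_right(4)[of Y3] mem_J_right(3)[of "Y3 * X1"] mult_mem[OF mem_J_right(3)[of Y2]]
        I.mult_mem[OF that(1), of Y1]
      by (blast intro: I.diff_mem I.add_mem)
    then have "scal (l h1 / of_nat (Suc n) - l h1) * Y3 \<in> I"
      by (simp add: odd_actions uenv_scalar_diff algebra_simps)
    moreover have "l h1 / of_nat (Suc n) - l h1 \<noteq> 0"
    proof
      assume "l h1 / of_nat (Suc n) - l h1 = 0"
      then have "l h1 = l h1 * of_nat (Suc n)" by (simp add: divide_eq_eq del: of_nat_Suc)
      then show False using typical(1) \<open>n \<noteq> 0\<close> by simp
    qed
    ultimately show ?thesis using I.scalar_mult_mem_iff Y3 by blast
  qed
  have "scal a \<notin> J \<or> scal b * X1 \<notin> J \<or> scal c * Y3 \<notin> J \<or> scal d * Z \<notin> J"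
    using highest_comb(2) add_mem by (auto simp: highest_comb_def)
  then show ?thesis
  proof (elim disjE)
    assume "scal a \<notin> J"
    then have "a \<noteq> 0" by (auto simp: zero_mem)
    then show ?thesis using one comp(1) by blast
  next
    assume "scal b * X1 \<notin> J"
    then have "b \<noteq> 0" by (auto simp: zero_mem)
    then show ?thesis using X1 comp(2) I.scalar_mult_mem_iff by blast
  next
    assume "scal c * Y3 \<notin> J"
    then have "c \<noteq> 0" by (auto simp: zero_mem)
    then show ?thesis using Y3 comp(3) I.scalar_mult_mem_iff by blast
  next
    assume "scal d * Z \<notin> J"
    then have "d \<noteq> 0" "Z \<notin> J" by (auto simp: zero_mem mult_mem)
    then show ?thesis using Z comp(4) I.scalar_mult_mem_iff by blast
  qed
qed

end

section \<open>Dominant weights\<close>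

text \<open>Gaussian elimination: a homogeneous linear system with more unknowns than equations has a nontrivial solution.\<close>

lemma exists_linear_dependence:
  fixes c :: "'k \<Rightarrow> nat \<Rightarrow> complex"
  assumes "finite K" "m < card K"
  shows "\<exists>a. (\<exists>k\<in>K. a k \<noteq> 0) \<and> (\<forall>i<m. (\<Sum>k\<in>K. a k * c k i) = 0)"
  using assms
proof (induction m arbitrary: K c)
  case 0
  then have "K \<noteq> {}" by auto
  then show ?case by (intro exI[of _ "\<lambda>_. 1"]) auto
next
  case (Suc m)
  show ?case
  proof (cases "\<exists>p\<in>K. c p m \<noteq> 0")
    case False
    from Suc.IH[of K c] Suc.prems obtain a where "\<exists>k\<in>K. a k \<noteq> 0" "\<forall>i<m. (\<Sum>k\<in>K. a k * c k i) = 0"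
      by auto
    with False show ?thesis by (intro exI[of _ a]) (auto simp: less_Suc_eq)
  next
    case True
    then obtain p where p: "p \<in> K" "c p m \<noteq> 0" by blast
    \<comment> \<open>Eliminate the equation of index \<open>m\<close> with the pivot \<open>p\<close>.\<close>
    define d where "d k i = c k i - c k m / c p m * c p i" for k i
    have "m < card (K - {p})" using Suc.prems p by (simp add: less_diff_conv)
    with Suc.IH[of "K - {p}" d] Suc.prems(1) obtain a
      where a: "\<exists>k\<in>K - {p}. a k \<noteq> 0" "\<forall>i<m. (\<Sum>k\<in>K - {p}. a k * d k i) = 0"
      by auto
    define b where "b k = (if k = p then - (\<Sum>k\<in>K - {p}. a k * c k m) / c p m else a k)" for k
    have "(\<Sum>k\<in>K. b k * c k i) = (\<Sum>k\<in>K - {p}. a k * d k i)" for i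
    proof -
      have "(\<Sum>k\<in>K. b k * c k i) = b p * c p i + (\<Sum>k\<in>K - {p}. a k * c k i)"
        using p Suc.prems(1) by (simp add: sum.remove[of K p] b_def)
      also have "\<dots> = (\<Sum>k\<in>K - {p}. a k * d k i)"
        by (simp add: b_def d_def right_diff_distrib sum_subtractf sum_divide_distrib sum_distrib_right mult.assoc)
      finally show ?thesis .
    qed
    moreover have "d k m = 0" for k using p by (simp add: d_def)
    ultimately have "\<forall>i<Suc m. (\<Sum>k\<in>K. b k * c k i) = 0"
      using a(2) by (auto simp: less_Suc_eq)
    moreover have "\<exists>k\<in>K. b k \<noteq> 0" using a(1) by (auto simp: b_def)
    ultimately show ?thesis by blast
  qed
qed

context sl12_module
begin

lemma smult_eq_zero:
  assumes "v \<in> carrier V" "c \<odot>\<^bsub>V\<^esub> v = \<zero>\<^bsub>V\<^esub>"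
  shows "c = 0 \<or> v = \<zero>\<^bsub>V\<^esub>"
proof (cases "c = 0")
  case False
  have "(1 / c) \<odot>\<^bsub>V\<^esub> (c \<odot>\<^bsub>V\<^esub> v) = v"
    using assms(1) False smult_assoc1[of "1 / c" c v] smult_one[of v] by simp
  then show ?thesis using assms(2) smult_r_null[of "1 / c"] by simp
qed simp

lemma act_zero: "act V x \<zero>\<^bsub>V\<^esub> = \<zero>\<^bsub>V\<^esub>"
  using act_scale_right[of "\<zero>\<^bsub>V\<^esub>" x 0] smult_l_null act_closed[of "\<zero>\<^bsub>V\<^esub>" x] by simp

definition combination :: "('k \<Rightarrow> 'v) \<Rightarrow> ('k \<Rightarrow> complex) \<Rightarrow> 'k set \<Rightarrow> 'v" where
  "combination w a K = (\<Oplus>\<^bsub>V\<^esub>k\<in>K. a k \<odot>\<^bsub>V\<^esub> w k)"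

context
  fixes w :: "'k \<Rightarrow> 'v"
  assumes w: "\<And>k. w k \<in> carrier V"
begin

lemma smult_w: "c \<odot>\<^bsub>V\<^esub> w k \<in> carrier V"
  using w smult_closed by simp

lemma combination_closed: "combination w a K \<in> carrier V"
  unfolding combination_def by (rule finsum_closed) (use smult_w in auto)

lemma combination_insert:
  "finite K \<Longrightarrow> k \<notin> K \<Longrightarrow> combination w a (insert k K) = a k \<odot>\<^bsub>V\<^esub> w k \<oplus>\<^bsub>V\<^esub> combination w a K"
  unfolding combination_def by (rule finsum_insert) (use smult_w in auto)

lemma combination_empty: "combination w a {} = \<zero>\<^bsub>V\<^esub>"
  by (simp add: combination_def)

lemma combination_add:
  "combination w (\<lambda>k. a k + b k) K = combination w a K \<oplus>\<^bsub>V\<^esub> combination w b K"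
proof -
  have "(a k + b k) \<odot>\<^bsub>V\<^esub> w k = a k \<odot>\<^bsub>V\<^esub> w k \<oplus>\<^bsub>V\<^esub> b k \<odot>\<^bsub>V\<^esub> w k" for k
    using smult_l_distr[of "a k" "b k" "w k"] w by simp
  then show ?thesis
    unfolding combination_def by (simp add: finsum_addf smult_w)
qed

lemma combination_smult:
  "finite K \<Longrightarrow> combination w (\<lambda>k. c * a k) K = c \<odot>\<^bsub>V\<^esub> combination w a K"
proof (induction K rule: finite_induct)
  case empty
  then show ?case using smult_r_null[of c] by (simp add: combination_empty)
next
  case (insert k K)
  then show ?case
    using smult_assoc1[of c "a k" "w k"] smult_r_distr[of c "a k \<odot>\<^bsub>V\<^esub> w k" "combination w a K"]
    by (simp add: combination_insert w smult_w combination_closed)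
qed

lemma combination_act:
  assumes "finite K" "\<And>k. act V h (w k) = \<mu> k \<odot>\<^bsub>V\<^esub> w k"
  shows "act V h (combination w a K) = combination w (\<lambda>k. a k * \<mu> k) K"
  using assms(1)
proof (induction K rule: finite_induct)
  case empty
  then show ?case by (simp add: combination_empty act_zero)
next
  case (insert k K)
  then show ?case
    using smult_assoc1[of "a k" "\<mu> k" "w k"]
    by (simp add: combination_insert w smult_w combination_closed act_add_right act_scale_right assms(2))
qed

lemma combination_zero: "(\<And>k. k \<in> K \<Longrightarrow> a k = 0) \<Longrightarrow> combination w a K = \<zero>\<^bsub>V\<^esub>"
proof -
  assume "\<And>k. k \<in> K \<Longrightarrow> a k = 0"
  then have "combination w a K = (\<Oplus>\<^bsub>V\<^esub>k\<in>K. \<zero>\<^bsub>V\<^esub>)"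
    unfolding combination_def
    using smult_l_null[of "w _"] w by (intro finsum_cong') auto
  then show ?thesis by simp
qed

lemma eigenvectors_independent:
  assumes "finite K" "inj_on \<mu> K" and h: "\<And>k. act V h (w k) = \<mu> k \<odot>\<^bsub>V\<^esub> w k"
    and nonzero: "\<And>k. w k \<noteq> \<zero>\<^bsub>V\<^esub>" and "combination w a K = \<zero>\<^bsub>V\<^esub>" "k \<in> K"
  shows "a k = 0"
  using assms(1,2,5,6)
proof (induction K arbitrary: a k rule: finite_induct)
  case (insert k K a j)
  let ?K = "insert k K"
  have fin: "finite ?K" using insert by simp
  \<comment> \<open>Applying \<open>h - \<mu> k\<close> to the relation removes the term of index \<open>k\<close>.\<close>
  define b where "b i = a i * \<mu> i + (- \<mu> k) * a i" for i
  have "combination w b ?K = act V h (combination w a ?K) \<oplus>\<^bsub>V\<^esub> (- \<mu> k) \<odot>\<^bsub>V\<^esub> combination w a ?K"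
    unfolding b_def by (simp only: combination_add combination_smult[OF fin] combination_act[OF fin h])
  then have "combination w b ?K = \<zero>\<^bsub>V\<^esub>"
    using insert.prems smult_r_null[of "- \<mu> k"] by (simp add: act_zero)
  moreover have "b k \<odot>\<^bsub>V\<^esub> w k = \<zero>\<^bsub>V\<^esub>"
    using smult_l_null[of "w k"] w by (simp add: b_def)
  ultimately have "combination w b K = \<zero>\<^bsub>V\<^esub>"
    using insert by (simp add: combination_insert combination_closed)
  then have "b i = 0" if "i \<in> K" for i
    using insert.IH[of b i] insert.prems(1) that by simp
  then have K: "a i = 0" if "i \<in> K" for i
    using that insert.prems(1) insert.hyps(2) by (auto simp: b_def inj_on_def algebra_simps)
  then have "a k \<odot>\<^bsub>V\<^esub> w k = \<zero>\<^bsub>V\<^esub>"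
    using insert combination_zero[of K a] by (simp add: combination_insert smult_w)
  then have "a k = 0" using smult_eq_zero w nonzero by blast
  with K show ?case using insert.prems by blast
qed simp

end

text \<open>Expanding more eigenvectors than there are spanning vectors in the spanning set gives a linear relation
between them, while nonzero eigenvectors for different eigenvalues are independent.\<close>

lemma no_infinite_spectrum:
  fixes w :: "nat \<Rightarrow> 'v"
  assumes fin: "finite_dimensional V" and w: "\<And>k. w k \<in> carrier V" and "inj \<mu>"
    and h: "\<And>k. act V h (w k) = \<mu> k \<odot>\<^bsub>V\<^esub> w k"
  shows "\<exists>k. w k = \<zero>\<^bsub>V\<^esub>"
proof (rule ccontr)
  assume "\<nexists>k. w k = \<zero>\<^bsub>V\<^esub>"
  then have nonzero: "w k \<noteq> \<zero>\<^bsub>V\<^esub>" for k by blast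
  obtain B where B: "finite B" "B \<subseteq> carrier V"
    and span: "\<And>W. submodule W complex_ring V \<Longrightarrow> B \<subseteq> W \<Longrightarrow> W = carrier V"
    using fin by (auto simp: finite_dimensional_def)
  define m where "m = card B"
  obtain b' where b': "b' ` {..<m} = B"
    using B(1) ex_bij_betw_nat_finite[of B] by (auto simp: bij_betw_def m_def atLeast0LessThan)
  define b where "b i = (if i < m then b' i else \<zero>\<^bsub>V\<^esub>)" for i
  have b: "b i \<in> carrier V" for i using b' B(2) by (auto simp: b_def)
  define W where "W = range (\<lambda>c. combination b c {..<m})"
  have "submodule W complex_ring V"
  proof (rule submoduleI)
    show "W \<subseteq> carrier V" using combination_closed[of b] b by (auto simp: W_def)
    show zero: "\<zero>\<^bsub>V\<^esub> \<in> W"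
      using combination_zero[of b "{..<m}" "\<lambda>_. 0"] b by (auto simp: W_def intro!: range_eqI[of _ _ "\<lambda>_. 0"])
    fix x assume "x \<in> W"
    then obtain c where c: "x = combination b c {..<m}" by (auto simp: W_def)
    have "r \<odot>\<^bsub>V\<^esub> x = combination b (\<lambda>k. r * c k) {..<m}" for r
      unfolding c by (rule combination_smult[of b, symmetric]) (use b in auto)
    then show smult: "r \<odot>\<^bsub>V\<^esub> x \<in> W" for r by (auto simp: W_def)
    have "x \<in> carrier V" using combination_closed[of b] b by (simp add: c)
    then have "\<ominus>\<^bsub>V\<^esub> x = (- 1) \<odot>\<^bsub>V\<^esub> x"
      using smult_l_minus[of 1 x] smult_one[of x] smult_l_distr[of "-1" 1 x] smult_l_null[of x]
      by (intro minus_equality) (auto simp: smult_closed)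
    then show "\<ominus>\<^bsub>V\<^esub> x \<in> W" using smult by simp
    fix y assume "y \<in> W"
    then obtain d where d: "y = combination b d {..<m}" by (auto simp: W_def)
    have "x \<oplus>\<^bsub>V\<^esub> y = combination b (\<lambda>k. c k + d k) {..<m}"
      unfolding c d by (rule combination_add[of b, symmetric]) (use b in auto)
    then show "x \<oplus>\<^bsub>V\<^esub> y \<in> W" by (auto simp: W_def)
  qed
  moreover have "B \<subseteq> W"
  proof
    fix x assume "x \<in> B"
    then obtain i where i: "i < m" "x = b i" using b' by (auto simp: b_def)
    have ins: "insert i {..<m} = {..<m}" using i(1) by auto
    have "combination b (\<lambda>j. if j = i then 1 else 0) {..<m} = x"
      using combination_insert[of b "{..<m} - {i}" i "\<lambda>j. if j = i then 1 else 0"]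
        combination_zero[of b "{..<m} - {i}" "\<lambda>j. if j = i then 1 else 0"] b smult_one[of "b i"] b[of i]
      by (simp add: ins i(2))
    then show "x \<in> W" unfolding W_def by (metis rangeI)
  qed
  ultimately have "W = carrier V" by (rule span)
  then have "\<exists>c. w k = combination b c {..<m}" for k using w[of k] by (auto simp: W_def)
  then obtain c where c: "\<And>k. w k = combination b (c k) {..<m}" by metis
  obtain a where a: "\<exists>k\<in>{..m}. a k \<noteq> 0" "\<forall>i<m. (\<Sum>k\<in>{..m}. a k * c k i) = 0"
    using exists_linear_dependence[of "{..m}" m c] by auto
  have "combination w a K = combination b (\<lambda>i. \<Sum>k\<in>K. a k * c k i) {..<m}" if "finite K" for K
    using that
  proof (induction K rule: finite_induct)
    case empty
    then show ?case using combination_zero[of b "{..<m}" "\<lambda>_. 0"] b by (simp add: combination_empty[OF w])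
  next
    case (insert k K)
    have "a k \<odot>\<^bsub>V\<^esub> w k = combination b (\<lambda>i. a k * c k i) {..<m}"
      unfolding c[of k] by (rule combination_smult[of b, symmetric]) (use b in auto)
    with insert show ?case
      using combination_add[of b "\<lambda>i. a k * c k i" "\<lambda>i. \<Sum>k\<in>K. a k * c k i" "{..<m}"] b
      by (simp add: combination_insert[OF w])
  qed
  from this[of "{..m}"] have "combination w a {..m} = \<zero>\<^bsub>V\<^esub>"
    using a(2) combination_zero[of b "{..<m}" "\<lambda>i. \<Sum>k\<in>{..m}. a k * c k i"] b by simp
  moreover have "inj_on \<mu> {..m}" using \<open>inj \<mu>\<close> by (rule inj_on_subset) simp
  ultimately have "a k = 0" if "k \<in> {..m}" for k
    using eigenvectors_independent[of w "{..m}" \<mu> h a k] w h nonzero that by simp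
  with a(1) show False by blast
qed

lemma act_commute:
  assumes "x \<in> sl12_part p" "y \<in> sl12_part q" "v \<in> carrier V"
  shows "act V x (act V y v) = koszul p q \<odot>\<^bsub>V\<^esub> act V y (act V x v) \<oplus>\<^bsub>V\<^esub> act V (sl12_bracket x y) v"
proof -
  let ?a = "act V x (act V y v)" and ?b = "koszul p q \<odot>\<^bsub>V\<^esub> act V y (act V x v)"
  have c: "?a \<in> carrier V" "?b \<in> carrier V" using assms act_closed smult_closed by auto
  then have "?b \<oplus>\<^bsub>V\<^esub> (?a \<ominus>\<^bsub>V\<^esub> ?b) = ?a"
    by (simp add: a_minus_def a_lcomm[of ?b ?a] r_neg)
  then show ?thesis using act_bracket[OF assms] by simp
qed

context
  fixes l v
  assumes hw: "highest_weight_vector V l v"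
begin

definition lowered :: "nat \<Rightarrow> 'v" where
  "lowered k = (act V y2 ^^ k) v"

lemma v_closed: "v \<in> carrier V"
  using hw by (simp add: highest_weight_vector_def)

lemma lowered_closed: "lowered k \<in> carrier V"
  by (induction k) (simp_all add: lowered_def v_closed act_closed)

lemma highest_weight_acts:
  "act V x2 v = \<zero>\<^bsub>V\<^esub>" "act V x3 v = \<zero>\<^bsub>V\<^esub>" "act V y1 v = \<zero>\<^bsub>V\<^esub>"
  "act V h1 v = l h1 \<odot>\<^bsub>V\<^esub> v" "act V h2 v = l h2 \<odot>\<^bsub>V\<^esub> v"
proof -
  have "{y1, x2, x3} \<subseteq> nplus" "{h1, h2} \<subseteq> cartan"
    by (auto simp: nplus_def cartan_def intro: sl12.span_base)
  then show "act V x2 v = \<zero>\<^bsub>V\<^esub>" "act V x3 v = \<zero>\<^bsub>V\<^esub>" "act V y1 v = \<zero>\<^bsub>V\<^esub>"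
    "act V h1 v = l h1 \<odot>\<^bsub>V\<^esub> v" "act V h2 v = l h2 \<odot>\<^bsub>V\<^esub> v"
    using hw by (auto simp: highest_weight_vector_def)
qed

lemma lowered_weight: "act V h2 (lowered k) = (l h2 - 2 * of_nat k) \<odot>\<^bsub>V\<^esub> lowered k"
proof (induction k)
  case 0
  then show ?case by (simp add: lowered_def highest_weight_acts)
next
  case (Suc k)
  have m2: "- y2 - y2 = sl12_scale (- 2) y2"
    by (rule sl12_eqI) (simp add: entry_diff entry_minus entry_scale)
  have "act V h2 (act V y2 (lowered k)) = 1 \<odot>\<^bsub>V\<^esub> act V y2 (act V h2 (lowered k)) \<oplus>\<^bsub>V\<^esub>
      (- 2) \<odot>\<^bsub>V\<^esub> act V y2 (lowered k)"
    using act_commute[OF sl12_part_basis(8,6) lowered_closed[of k]] act_scale[OF lowered_closed[of k], of "- 2" y2]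
    by (simp add: sl12_bracket_even_even koszul_def m2)
  also have "\<dots> = (l h2 - 2 * of_nat (Suc k)) \<odot>\<^bsub>V\<^esub> act V y2 (lowered k)"
    using smult_l_distr[of "l h2 - 2 * of_nat k" "- 2" "act V y2 (lowered k)"]
    by (simp add: Suc act_scale_right lowered_closed act_closed smult_closed smult_one[simplified] algebra_simps)
  finally show ?case by (simp add: lowered_def)
qed

lemma lowered_raise:
  "act V x2 (lowered (Suc k)) = (of_nat (Suc k) * (l h2 - of_nat k)) \<odot>\<^bsub>V\<^esub> lowered k"
proof (induction k)
  have step: "act V x2 (lowered (Suc k)) = act V y2 (act V x2 (lowered k)) \<oplus>\<^bsub>V\<^esub> act V h2 (lowered k)" for k
    using act_commute[OF sl12_part_basis(5,6) lowered_closed[of k]] smult_one[of "act V y2 (act V x2 (lowered k))"]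
    by (simp add: sl12_bracket_even_even koszul_def lowered_def act_closed lowered_closed[unfolded lowered_def])
  {
    case 0
    show ?case
      using lowered_weight[of 0]
      by (simp add: step[of 0] act_closed lowered_closed act_zero smult_closed highest_weight_acts
          lowered_def[of 0] v_closed)
  next
    case (Suc k)
    have y2: "act V y2 (lowered k) = lowered (Suc k)" by (simp add: lowered_def)
    have "act V x2 (lowered (Suc (Suc k))) = (of_nat (Suc k) * (l h2 - of_nat k)) \<odot>\<^bsub>V\<^esub> lowered (Suc k) \<oplus>\<^bsub>V\<^esub>
        (l h2 - 2 * of_nat (Suc k)) \<odot>\<^bsub>V\<^esub> lowered (Suc k)"
      by (simp only: step[of "Suc k"] Suc.IH act_scale_right[OF lowered_closed] y2 lowered_weight)
    also have "\<dots> = (of_nat (Suc k) * (l h2 - of_nat k) + (l h2 - 2 * of_nat (Suc k))) \<odot>\<^bsub>V\<^esub> lowered (Suc k)"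
      using smult_l_distr lowered_closed by simp
    also have "of_nat (Suc k) * (l h2 - of_nat k) + (l h2 - 2 * of_nat (Suc k)) =
        of_nat (Suc (Suc k)) * (l h2 - of_nat (Suc k))"
      by (simp add: algebra_simps)
    finally show ?case .
  }
qed

text \<open>At the last nonzero lowered vector \<open>y\<^sub>2\<^sup>k v\<close>, raising \<open>y\<^sub>2\<^sup>k\<^sup>+\<^sup>1 v = 0\<close> gives \<open>\<lambda>(h\<^sub>2) = k\<close>. If \<open>k = 0\<close>, then \<open>x\<^sub>1 = [x\<^sub>3, y\<^sub>2]\<close> and
\<open>h\<^sub>1 = [x\<^sub>1, y\<^sub>1]\<close> show that \<open>h\<^sub>1\<close> kills \<open>v\<close> as well.\<close>

lemma highest_weight_dominant:
  assumes "finite_dimensional V"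
  shows "(l h1 = 0 \<and> l h2 = 0) \<or> (\<exists>n. l h2 = of_nat (Suc n))"
proof -
  have v0: "lowered 0 \<noteq> \<zero>\<^bsub>V\<^esub>" using hw by (simp add: lowered_def highest_weight_vector_def)
  have "inj (\<lambda>k. l h2 - 2 * of_nat k)" by (rule injI) simp
  from no_infinite_spectrum[OF assms lowered_closed this lowered_weight]
  obtain k where "lowered k = \<zero>\<^bsub>V\<^esub>" by blast
  then obtain k where k: "lowered k \<noteq> \<zero>\<^bsub>V\<^esub>" "lowered (Suc k) = \<zero>\<^bsub>V\<^esub>"
    using v0 by (induction k) auto
  have "(of_nat (Suc k) * (l h2 - of_nat k)) \<odot>\<^bsub>V\<^esub> lowered k = \<zero>\<^bsub>V\<^esub>"
    using lowered_raise[of k] k(2) act_zero by simp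
  then have "of_nat (Suc k) * (l h2 - of_nat k) = 0"
    using smult_eq_zero lowered_closed k(1) by blast
  then have l: "l h2 = of_nat k" by (simp del: of_nat_Suc)
  show ?thesis
  proof (cases k)
    case (Suc n)
    with l show ?thesis by auto
  next
    case 0
    then have y2: "act V y2 v = \<zero>\<^bsub>V\<^esub>" using k(2) by (simp add: lowered_def)
    have "act V x1 v = \<zero>\<^bsub>V\<^esub>"
      using act_commute[OF sl12_part_basis(2,6) v_closed] smult_r_null act_closed[OF v_closed]
      by (simp add: y2 act_zero highest_weight_acts sl12_bracket_odd_even)
    then have "l h1 \<odot>\<^bsub>V\<^esub> v = \<zero>\<^bsub>V\<^esub>"
      using act_commute[OF sl12_part_basis(1,3) v_closed] smult_r_null smult_closed v_closed
      by (simp add: act_zero highest_weight_acts sl12_bracket_odd_odd)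
    then have "l h1 = 0" using smult_eq_zero v_closed v0 by (auto simp: lowered_def)
    then show ?thesis using 0 l by simp
  qed
qed

end

end

lemma Pplus_cases:
  assumes "l \<in> Pplus"
  shows "l \<in> cartan_dual" "l = (\<lambda>_. 0) \<or> (\<exists>n. l h2 = of_nat (Suc n))"
proof -
  from assms obtain V :: "uenv set sl12_module" and v where l: "l \<in> cartan_dual"
    and V: "irreducible_sl12_module V" "highest_weight_vector V l v" "finite_dimensional V"
    by (auto simp: Pplus_def)
  show "l \<in> cartan_dual" by (rule l)
  interpret sl12_module V using V(1) by (simp add: irreducible_sl12_module_def)
  from highest_weight_dominant[OF V(2,3)] show "l = (\<lambda>_. 0) \<or> (\<exists>n. l h2 = of_nat (Suc n))"
  proof
    assume "l h1 = 0 \<and> l h2 = 0"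
    moreover have "sl12.subspace {h \<in> cartan. l h = 0}"
    proof (rule sl12.subspaceI)
      have "0 \<in> cartan" by (simp add: cartan_def sl12.span_zero)
      moreover from this have "l (sl12_scale 0 0) = 0 * l 0" using l unfolding cartan_dual_def by blast
      ultimately show "0 \<in> {h \<in> cartan. l h = 0}" by simp
    qed (use l in \<open>auto simp: cartan_dual_def cartan_def intro: sl12.span_add sl12.span_scale\<close>)
    moreover have "{h1, h2} \<subseteq> cartan" by (auto simp: cartan_def intro: sl12.span_base)
    ultimately have "cartan \<subseteq> {h \<in> cartan. l h = 0}"
      unfolding cartan_def by (intro sl12.span_minimal) auto
    then have "l h = 0" for h using l unfolding cartan_dual_def by (cases "h \<in> cartan") auto
    then show ?thesis by auto
  qed blast
qed

section \<open>Generalized Kac modules\<close>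

lemma parity_involution_nplus:
  assumes "x \<in> nplus"
  shows "parity_involution x \<in> nplus"
proof -
  have sub: "sl12.subspace nplus" by (simp add: nplus_def)
  have "sl12.subspace {x. parity_involution x \<in> nplus}"
    using sl12.subspace_0[OF sub] sl12.subspace_add[OF sub] sl12.subspace_scale[OF sub]
      parity_involution_scale[of 0 0]
    by (intro sl12.subspaceI) (simp_all add: parity_involution_add parity_involution_scale)
  moreover have "{y1, x2, x3} \<subseteq> {x. parity_involution x \<in> nplus}"
    using sl12.span_base[of _ "{y1, x2, x3}"] sl12.span_neg[OF sl12.span_base, of _ "{y1, x2, x3}"]
    by (auto simp: parity_involution_part[OF sl12_part_basis(3)] parity_involution_part[OF sl12_part_basis(5)]
        parity_involution_part[OF sl12_part_basis(2)] nplus_def)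
  ultimately show ?thesis
    using sl12.span_minimal assms unfolding nplus_def by blast
qed

lemma cartan_even: "h \<in> cartan \<Longrightarrow> h \<in> sl12_part 0"
proof -
  have "sl12.subspace (sl12_part 0)"
    by (rule sl12.subspaceI) (simp_all add: sl12_part_0_iff entry_0 entry_add entry_scale)
  then have "cartan \<subseteq> sl12_part 0"
    unfolding cartan_def by (intro sl12.span_minimal) (auto simp: sl12_part_basis)
  then show "h \<in> cartan \<Longrightarrow> h \<in> sl12_part 0" by blast
qed

text \<open>The defining relations are homogeneous or, in the case of \<open>n\<^sup>+\<close>, stable under the involution.\<close>

lemma graded_kac_ideal: "graded_left_ideal (left_ideal (kac_relations l))"
proof (rule graded_left_idealI)
  fix s assume "s \<in> kac_relations l"
  then consider x where "s = uenv_gen x" "x \<in> nplus"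
    | h where "s = uenv_gen h - uenv_scalar (l h)" "h \<in> cartan"
    | n where "s = Y2 ^ (n + 1)" "of_nat n = l h2"
    unfolding kac_relations_def by blast
  then have "parity_aut s \<in> kac_relations l"
  proof cases
    case 1
    then show ?thesis
      using parity_involution_nplus by (simp add: parity_aut_gen kac_relations_def)
  next
    case 2
    then have "parity_aut s = s"
      by (simp add: parity_aut_diff parity_aut_gen parity_aut_scalar parity_involution_part[OF cartan_even])
    then show ?thesis using \<open>s \<in> kac_relations l\<close> by simp
  next
    case 3
    have "parity_aut (Y2 ^ k) = Y2 ^ k" for k
      using parity_aut_scalar[of 1]
      by (induction k) (simp_all add: parity_aut_mult parity_aut_gen parity_involution_part[OF sl12_part_basis(6)])
    then have "parity_aut s = s" by (simp only: 3)
    then show ?thesis using \<open>s \<in> kac_relations l\<close> by simp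
  qed
  then show "parity_aut s \<in> left_ideal (kac_relations l)" by (rule left_ideal.gen)
qed

section \<open>The trivial module\<close>

lemma trivial_module_simps [simp]:
  "carrier trivial_module = UNIV" "\<zero>\<^bsub>trivial_module\<^esub> = 0" "v \<oplus>\<^bsub>trivial_module\<^esub> w = v + w"
  "c \<odot>\<^bsub>trivial_module\<^esub> v = c * v" "grade trivial_module p = (if p = 0 then UNIV else {0})"
  "act trivial_module x v = 0"
  by (simp_all add: trivial_module_def)

lemma abelian_group_trivial_module: "abelian_group trivial_module"
proof (rule abelian_groupI)
  fix x assume "x \<in> carrier trivial_module"
  show "\<exists>y\<in>carrier trivial_module. y \<oplus>\<^bsub>trivial_module\<^esub> x = \<zero>\<^bsub>trivial_module\<^esub>"
    by (rule bexI[of _ "- x"]) simp_all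
qed simp_all

lemma sl12_module_trivial: "sl12_module trivial_module"
proof -
  have module: "Module.module complex_ring trivial_module"
    by (rule moduleI) (simp_all add: cring_complex_ring abelian_group_trivial_module distrib_left distrib_right)
  interpret Module.module complex_ring trivial_module by (rule module)
  have neg: "\<ominus>\<^bsub>trivial_module\<^esub> v = - v" for v
    by (rule minus_equality) simp_all
  show ?thesis
  proof (intro sl12_module.intro module sl12_module_axioms.intro)
    show "submodule (grade trivial_module p) complex_ring trivial_module" for p
      by (rule submoduleI) (auto simp: neg)
    show "\<exists>u\<in>grade trivial_module 0. \<exists>w\<in>grade trivial_module 1. v = u \<oplus>\<^bsub>trivial_module\<^esub> w" for v
      by simp
  qed (auto simp: a_minus_def neg)
qed

lift_definition augmentation :: "uenv \<Rightarrow> complex" is "\<lambda>u. Poly_Mapping.lookup u []"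
  using two_sided_ideal_lookup_Nil by (force simp: uenv_eq_def lookup_minus)

lemma augmentation_add: "augmentation (u + w) = augmentation u + augmentation w"
  by transfer (simp add: lookup_add)

lemma augmentation_mult: "augmentation (u * w) = augmentation u * augmentation w"
  by transfer (rule lookup_Nil_times)

lemma augmentation_scalar: "augmentation (uenv_scalar c) = c"
  by transfer simp

lemma augmentation_gen: "augmentation (uenv_gen x) = 0"
  by (simp add: uenv_gen.abs_eq augmentation.abs_eq lookup_single)

lemma augmentation_diff: "augmentation (u - w) = augmentation u - augmentation w"
  using augmentation_add[of "u - w" w] by simp

text \<open>For the weight zero, \<open>y\<^sub>2\<close> is a relation, and the remaining generators \<open>x\<^sub>1 = [x\<^sub>3, y\<^sub>2]\<close> and
\<open>y\<^sub>3 = [y\<^sub>2, y\<^sub>1]\<close> follow.\<close>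

lemma kac_ideal_zero: "left_ideal (kac_relations (\<lambda>_. 0)) = {u. augmentation u = 0}"
proof
  let ?J = "left_ideal (kac_relations (\<lambda>_. 0))"
  have "uenv_left_ideal {u. augmentation u = 0}"
    using augmentation_scalar[of 0] by unfold_locales (simp_all add: augmentation_add augmentation_mult)
  moreover have "kac_relations (\<lambda>_. 0) \<subseteq> {u. augmentation u = 0}"
    by (auto simp: kac_relations_def augmentation_gen augmentation_diff augmentation_mult augmentation_scalar
        simp flip: uenv_scalar_0)
  ultimately show "?J \<subseteq> {u. augmentation u = 0}" by (rule left_ideal_least)
  interpret uenv_left_ideal ?J by (rule uenv_left_ideal_left_ideal)
  have "{X2, X3, Y1, H1, H2, Y2} \<subseteq> kac_relations (\<lambda>_. 0)"
    by (auto simp: kac_relations_def nplus_def cartan_def intro: sl12.span_base)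
  then have mem: "X2 \<in> ?J" "X3 \<in> ?J" "Y1 \<in> ?J" "H1 \<in> ?J" "H2 \<in> ?J" "Y2 \<in> ?J"
    by (auto intro: left_ideal.gen)
  have "X1 = X3 * Y2 - Y2 * X3" "Y3 = Y2 * Y1 - Y1 * Y2"
    by (simp_all add: even_commutations)
  then have "X1 \<in> ?J" "Y3 \<in> ?J"
    using mem by (metis diff_mem mult_mem)+
  then have gen: "uenv_gen x \<in> ?J" for x
    by (subst sl12_decomp[of x], unfold uenv_gen_add uenv_gen_scale uenv_gen_diff)
      (intro add_mem mult_mem diff_mem mem; assumption)
  have "u - uenv_scalar (augmentation u) \<in> ?J" for u
  proof (induction u rule: uenv_induct)
    case (scalar c)
    show ?case by (simp add: augmentation_scalar zero_mem)
  next
    case (gen_mult x u)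
    have "uenv_gen x * (u - uenv_scalar (augmentation u)) + uenv_scalar (augmentation u) * uenv_gen x \<in> ?J"
      by (intro add_mem mult_mem gen gen_mult)
    then show ?case
      by (simp add: augmentation_mult augmentation_gen right_diff_distrib uenv_scalar_commute)
  next
    case (add u w)
    then show ?case
      using add_mem[of "u - uenv_scalar (augmentation u)" "w - uenv_scalar (augmentation w)"]
      by (simp add: augmentation_add uenv_scalar_add algebra_simps)
  qed
  note reduce = this
  show "{u. augmentation u = 0} \<subseteq> ?J"
  proof
    fix u assume "u \<in> {u. augmentation u = 0}"
    then show "u \<in> ?J" using reduce[of u] by simp
  qed
qed

lemma kac_module_zero: "sl12_isomorphic (kac_module (\<lambda>_. 0)) trivial_module"
proof -
  interpret graded_left_ideal "left_ideal (kac_relations (\<lambda>_. 0))" by (rule graded_kac_ideal)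
  have mem: "u \<in> left_ideal (kac_relations (\<lambda>_. 0)) \<longleftrightarrow> augmentation u = 0" for u
    by (simp add: kac_ideal_zero)
  define f where "f A = augmentation (SOME u. u \<in> A)" for A
  have f: "f (coset u) = augmentation u" for u
  proof -
    have "u \<in> coset u" by (simp add: mem_coset_iff zero_mem)
    then have "(SOME w. w \<in> coset u) \<in> coset u" by (rule someI)
    then show ?thesis by (simp add: f_def mem_coset_iff mem augmentation_diff)
  qed
  have "f \<in> sl12_hom Q trivial_module"
    by (auto simp: sl12_hom_def carrier_Q f augmentation_add augmentation_mult augmentation_scalar augmentation_gen)
  moreover have "bij_betw f (carrier Q) (carrier trivial_module)"
    unfolding bij_betw_def
  proof
    show "inj_on f (carrier Q)"
    proof (rule inj_onI)
      fix A B assume "A \<in> carrier Q" "B \<in> carrier Q" "f A = f B"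
      moreover from this obtain u w where "A = coset u" "B = coset w" by (auto simp: carrier_Q)
      ultimately show "A = B" by (simp add: f coset_eq_iff mem augmentation_diff)
    qed
    have "c = f (coset (uenv_scalar c))" for c by (simp add: f augmentation_scalar)
    then show "f ` carrier Q = carrier trivial_module"
      by (auto intro: image_eqI[of _ _ "coset (uenv_scalar c)" for c])
  qed
  ultimately show ?thesis
    unfolding sl12_isomorphic_def kac_module_def using sl12_module_Q sl12_module_trivial by blast
qed

lemma kac_module_irreducible_iff:
  assumes l: "l \<in> cartan_dual" "l h2 = of_nat (Suc n)"
  shows "irreducible_sl12_module (kac_module l) \<longleftrightarrow> l h1 \<noteq> 0 \<and> l h1 \<noteq> l h2"
proof
  interpret kac l n by standard (rule l)+
  interpret graded: graded_left_ideal J by (rule graded_kac_ideal)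
  show "irreducible_sl12_module (kac_module l)" if "l h1 \<noteq> 0 \<and> l h1 \<noteq> l h2"
    unfolding kac_module_def
    by (rule graded.irreducible_QI) (use that one_notin_kac_ideal[OF l] typical_ideal in blast)+
  assume irr: "irreducible_sl12_module (kac_module l)"
  have "uenv_homogeneous 1 X1" "uenv_homogeneous 1 Y3"
    by (intro uenv_homogeneous_gen sl12_part_basis)+
  then have "\<exists>r. 1 - r * X1 \<in> J" "\<exists>r. 1 - r * Y3 \<in> J"
    using irreducible_imp_generating[OF irr[unfolded kac_module_def]]
      x1_notin_kac_ideal[OF l] y3_notin_kac_ideal[OF l] by blast+
  then show "l h1 \<noteq> 0 \<and> l h1 \<noteq> l h2"
    using x1_not_generating[OF l] y3_not_generating[OF l] by blast
qed

theorem proposition2p4: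
  shows "sl12_isomorphic (kac_module (\<lambda>_. 0)) trivial_module \<and>
    (\<forall>l \<in> Pplus. \<forall>\<kappa> a b :: complex.
       l = (\<lambda>h. \<kappa> * delta h + a * eps1 h + b * eps2 h) \<longrightarrow> l \<noteq> (\<lambda>_. 0) \<longrightarrow>
       (irreducible_sl12_module (kac_module l) \<longleftrightarrow> \<kappa> + a \<noteq> 0 \<and> \<kappa> + b \<noteq> 0))"
proof (intro conjI ballI allI impI)
  show "sl12_isomorphic (kac_module (\<lambda>_. 0)) trivial_module" by (rule kac_module_zero)
  fix l and \<kappa> a b :: complex
  assume "l \<in> Pplus" and l: "l = (\<lambda>h. \<kappa> * delta h + a * eps1 h + b * eps2 h)" and "l \<noteq> (\<lambda>_. 0)"
  then obtain n where n: "l \<in> cartan_dual" "l h2 = of_nat (Suc n)" using Pplus_cases by blast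
  have "h1 \<in> cartan" "h2 \<in> cartan" by (auto simp: cartan_def intro: sl12.span_base)
  then have "l h1 = \<kappa> + a" "l h2 = a - b"
    by (simp_all add: l delta_def eps1_def eps2_def entry_basis)
  then have "l h1 \<noteq> 0 \<longleftrightarrow> \<kappa> + a \<noteq> 0" "l h1 \<noteq> l h2 \<longleftrightarrow> \<kappa> + b \<noteq> 0"
    by (auto simp: algebra_simps add_eq_0_iff)
  then show "irreducible_sl12_module (kac_module l) \<longleftrightarrow> \<kappa> + a \<noteq> 0 \<and> \<kappa> + b \<noteq> 0"
    using kac_module_irreducible_iff[OF n] by blast
qed

end
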